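(* Let $R$ be a regular local ring of dimension two with maximal ideal $\mathfrak m_R$, residue field $\mathfrak k=R/\mathfrak m_R$ and coefficient set $CS$. Let $\nu$ be a valuation of the quotient field of $R$ dominating $R$, let $L=V_\nu/\mathfrak m_\nu$, and for $f\in V_\nu$ let $[f]$ denote the class of $f$ in $L$. Let $x,y$ be regular parameters in $R$. Then there exist $\Omega\in\mathbb Z_{>0}\cup\{\infty\}$ and elements $P_i\in\mathfrak m_R$ for all integers $i\ge 0$ with $i<\min\{\Omega+1,\infty\}$ (that is, $0\le i\le\Omega$ if $\Omega<\infty$, and all $i\ge0$ if $\Omega=\infty$), such that $P_0=x$, $P_1=y$, and for $1\le i<\Omega$ there is an expression $$P_{i+1}=P_i^{n_i}+\sum_{k=1}^{\lambda_i}c_{i,k}P_0^{\sigma_{i,0}(k)}P_1^{\sigma_{i,1}(k)}\cdots P_i^{\sigma_{i,i}(k)}$$ with $n_i\ge1$, $\lambda_i\ge1$, $0\ne c_{i,k}\in CS$ for $1\le k\le\lambda_i$, $\sigma_{i,s}(k)\in\mathbb N$ for all $s,k$, $0\le\sigma_{i,s}(k)<n_s$ for $s\ge1$, and $$n_i\nu(P_i)=\nu\big(P_0^{\sigma_{i,0}(k)}P_1^{\sigma_{i,1}(k)}\cdots P_i^{\sigma_{i,i}(k)}\big)\quad\text{for all }k.$$ Moreover, for all $i\in\mathbb Z_{>0}$ with $i<\Omega$ the following are true. 1) $\nu(P_{i+1})>n_i\nu(P_i)$. 2) Suppose that $r\in\mathbb N$ with $r<\Omega$, $m\in\mathbb Z_{>0}$,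 and $j_k(l)\in\mathbb N$ for $0\le k\le r$, $1\le l\le m$, with $0\le j_k(l)<n_k$ for $1\le k\le r$, are such that the tuples $(j_0(l),j_1(l),\ldots,j_r(l))$ are distinct for $1\le l\le m$ and $\nu(P_0^{j_0(l)}P_1^{j_1(l)}\cdots P_r^{j_r(l)})=\nu(P_0^{j_0(1)}\cdots P_r^{j_r(1)})$ for $1\le l\le m$. Then $$1,\ \left[\frac{P_0^{j_0(2)}P_1^{j_1(2)}\cdots P_r^{j_r(2)}}{P_0^{j_0(1)}P_1^{j_1(1)}\cdots P_r^{j_r(1)}}\right],\ \ldots,\ \left[\frac{P_0^{j_0(m)}P_1^{j_1(m)}\cdots P_r^{j_r(m)}}{P_0^{j_0(1)}P_1^{j_1(1)}\cdots P_r^{j_r(1)}}\right]$$ are linearly independent over $\mathfrak k$. 3) Let $\overline n_i=[G(\nu(P_0),\ldots,\nu(P_i)):G(\nu(P_0),\ldots,\nu(P_{i-1}))]$. Then $\overline n_i$ divides $\sigma_{i,i}(k)$ for all $k$ in the expression for $P_{i+1}$. In particular, $n_i=\overline n_id_i$ with $d_i\in\mathbb Z_{>0}$. 4) There exists $U_i=P_0^{w_0(i)}P_1^{w_1(i)}\cdots P_{i-1}^{w_{i-1}(i)}$ with $w_0(i),\ldots,w_{i-1}(i)\in\mathbb N$ and $0\le w_j(i)<n_j$ for $1\le j\le i-1$ such that $\nu(P_i^{\overline n_i})=\nu(U_i)$ and, if $\alpha_i=\left[\frac{P_i^{\overline n_i}}{U_i}\right]$, then $$b_{i,t}=\left[\sum_{k:\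 \sigma_{i,i}(k)=t\overline n_i}c_{i,k}\frac{P_0^{\sigma_{i,0}(k)}P_1^{\sigma_{i,1}(k)}\cdots P_{i-1}^{\sigma_{i,i-1}(k)}}{U_i^{d_i-t}}\right]\in\mathfrak k(\alpha_1,\ldots,\alpha_{i-1})$$ for $0\le t\le d_i-1$, and $$f_i(u)=u^{d_i}+b_{i,d_i-1}u^{d_i-1}+\cdots+b_{i,0}$$ is the minimal polynomial of $\alpha_i$ over $\mathfrak k(\alpha_1,\ldots,\alpha_{i-1})$. Finally, the sequence terminates at a finite index $\Omega<\infty$ if and only if either $$\overline n_\Omega=[G(\nu(P_0),\ldots,\nu(P_\Omega)):G(\nu(P_0),\ldots,\nu(P_{\Omega-1}))]=\infty,$$ or $\overline n_\Omega<\infty$ (so that $U_\Omega$ and $\alpha_\Omega=[P_\Omega^{\overline n_\Omega}/U_\Omega]$ are defined as in 4)) and $d_\Omega=[\mathfrak k(\alpha_1,\ldots,\alpha_\Omega):\mathfrak k(\alpha_1,\ldots,\alpha_{\Omega-1})]=\infty$. That is, if $\Omega<\infty$ one of these two conditions holds at $\Omega$, and if one of the two conditions holds at some index $i\ge1$ of the sequence (in place of $\Omega$), then $\Omega=i$.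
   Context: $\mathbb N=\{0,1,2,\ldots\}$. A coefficient set of $R$ is a subset $CS\subset R$ with $0,1\in CS$ such that the map $CS\to\mathfrak k$, $s\mapsto$ residue of $s$, is a bijection. $V_\nu$ is the valuation ring of $\nu$, with maximal ideal $\mathfrak m_\nu$; $\nu$ dominates $R$ if $R\subset V_\nu$ and $\mathfrak m_\nu\cap R=\mathfrak m_R$. $G(z_1,\ldots,z_n)$ is the subgroup generated by $z_1,\ldots,z_n$. *)

theory Defs
  imports
    "HOL-Algebra.Algebra"
    "HOL-Library.Extended_Nat"
    "HOL-Computational_Algebra.Group_Closure"
begin

text \<open>Commutative rings are \<^const>\<open>cring\<close> records; value groups are arbitrary types of class
  \<^class>\<open>linordered_ab_group_add\<close>.\<close>

section \<open>Regular local rings\<close>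

definition krull_dim :: "('a, 'b) ring_scheme \<Rightarrow> enat" where
  "krull_dim R = Sup {enat n | n. \<exists>p :: nat \<Rightarrow> 'a set.
     (\<forall>i\<le>n. primeideal (p i) R) \<and> (\<forall>i<n. p i \<subset> p (Suc i))}"

definition local_ring :: "('a, 'b) ring_scheme \<Rightarrow> bool" where
  "local_ring R \<longleftrightarrow> cring R \<and> (\<exists>!M. maximalideal M R)"

definition max_ideal :: "('a, 'b) ring_scheme \<Rightarrow> 'a set" where
  "max_ideal R = (THE M. maximalideal M R)"

definition regular_local_ring :: "('a, 'b) ring_scheme \<Rightarrow> bool" where
  "regular_local_ring R \<longleftrightarrow> noetherian_ring R \<and> local_ring R \<and>
     (\<exists>S. S \<subseteq> carrier R \<and> finite S \<and> Idl\<^bsub>R\<^esub> S = max_ideal R \<and> enat (card S) = krull_dim R)"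

text \<open>Regular parameters of a two-dimensional regular local ring.\<close>

definition regular_parameters :: "('a, 'b) ring_scheme \<Rightarrow> 'a \<Rightarrow> 'a \<Rightarrow> bool" where
  "regular_parameters R x y \<longleftrightarrow>
     x \<in> carrier R \<and> y \<in> carrier R \<and> Idl\<^bsub>R\<^esub> {x, y} = max_ideal R"

definition coefficient_set :: "('a, 'b) ring_scheme \<Rightarrow> 'a set \<Rightarrow> bool" where
  "coefficient_set R CS \<longleftrightarrow> CS \<subseteq> carrier R \<and> \<zero>\<^bsub>R\<^esub> \<in> CS \<and> \<one>\<^bsub>R\<^esub> \<in> CS \<and>
     bij_betw (\<lambda>s. max_ideal R +>\<^bsub>R\<^esub> s) CS (carrier (R Quot max_ideal R))"

text \<open>The quotient field contains the ring as a subring.\<close>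

definition quotient_field :: "'a ring \<Rightarrow> 'a ring \<Rightarrow> bool" where
  "quotient_field K R \<longleftrightarrow> field K \<and> subring (carrier R) K \<and> R = K\<lparr>carrier := carrier R\<rparr> \<and>
     (\<forall>a\<in>carrier K. \<exists>r\<in>carrier R. \<exists>s\<in>carrier R - {\<zero>\<^bsub>R\<^esub>}. a = r \<otimes>\<^bsub>K\<^esub> inv\<^bsub>K\<^esub> s)"

section \<open>Valuations\<close>

text \<open>A valuation is a function on the nonzero elements of the field. Its value at zero is
  irrelevant; the convention that zero has infinite value is built into the definitions below.\<close>

definition valuation :: "'a ring \<Rightarrow> ('a \<Rightarrow> 'g::linordered_ab_group_add) \<Rightarrow> bool" where
  "valuation K \<nu> \<longleftrightarrow>
     (\<forall>a\<in>carrier K - {\<zero>\<^bsub>K\<^esub>}. \<forall>b\<in>carrier K - {\<zero>\<^bsub>K\<^esub>}.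
        \<nu> (a \<otimes>\<^bsub>K\<^esub> b) = \<nu> a + \<nu> b \<and>
        (a \<oplus>\<^bsub>K\<^esub> b \<noteq> \<zero>\<^bsub>K\<^esub> \<longrightarrow> min (\<nu> a) (\<nu> b) \<le> \<nu> (a \<oplus>\<^bsub>K\<^esub> b)))"

definition val_ring :: "'a ring \<Rightarrow> ('a \<Rightarrow> 'g::linordered_ab_group_add) \<Rightarrow> 'a ring" where
  "val_ring K \<nu> = K\<lparr>carrier := {f \<in> carrier K. f \<noteq> \<zero>\<^bsub>K\<^esub> \<longrightarrow> 0 \<le> \<nu> f}\<rparr>"

definition val_ideal :: "'a ring \<Rightarrow> ('a \<Rightarrow> 'g::linordered_ab_group_add) \<Rightarrow> 'a set" where
  "val_ideal K \<nu> = {f \<in> carrier K. f \<noteq> \<zero>\<^bsub>K\<^esub> \<longrightarrow> 0 < \<nu> f}"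

definition dominates :: "'a ring \<Rightarrow> ('a \<Rightarrow> 'g::linordered_ab_group_add) \<Rightarrow> 'a ring \<Rightarrow> bool" where
  "dominates K \<nu> R \<longleftrightarrow>
     carrier R \<subseteq> carrier (val_ring K \<nu>) \<and> val_ideal K \<nu> \<inter> carrier R = max_ideal R"

definition res_field :: "'a ring \<Rightarrow> ('a \<Rightarrow> 'g::linordered_ab_group_add) \<Rightarrow> 'a set ring" where
  "res_field K \<nu> = val_ring K \<nu> Quot val_ideal K \<nu>"

text \<open>The class of an element of the valuation ring. If \<open>f\<close> is outside the valuation ring, this
  coset is not in the carrier of the residue field.\<close>

definition res :: "'a ring \<Rightarrow> ('a \<Rightarrow> 'g::linordered_ab_group_add) \<Rightarrow> 'a \<Rightarrow> 'a set" where
  "res K \<nu> f = val_ideal K \<nu> +>\<^bsub>val_ring K \<nu>\<^esub> f"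

text \<open>The residue field of \<open>R\<close> as a subfield of the residue field of a dominating valuation, that
  is, the image of the embedding \<open>R / m\<^sub>R \<rightarrow> V\<^sub>\<nu> / m\<^sub>\<nu>\<close>.\<close>

definition base_field ::
    "'a ring \<Rightarrow> ('a \<Rightarrow> 'g::linordered_ab_group_add) \<Rightarrow> 'a ring \<Rightarrow> 'a set set" where
  "base_field K \<nu> R = res K \<nu> ` carrier R"

section \<open>Value groups\<close>

definition nat_mult :: "nat \<Rightarrow> 'g \<Rightarrow> 'g::comm_monoid_add" where
  "nat_mult n g = (\<Sum>_<n. g)"

definition group_index :: "'g::ab_group_add set \<Rightarrow> 'g set \<Rightarrow> enat" where
  "group_index G H = (let cosets = (\<lambda>g. (+) g ` H) ` G
     in if finite cosets then enat (card cosets) else \<infinity>)"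

text \<open>\<open>val_index \<nu> P i = [G(\<nu>(P\<^sub>0),\<dots>,\<nu>(P\<^sub>i)) : G(\<nu>(P\<^sub>0),\<dots>,\<nu>(P\<^sub>i\<^sub>-\<^sub>1))]\<close>\<close>

definition val_index :: "('a \<Rightarrow> 'g::linordered_ab_group_add) \<Rightarrow> (nat \<Rightarrow> 'a) \<Rightarrow> nat \<Rightarrow> enat" where
  "val_index \<nu> P i = group_index (group_closure ((\<lambda>j. \<nu> (P j)) ` {..i}))
                                  (group_closure ((\<lambda>j. \<nu> (P j)) ` {..<i}))"

text \<open>The same index as a natural number, meaningful only when it is finite.\<close>

abbreviation nbar :: "('a \<Rightarrow> 'g::linordered_ab_group_add) \<Rightarrow> (nat \<Rightarrow> 'a) \<Rightarrow> nat \<Rightarrow> nat" where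
  "nbar \<nu> P i \<equiv> the_enat (val_index \<nu> P i)"

section \<open>Power products and the residue field tower\<close>

definition power_product :: "'a ring \<Rightarrow> (nat \<Rightarrow> 'a) \<Rightarrow> nat set \<Rightarrow> (nat \<Rightarrow> nat) \<Rightarrow> 'a" where
  "power_product K P I e = (\<Otimes>\<^bsub>K\<^esub>s\<in>I. P s [^]\<^bsub>K\<^esub> e s)"

text \<open>In the following, \<open>w i j\<close> is the exponent of \<open>P\<^sub>j\<close> in \<open>U\<^sub>i\<close>.\<close>

definition U_elem :: "'a ring \<Rightarrow> (nat \<Rightarrow> 'a) \<Rightarrow> (nat \<Rightarrow> nat \<Rightarrow> nat) \<Rightarrow> nat \<Rightarrow> 'a" where
  "U_elem K P w i = power_product K P {..<i} (w i)"

definition alpha :: "'a ring \<Rightarrow> ('a \<Rightarrow> 'g::linordered_ab_group_add) \<Rightarrow>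
    (nat \<Rightarrow> 'a) \<Rightarrow> (nat \<Rightarrow> nat \<Rightarrow> nat) \<Rightarrow> nat \<Rightarrow> 'a set" where
  "alpha K \<nu> P w i = res K \<nu> (P i [^]\<^bsub>K\<^esub> nbar \<nu> P i \<otimes>\<^bsub>K\<^esub> inv\<^bsub>K\<^esub> (U_elem K P w i))"

text \<open>\<open>tower K \<nu> R P w i\<close> is the field obtained by adjoining \<open>\<alpha>\<^sub>1,\<dots>,\<alpha>\<^sub>i\<close> to the residue field
  of \<open>R\<close>.\<close>

definition tower :: "'a ring \<Rightarrow> ('a \<Rightarrow> 'g::linordered_ab_group_add) \<Rightarrow> 'a ring \<Rightarrow>
    (nat \<Rightarrow> 'a) \<Rightarrow> (nat \<Rightarrow> nat \<Rightarrow> nat) \<Rightarrow> nat \<Rightarrow> 'a set set" where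
  "tower K \<nu> R P w i =
     generate_field (res_field K \<nu>) (base_field K \<nu> R \<union> alpha K \<nu> P w ` {1..i})"

text \<open>Minimal polynomial, with polynomials as coefficient lists starting from the leading
  coefficient. The algebraicity requirement is needed since \<^const>\<open>ring.Irr\<close> is a definite
  description.\<close>

definition minimal_polynomial ::
    "('b, 'c) ring_scheme \<Rightarrow> 'b set \<Rightarrow> 'b \<Rightarrow> 'b list \<Rightarrow> bool" where
  "minimal_polynomial L F a p \<longleftrightarrow> ring.algebraic L F a \<and> ring.Irr L F a = p"

text \<open>The condition under which the sequence stops at index \<open>i\<close>.\<close>

definition stops_at :: "'a ring \<Rightarrow> ('a \<Rightarrow> 'g::linordered_ab_group_add) \<Rightarrow> 'a ring \<Rightarrow>
    (nat \<Rightarrow> 'a) \<Rightarrow> (nat \<Rightarrow> nat \<Rightarrow> nat) \<Rightarrow> nat \<Rightarrow> bool" where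
  "stops_at K \<nu> R P w i \<longleftrightarrow> val_index \<nu> P i = \<infinity> \<or>
     (val_index \<nu> P i < \<infinity> \<and>
      ring.infinite_dimension (res_field K \<nu>) (tower K \<nu> R P w (i - 1)) (tower K \<nu> R P w i))"

end

theory Submission
  imports Defs
begin

text \<open>Write \<open>n\<^sub>i = nbar\<^sub>i d\<^sub>i\<close>, where \<open>d\<^sub>i\<close> is the degree of \<open>\<alpha>\<^sub>i\<close> over \<open>k(\<alpha>\<^sub>1,\<dots>,\<alpha>\<^sub>i\<^sub>-\<^sub>1)\<close>, and call
  a monomial in \<open>P\<^sub>0,\<dots>,P\<^sub>i\<close> reduced if the exponent of \<open>P\<^sub>s\<close> is less than \<open>n\<^sub>s\<close> for \<open>s \<ge> 1\<close>. If \<open>h\<close> is a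
  quotient of monomials, then the residues of \<open>M/h\<close>, for the reduced monomials \<open>M\<close> of value \<open>\<nu> h\<close>, are
  linearly independent over \<open>k\<close>, and if \<open>\<nu> h\<close> is large enough, they span \<open>k(\<alpha>\<^sub>1,\<dots>,\<alpha>\<^sub>i)\<close>: the value
  determines the exponent of \<open>P\<^sub>i\<close> modulo \<open>nbar\<^sub>i\<close>, and the remaining \<open>d\<^sub>i\<close> choices for it correspond to
  the basis \<open>1,\<alpha>\<^sub>i,\<dots>,\<alpha>\<^sub>i\<^sup>d\<^sup>-\<^sup>1\<close> of \<open>k(\<alpha>\<^sub>1,\<dots>,\<alpha>\<^sub>i)\<close> over \<open>k(\<alpha>\<^sub>1,\<dots>,\<alpha>\<^sub>i\<^sub>-\<^sub>1)\<close>. Spanning yields \<open>U\<^sub>i\<close> and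
  lifts of the coefficients of the minimal polynomial of \<open>\<alpha>\<^sub>i\<close>, from which \<open>P\<^sub>i\<^sub>+\<^sub>1\<close> is assembled. It does not
  vanish because modulo \<open>x\<close> it is a power of \<open>y\<close>, and in dimension two no power of \<open>y\<close> is a multiple of \<open>x\<close>.\<close>

text \<open>The exponent of P_0 is unbounded but must be a natural number, which is why spanning
  needs a lower bound on the value. The bound is the value of the monomial in P_1,...,P_i with all
  exponents n_s - 1: above it, enough value for P_0 remains whatever reduced powers of the others
  are split off. Since \<nu>(P_(s+1)) > n_s \<nu>(P_s) for all earlier s, the value of P_(i+1)
  exceeds this bound, so every positive multiple of \<nu>(P_(i+1)) is in the spanning range. The
  same estimate shows that each correction term of P_(i+1) contains x = P_0: without P_0, a reduced
  monomial in P_1,...,P_i has value below n_i \<nu>(P_i). Hence only P_i^(n_i) survives modulo x,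
  and a power of y remains at every stage. The jump in value comes from the relation f_i(\<alpha>_i)
  = 0: it says that P_(i+1) / U_i^(d_i) has residue zero. Each choice involves all earlier ones, so
  the conditions at an index are formulated to depend on an initial segment of the sequence, and the
  sequence comes from dependent choice.\<close>

section \<open>Cyclic extensions of subgroups\<close>

lemma nat_mult_0 [simp]: "nat_mult 0 g = 0"
  and nat_mult_Suc [simp]: "nat_mult (Suc n) g = nat_mult n g + g"
  by (simp_all add: nat_mult_def)

lemma nat_mult_add: "nat_mult (m + n) g = nat_mult m g + nat_mult n g"
  by (induction n) (simp_all add: add.assoc)

lemma nat_mult_mult: "nat_mult (m * n) g = nat_mult m (nat_mult n g)"
  by (induction m) (simp_all add: nat_mult_add add.commute)

lemma nat_mult_in:
  assumes "0 \<in> A" "\<And>a b. a \<in> A \<Longrightarrow> b \<in> A \<Longrightarrow> a + b \<in> A" "g \<in> A"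
  shows "nat_mult n g \<in> A"
  using assms by (induction n) auto

lemma coset_eq_iff:
  fixes A :: "'g::ab_group_add set"
  assumes "0 \<in> A" and diff: "\<And>a b. a \<in> A \<Longrightarrow> b \<in> A \<Longrightarrow> a - b \<in> A"
  shows "(+) g ` A = (+) h ` A \<longleftrightarrow> g - h \<in> A"
proof
  assume "(+) g ` A = (+) h ` A"
  then have "g + 0 \<in> (+) h ` A" using assms(1) by blast
  then show "g - h \<in> A" by auto
next
  assume gh: "g - h \<in> A"
  have hg: "h - g \<in> A" using diff[OF assms(1) gh] by simp
  have sub: "(+) u ` A \<subseteq> (+) v ` A" if "v - u \<in> A" for u v
  proof (rule image_subsetI)
    fix a assume "a \<in> A"
    then have "a - (v - u) \<in> A" using diff that by blast
    moreover have "u + a = v + (a - (v - u))" by (simp add: algebra_simps)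
    ultimately show "u + a \<in> (+) v ` A" by blast
  qed
  show "(+) g ` A = (+) h ` A" using sub[OF gh] sub[OF hg] by blast
qed

text \<open>The quotient B/A is cyclic, generated by the class of g. Its order is the least positive
  k with k g in A; if there is no such k, the classes of the multiples of g are pairwise
  different.\<close>

lemma group_index_cyclic:
  fixes A B :: "'g::ab_group_add set"
  assumes zero: "0 \<in> A" and diff: "\<And>a b. a \<in> A \<Longrightarrow> b \<in> A \<Longrightarrow> a - b \<in> A"
    and B: "B = {a + nat_mult m g - nat_mult k g | a m k. a \<in> A}"
  shows "group_index B A < \<infinity> \<longleftrightarrow> (\<exists>k>0. nat_mult k g \<in> A)"
    and "group_index B A < \<infinity> \<Longrightarrow> 0 < the_enat (group_index B A) \<and>
      (\<forall>k. nat_mult k g \<in> A \<longleftrightarrow> the_enat (group_index B A) dvd k)"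
proof -
  define C where "C = (\<lambda>g. (+) g ` A) ` B"
  have ceq: "(+) g ` A = (+) h ` A \<longleftrightarrow> g - h \<in> A" for g h
    by (rule coset_eq_iff[OF zero diff])
  have neg: "- a \<in> A" if "a \<in> A" for a using diff[OF zero that] by simp
  have add: "a + b \<in> A" if "a \<in> A" "b \<in> A" for a b using diff[OF that(1) neg[OF that(2)]] by simp
  have gB: "nat_mult k g \<in> B" for k
  proof -
    have "nat_mult k g = 0 + nat_mult k g - nat_mult 0 g" by simp
    then show ?thesis unfolding B using zero by blast
  qed
  have mult: "nat_mult k a \<in> A" if "a \<in> A" for k a
    by (rule nat_mult_in) (use zero add that in auto)
  have fin: "(\<exists>k>0. nat_mult k g \<in> A)" if "finite C"
  proof -
    have "range (\<lambda>k. (+) (nat_mult k g) ` A) \<subseteq> C" unfolding C_def using gB by auto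
    then have "finite (range (\<lambda>k. (+) (nat_mult k g) ` A))" using that finite_subset by blast
    then have "\<not> inj (\<lambda>k. (+) (nat_mult k g) ` A)" using finite_imageD infinite_UNIV_nat by blast
    then obtain k l where "k \<noteq> l" "(+) (nat_mult k g) ` A = (+) (nat_mult l g) ` A"
      unfolding inj_def by blast
    then obtain k l where kl: "k > l" "(+) (nat_mult k g) ` A = (+) (nat_mult l g) ` A"
      by (cases "k > l") (auto simp: not_less le_less)
    then have "nat_mult k g - nat_mult l g \<in> A" using ceq by blast
    moreover have "nat_mult k g = nat_mult (k - l) g + nat_mult l g"
      using kl by (simp flip: nat_mult_add)
    ultimately show ?thesis using kl by (intro exI[of _ "k - l"]) auto
  qed
  have main: "finite C \<and> card C > 0 \<and> (\<forall>k. nat_mult k g \<in> A \<longleftrightarrow> card C dvd k)"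
    if ex: "\<exists>k>0. nat_mult k g \<in> A"
  proof -
    define N where "N = (LEAST k. k > 0 \<and> nat_mult k g \<in> A)"
    have N: "N > 0" "nat_mult N g \<in> A" using LeastI_ex[OF ex] unfolding N_def by auto
    have least: "N \<le> k" if "k > 0" "nat_mult k g \<in> A" for k
      unfolding N_def using that by (intro Least_le) auto
    have dvdN: "nat_mult k g \<in> A \<longleftrightarrow> N dvd k" for k
    proof
      assume "N dvd k"
      then obtain q where "k = q * N" by (metis dvd_def mult.commute)
      then show "nat_mult k g \<in> A" using mult[OF N(2)] by (simp add: nat_mult_mult)
    next
      assume k: "nat_mult k g \<in> A"
      have "nat_mult k g = nat_mult (k div N) (nat_mult N g) + nat_mult (k mod N) g"
        by (simp flip: nat_mult_add nat_mult_mult)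
      then have "nat_mult (k mod N) g = nat_mult k g - nat_mult (k div N) (nat_mult N g)" by simp
      then have "nat_mult (k mod N) g \<in> A" using diff[OF k mult[OF N(2)]] by simp
      then have "k mod N = 0" using least[of "k mod N"] N(1) mod_less_divisor[OF N(1), of k] by linarith
      then show "N dvd k" by auto
    qed
    have CN: "C = (\<lambda>k. (+) (nat_mult k g) ` A) ` {..<N}"
    proof
      show "(\<lambda>k. (+) (nat_mult k g) ` A) ` {..<N} \<subseteq> C" unfolding C_def using gB by auto
      show "C \<subseteq> (\<lambda>k. (+) (nat_mult k g) ` A) ` {..<N}"
      proof
        fix c assume "c \<in> C"
        then obtain a m k where a: "a \<in> A" and c: "c = (+) (a + nat_mult m g - nat_mult k g) ` A"
          unfolding C_def B by auto
        \<comment> \<open>Only natural multiples are available: (N - 1) k replaces -k, because N g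
          lies in A.\<close>
        let ?j = "(m + (N - 1) * k) mod N"
        have "nat_mult (m + (N - 1) * k) g
            = nat_mult ((m + (N - 1) * k) div N) (nat_mult N g) + nat_mult ?j g"
          by (simp flip: nat_mult_add nat_mult_mult)
        moreover have "nat_mult (m + (N - 1) * k) g + nat_mult k g = nat_mult m g + nat_mult k (nat_mult N g)"
        proof -
          have "m + (N - 1) * k + k = m + k * N" using N(1) by (cases N) auto
          then show ?thesis by (metis nat_mult_add nat_mult_mult)
        qed
        moreover have "a + u - v - w = a + y - z"
          if "x = y + w" "x + v = u + z" for x y z u v w :: 'g
        proof -
          have "u = x + v - z" using that(2) by (simp add: eq_diff_eq)
          then show ?thesis using that(1) by (simp add: algebra_simps)
        qed
        ultimately have "a + nat_mult m g - nat_mult k g - nat_mult ?j g =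
            a + nat_mult ((m + (N - 1) * k) div N) (nat_mult N g) - nat_mult k (nat_mult N g)"
          by blast
        also have "\<dots> \<in> A" using a mult[OF N(2)] add diff by auto
        finally have "c = (+) (nat_mult ?j g) ` A" using c ceq by blast
        then show "c \<in> (\<lambda>k. (+) (nat_mult k g) ` A) ` {..<N}" using N(1) by auto
      qed
    qed
    have "inj_on (\<lambda>k. (+) (nat_mult k g) ` A) {..<N}"
    proof (rule linorder_inj_onI)
      fix k l assume kl: "k < l" "k \<in> {..<N}" "l \<in> {..<N}"
      show "(+) (nat_mult k g) ` A \<noteq> (+) (nat_mult l g) ` A"
      proof
        assume "(+) (nat_mult k g) ` A = (+) (nat_mult l g) ` A"
        then have "nat_mult l g - nat_mult k g \<in> A" using ceq by metis
        moreover have "nat_mult l g = nat_mult (l - k) g + nat_mult k g"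
          using kl by (simp flip: nat_mult_add)
        ultimately have "nat_mult (l - k) g \<in> A" by auto
        then show False using least[of "l - k"] kl by auto
      qed
    qed auto
    then have "card C = N" unfolding CN by (simp add: card_image)
    then show ?thesis using N dvdN CN by auto
  qed
  have gi: "group_index B A = (if finite C then enat (card C) else \<infinity>)"
    unfolding group_index_def C_def Let_def by simp
  show "group_index B A < \<infinity> \<longleftrightarrow> (\<exists>k>0. nat_mult k g \<in> A)"
  proof -
    have "finite C \<longleftrightarrow> (\<exists>k>0. nat_mult k g \<in> A)" using fin main by blast
    then show ?thesis unfolding gi by simp
  qed
  show "0 < the_enat (group_index B A) \<and> (\<forall>k. nat_mult k g \<in> A \<longleftrightarrow> the_enat (group_index B A) dvd k)"
    if "group_index B A < \<infinity>"
  proof -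
    have "finite C" using that unfolding gi by (simp split: if_splits)
    then show ?thesis unfolding gi using main[OF fin] by simp
  qed
qed

section \<open>Polynomials as sums\<close>

lemma (in ring) eval_eq_finsum:
  assumes "set p \<subseteq> carrier R" "x \<in> carrier R"
  shows "eval p x = (\<Oplus>e\<in>{..<length p}. coeff p e \<otimes> x [^] e)"
  using assms(1)
proof (induction p)
  case (Cons a p)
  have c: "coeff p i \<in> carrier R" for i using Cons.prems by (intro coeff_in_carrier) auto
  have "eval (a # p) x = a \<otimes> x [^] length p \<oplus> (\<Oplus>e\<in>{..<length p}. coeff p e \<otimes> x [^] e)"
    using Cons by simp
  also have "\<dots> = (\<Oplus>e\<in>{..<Suc (length p)}. coeff (a # p) e \<otimes> x [^] e)"
  proof -
    have "(\<Oplus>e\<in>{..<length p}. coeff p e \<otimes> x [^] e) = (\<Oplus>e\<in>{..<length p}. coeff (a # p) e \<otimes> x [^] e)"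
      using assms(2) c by (intro finsum_cong') auto
    then show ?thesis
      using Cons.prems assms(2) c by (subst lessThan_Suc) (subst finsum_insert, auto)
  qed
  finally show ?case by simp
qed simp

text \<open>Coefficient lists start with the leading coefficient, hence the reversed range of
  exponents.\<close>

lemma (in ring) coeff_map_rev:
  assumes "i < n"
  shows "coeff (map g (rev [0..<n])) i = g i"
  using assms by (subst coeff_nth) (auto simp: rev_nth)

text \<open>Below the degree of the minimal polynomial the powers of x are independent over K. The
  list \<open>Ks\<close> may begin with zeros and then is not a normalized polynomial, so the
  independence of \<open>exp_base\<close> is applied instead of the minimality of
  \<open>Irr\<close>.\<close>

lemma (in domain) exp_base_finsum_unique:
  assumes K: "subfield K R" and x: "x \<in> carrier R" "algebraic K x"
    and d: "d = degree (Irr K x)"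
    and g: "\<And>e. e < d \<Longrightarrow> g e \<in> K" and eq: "(\<Oplus>e\<in>{..<d}. g e \<otimes> x [^] e) = \<zero>"
  shows "\<forall>e<d. g e = \<zero>"
proof (intro allI impI)
  fix e assume e: "e < d"
  define Ks where "Ks = map g (rev [0..<d])"
  have KR: "K \<subseteq> carrier R" by (rule subfieldE(3)[OF K])
  have Ks: "set Ks \<subseteq> K" "length Ks = d" unfolding Ks_def using g by auto
  have "eval Ks x = (\<Oplus>e\<in>{..<d}. coeff Ks e \<otimes> x [^] e)"
    using Ks KR x(1) by (subst eval_eq_finsum) auto
  also have "\<dots> = (\<Oplus>e\<in>{..<d}. g e \<otimes> x [^] e)"
    unfolding Ks_def using g KR x by (intro finsum_cong') (auto simp: coeff_map_rev)
  finally have "combine Ks (exp_base x d) = \<zero>"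
    using combine_eq_eval[of Ks x] Ks eq by simp
  then have "set (take (length (exp_base x d)) Ks) \<subseteq> {\<zero>}"
    using independent_imp_trivial_combine[OF K _ Ks(1)] exp_base_independent[OF K x(1), unfolded over_def, OF x(2)]
    unfolding d by auto
  moreover have "length (exp_base x d) = d" by (simp add: exp_base_def)
  ultimately show "g e = \<zero>" using e unfolding Ks_def by (auto simp: image_subset_iff)
qed

lemma (in domain) simple_extension_finsum:
  assumes K: "subfield K R" and x: "x \<in> carrier R" "algebraic K x"
    and d: "d = degree (Irr K x)" and f: "f \<in> simple_extension K x"
  obtains g where "\<And>e. g e \<in> K" "f = (\<Oplus>e\<in>{..<d}. g e \<otimes> x [^] e)"
proof -
  have KR: "K \<subseteq> carrier R" by (rule subfieldE(3)[OF K])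
  have "f \<in> Span K (exp_base x d)"
    using Span_exp_base[OF K x(1)] x(2) f d by (simp add: over_def)
  then obtain Ks where Ks: "set Ks \<subseteq> K" "length Ks = length (exp_base x d)" "f = combine Ks (exp_base x d)"
    using equalityD1[OF Span_eq_combine_set_length_version[OF K exp_base_closed[OF x(1)], of d], THEN subsetD]
    by blast
  have "length (exp_base x d) = d" by (simp add: exp_base_def)
  note Ks = Ks(1) trans[OF Ks(2) this] Ks(3)
  have "f = eval Ks x" using combine_eq_eval[of Ks x] unfolding Ks(2,3) .
  also have "\<dots> = (\<Oplus>e\<in>{..<d}. coeff Ks e \<otimes> x [^] e)"
    using Ks KR x(1) by (subst eval_eq_finsum) auto
  finally have "f = (\<Oplus>e\<in>{..<d}. coeff Ks e \<otimes> x [^] e)" .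
  moreover have "coeff Ks e \<in> K" for e
  proof -
    have "coeff Ks e \<in> set Ks \<union> {\<zero>}" using coeff_img(3)[of Ks] by blast
    then show ?thesis using Ks(1) subringE(2)[OF subfieldE(1)[OF K]] by auto
  qed
  ultimately show ?thesis using that by blast
qed

text \<open>The constant coefficient of a minimal polynomial does not vanish, because otherwise the
  polynomial would be divisible by the variable.\<close>

lemma (in domain) Irr_expansion:
  assumes K: "subfield K R" and x: "x \<in> carrier R" "x \<noteq> \<zero>" "algebraic K x"
    and d: "d = degree (Irr K x)"
  defines "b \<equiv> coeff (Irr K x)"
  shows "0 < d" and "\<And>t. b t \<in> K" and "Irr K x = \<one> # map b (rev [0..<d])"
    and "x [^] d \<oplus> (\<Oplus>t\<in>{..<d}. b t \<otimes> x [^] t) = \<zero>" and "b 0 \<noteq> \<zero>"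
proof -
  let ?p = "Irr K x"
  have KR: "K \<subseteq> carrier R" by (rule subfieldE(3)[OF K])
  note I = IrrE[OF K x(1), unfolded over_def, OF x(3)]
  have ne: "?p \<noteq> []" using I(2) unfolding ring_irreducible_def univ_poly_zero by auto
  then obtain ps where ps: "?p = \<one> # ps" using I(3) by (cases ?p) auto
  have dps: "d = length ps" using d ps by simp
  have psK: "set ps \<subseteq> K" using I(1) ps unfolding univ_poly_def polynomial_def by auto
  have bps: "b t = coeff ps t" if "t < d" for t using that unfolding b_def ps dps by simp
  have "map b (rev [0..<d]) = map (coeff ps) (rev [0..<d])" using bps by auto
  then show "?p = \<one> # map b (rev [0..<d])" unfolding ps dps using coeff_list[of ps] by simp
  show bK: "b t \<in> K" for t
  proof -
    have "b t \<in> set ?p \<union> {\<zero>}" unfolding b_def using coeff_img(3)[of ?p] by blast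
    then show ?thesis using psK ps subringE(2,3)[OF subfieldE(1)[OF K]] by auto
  qed
  have ev: "\<one> \<otimes> x [^] d \<oplus> eval ps x = \<zero>" using I(4) unfolding ps dps by simp
  have "eval ps x = (\<Oplus>t\<in>{..<d}. coeff ps t \<otimes> x [^] t)"
    using psK KR x(1) dps by (subst eval_eq_finsum) auto
  also have "\<dots> = (\<Oplus>t\<in>{..<d}. b t \<otimes> x [^] t)"
    using bps bK KR x(1) by (intro finsum_cong') auto
  finally have evps: "eval ps x = (\<Oplus>t\<in>{..<d}. b t \<otimes> x [^] t)" .
  show sum: "x [^] d \<oplus> (\<Oplus>t\<in>{..<d}. b t \<otimes> x [^] t) = \<zero>"
    using ev x(1) unfolding evps by simp
  show d0: "0 < d"
  proof (rule ccontr)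
    assume "\<not> 0 < d" then show False using sum by simp
  qed
  show "b 0 \<noteq> \<zero>"
  proof
    assume b0: "b 0 = \<zero>"
    \<comment> \<open>Dropping the last entry of the coefficient list divides by the variable when
      the constant term is zero. As x is nonzero, the quotient still has the root x, but smaller
      degree.\<close>
    define qs where "qs = butlast ?p"
    have last: "?p = qs @ [\<zero>]"
    proof -
      have "last ?p = coeff ?p 0" using ne by (subst coeff_nth) (auto simp: last_conv_nth)
      then show ?thesis using b0 ne append_butlast_last_id[OF ne] unfolding qs_def b_def by simp
    qed
    have qsne: "qs \<noteq> []" "hd qs = \<one>"
    proof -
      show "qs \<noteq> []" using last ps by auto
      then show "hd qs = \<one>" using last ps by (cases qs) auto
    qed
    have qsK: "set qs \<subseteq> K" using psK ps last subringE(3)[OF subfieldE(1)[OF K]]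
      unfolding qs_def by (auto dest: in_set_butlastD)
    have "eval ?p x = eval qs x \<otimes> x \<oplus> \<zero>"
      unfolding last using eval_append_aux[of qs \<zero> x] qsK KR x(1) by auto
    moreover have "eval qs x \<in> carrier R" using qsK KR x(1) by (intro eval_in_carrier) auto
    ultimately have "eval qs x = \<zero>" using I(4) x integral by auto
    moreover have q: "qs \<in> carrier (K[X])" using qsK qsne unfolding univ_poly_def polynomial_def by auto
    ultimately have "?p pdivides qs" using Irr_minimal[OF K x(1), unfolded over_def, OF x(3) q] by simp
    then have "degree ?p \<le> degree qs"
      using pdivides_imp_degree_le[OF subfieldE(1)[OF K] I(1) q qsne(1)] by blast
    moreover have "degree ?p = Suc (degree qs)" using last qsne(1) by (cases qs) auto
    ultimately show False by simp
  qed
qed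

section \<open>Valued fields\<close>

locale valued_field = field K for K :: "'a ring" (structure) +
  fixes \<nu> :: "'a \<Rightarrow> 'g::linordered_ab_group_add"
  assumes valuation: "valuation K \<nu>"
begin

abbreviation "V \<equiv> carrier (val_ring K \<nu>)"
abbreviation "L \<equiv> res_field K \<nu>"
abbreviation "rs \<equiv> res K \<nu>"
abbreviation L_mult (infixl \<open>\<otimes>\<^sub>L\<close> 70) where "a \<otimes>\<^sub>L b \<equiv> a \<otimes>\<^bsub>res_field K \<nu>\<^esub> b"
abbreviation L_add (infixl \<open>\<oplus>\<^sub>L\<close> 65) where "a \<oplus>\<^sub>L b \<equiv> a \<oplus>\<^bsub>res_field K \<nu>\<^esub> b"

text \<open>The value of zero is arbitrary, so the rules for \<nu> hold only on nonzero elements.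
  Membership in this set is what the simplifier tracks.\<close>

definition nz :: "'a set" where "nz = carrier K - {\<zero>}"

lemma nzD [simp]: "a \<in> nz \<Longrightarrow> a \<in> carrier K" "a \<in> nz \<Longrightarrow> a \<noteq> \<zero>"
  by (simp_all add: nz_def)

lemma nz_closed [simp, intro]:
  "\<one> \<in> nz" "a \<in> nz \<Longrightarrow> b \<in> nz \<Longrightarrow> a \<otimes> b \<in> nz" "a \<in> nz \<Longrightarrow> inv a \<in> nz"
  "a \<in> nz \<Longrightarrow> a [^] (k::nat) \<in> nz" "a \<in> nz \<Longrightarrow> \<ominus> a \<in> nz"
proof -
  show one: "\<one> \<in> nz" by (simp add: nz_def del: nzD)
  show mult: "a \<otimes> b \<in> nz" if "a \<in> nz" "b \<in> nz" for a b
    using that integral by (force simp: nz_def simp del: nzD)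
  show "inv a \<in> nz" if "a \<in> nz"
  proof -
    have "inv a \<in> Units K" using that field_Units Units_inv_Units unfolding nz_def by simp
    then show ?thesis using field_Units unfolding nz_def by simp
  qed
  show "a [^] k \<in> nz" if "a \<in> nz"
    using that one mult by (induction k) auto
  show "\<ominus> a \<in> nz" if "a \<in> nz"
    using that a_inv_closed minus_minus minus_zero unfolding nz_def by (metis Diff_iff singletonD singletonI)
qed

lemma nz_Units: "a \<in> nz \<Longrightarrow> a \<in> Units K"
  using field_Units by (auto simp: nz_def simp del: nzD)

lemma nz_inv [simp]: "a \<in> nz \<Longrightarrow> inv a \<otimes> a = \<one>" "a \<in> nz \<Longrightarrow> a \<otimes> inv a = \<one>"
  using nz_Units Units_l_inv Units_r_inv by auto

lemma inv_closed [simp]: "a \<in> nz \<Longrightarrow> inv a \<in> carrier K"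
  by simp

lemma inv_inv_nz [simp]: "a \<in> nz \<Longrightarrow> inv (inv a) = a"
  using nz_Units by simp

lemma inv_mult_nz: "a \<in> nz \<Longrightarrow> b \<in> nz \<Longrightarrow> inv (a \<otimes> b) = inv a \<otimes> inv b"
  
proof -
  assume ab: "a \<in> nz" "b \<in> nz"
  have "(a \<otimes> b) \<otimes> (inv a \<otimes> inv b) = (a \<otimes> inv a) \<otimes> (b \<otimes> inv b)"
    using ab by (simp add: m_ac del: nz_inv)
  then show ?thesis using ab comm_inv_char[of "a \<otimes> b" "inv a \<otimes> inv b"] by simp
qed

lemma \<nu>_mult [simp]: "a \<in> nz \<Longrightarrow> b \<in> nz \<Longrightarrow> \<nu> (a \<otimes> b) = \<nu> a + \<nu> b"
  and \<nu>_add: "a \<in> nz \<Longrightarrow> b \<in> nz \<Longrightarrow> a \<oplus> b \<noteq> \<zero> \<Longrightarrow> min (\<nu> a) (\<nu> b) \<le> \<nu> (a \<oplus> b)"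
  using valuation unfolding valuation_def nz_def by blast+

lemma \<nu>_one [simp]: "\<nu> \<one> = 0"
  using \<nu>_mult[of \<one> \<one>] by simp

lemma \<nu>_inv [simp]: "a \<in> nz \<Longrightarrow> \<nu> (inv a) = - \<nu> a"
  using \<nu>_mult[of a "inv a"] by (simp add: eq_neg_iff_add_eq_0 add.commute)

lemma \<nu>_pow [simp]: "a \<in> nz \<Longrightarrow> \<nu> (a [^] (k::nat)) = nat_mult k (\<nu> a)"
  by (induction k) auto

lemma \<nu>_minus [simp]: "a \<in> nz \<Longrightarrow> \<nu> (\<ominus> a) = \<nu> a"
proof -
  assume a: "a \<in> nz"
  have "\<ominus> \<one> \<otimes> \<ominus> \<one> = \<one>" by algebra
  then have "\<nu> (\<ominus> \<one>) + \<nu> (\<ominus> \<one>) = 0" using \<nu>_mult[of "\<ominus> \<one>" "\<ominus> \<one>"] by simp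
  then have "\<nu> (\<ominus> \<one>) = 0" by simp
  moreover have "\<ominus> a = \<ominus> \<one> \<otimes> a" using a by (simp add: l_minus)
  ultimately show ?thesis using a \<nu>_mult[of "\<ominus> \<one>" a] by simp
qed

lemma V_iff: "f \<in> V \<longleftrightarrow> f \<in> carrier K \<and> (f \<noteq> \<zero> \<longrightarrow> 0 \<le> \<nu> f)"
  by (simp add: val_ring_def)

lemma val_ideal_iff: "f \<in> val_ideal K \<nu> \<longleftrightarrow> f \<in> carrier K \<and> (f \<noteq> \<zero> \<longrightarrow> 0 < \<nu> f)"
  by (simp add: val_ideal_def)

lemma V_ops: "a \<otimes>\<^bsub>val_ring K \<nu>\<^esub> b = a \<otimes> b" "a \<oplus>\<^bsub>val_ring K \<nu>\<^esub> b = a \<oplus> b"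
  "\<one>\<^bsub>val_ring K \<nu>\<^esub> = \<one>" "\<zero>\<^bsub>val_ring K \<nu>\<^esub> = \<zero>"
  by (simp_all add: val_ring_def)

lemma V_subring: "subring V K"
proof (rule subringI)
  show "V \<subseteq> carrier K" "\<one> \<in> V" by (auto simp: V_iff)
  show "\<ominus> h \<in> V" if "h \<in> V" for h
    using that \<nu>_minus[of h] by (cases "h = \<zero>") (auto simp: V_iff nz_def simp del: nzD)
  show "a \<otimes> b \<in> V" if "a \<in> V" "b \<in> V" for a b
    using that \<nu>_mult[of a b] by (cases "a = \<zero>"; cases "b = \<zero>") (auto simp: V_iff nz_def simp del: nzD)
  show "a \<oplus> b \<in> V" if "a \<in> V" "b \<in> V" for a b
    using that \<nu>_add[of a b] by (cases "a = \<zero>"; cases "b = \<zero>") (auto simp: V_iff nz_def min_def simp del: nzD split: if_splits)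
qed

lemma V_cring: "cring (val_ring K \<nu>)"
proof -
  have "val_ring K \<nu> = K\<lparr>carrier := V\<rparr>" by (simp add: val_ring_def)
  moreover have "cring (K\<lparr>carrier := V\<rparr>)"
    using subcring_iff[of V] subcringI'[OF V_subring] subringE(1)[OF V_subring] by simp
  ultimately show ?thesis by simp
qed

lemma V_closed [simp, intro]:
  "\<one> \<in> V" "\<zero> \<in> V" "a \<in> V \<Longrightarrow> \<ominus> a \<in> V" "a \<in> V \<Longrightarrow> b \<in> V \<Longrightarrow> a \<otimes> b \<in> V"
  "a \<in> V \<Longrightarrow> b \<in> V \<Longrightarrow> a \<oplus> b \<in> V" "a \<in> V \<Longrightarrow> a \<in> carrier K"
  using subringE[OF V_subring] by auto

lemma V_pow [simp, intro]: "a \<in> V \<Longrightarrow> a [^] (k::nat) \<in> V"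
  by (induction k) auto

lemma V_a_inv: "a \<in> V \<Longrightarrow> \<ominus>\<^bsub>val_ring K \<nu>\<^esub> a = \<ominus> a"
proof -
  assume a: "a \<in> V"
  interpret V: cring "val_ring K \<nu>" by (rule V_cring)
  have "\<ominus> a \<oplus>\<^bsub>val_ring K \<nu>\<^esub> a = \<zero>\<^bsub>val_ring K \<nu>\<^esub>" using a by (simp add: V_ops l_neg)
  then show ?thesis using V.minus_equality[of "\<ominus> a" a] a by simp
qed

text \<open>An ideal of the valuation ring that is not contained in this one has an element of value
  zero; the inverse of that element also has value zero, so the ideal contains one.\<close>

lemma val_ideal_maximal: "maximalideal (val_ideal K \<nu>) (val_ring K \<nu>)"
proof -
  interpret V: cring "val_ring K \<nu>" by (rule V_cring)
  have mult: "a \<otimes> b \<in> val_ideal K \<nu>" if "a \<in> val_ideal K \<nu>" "b \<in> V" for a b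
    using that \<nu>_mult[of a b]
    by (cases "a = \<zero>"; cases "b = \<zero>") (auto simp: V_iff val_ideal_iff nz_def add_pos_nonneg simp del: nzD)
  have idl: "ideal (val_ideal K \<nu>) (val_ring K \<nu>)"
  proof (rule idealI)
    show "ring (val_ring K \<nu>)" by (rule V.ring_axioms)
    show "subgroup (val_ideal K \<nu>) (add_monoid (val_ring K \<nu>))"
    proof (rule V.add.subgroupI)
      show "val_ideal K \<nu> \<subseteq> V" by (auto simp: V_iff val_ideal_iff)
      have "\<zero> \<in> val_ideal K \<nu>" by (simp add: val_ideal_iff)
      then show "val_ideal K \<nu> \<noteq> {}" by blast
      show "\<ominus>\<^bsub>val_ring K \<nu>\<^esub> a \<in> val_ideal K \<nu>" if "a \<in> val_ideal K \<nu>" for a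
      proof -
        have "a \<in> V" using that by (auto simp: V_iff val_ideal_iff)
        then show ?thesis
          using that \<nu>_minus[of a] by (cases "a = \<zero>") (auto simp: V_a_inv val_ideal_iff nz_def simp del: nzD)
      qed
      show "a \<oplus>\<^bsub>val_ring K \<nu>\<^esub> b \<in> val_ideal K \<nu>" if "a \<in> val_ideal K \<nu>" "b \<in> val_ideal K \<nu>" for a b
        using that \<nu>_add[of a b]
        by (cases "a = \<zero>"; cases "b = \<zero>") (auto simp: V_ops val_ideal_iff nz_def min_def simp del: nzD split: if_splits)
    qed
    show "x \<otimes>\<^bsub>val_ring K \<nu>\<^esub> a \<in> val_ideal K \<nu>" if "a \<in> val_ideal K \<nu>" "x \<in> V" for a x
      using mult[OF that] that by (simp add: V_ops m_comm val_ideal_iff V_iff)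
    show "a \<otimes>\<^bsub>val_ring K \<nu>\<^esub> x \<in> val_ideal K \<nu>" if "a \<in> val_ideal K \<nu>" "x \<in> V" for a x
      using mult[OF that] by (simp add: V_ops)
  qed
  show ?thesis
  proof (rule maximalidealI[OF idl])
    have "\<one> \<notin> val_ideal K \<nu>" by (simp add: val_ideal_iff)
    then show "V \<noteq> val_ideal K \<nu>" by blast
    fix J assume J: "ideal J (val_ring K \<nu>)" "val_ideal K \<nu> \<subseteq> J" "J \<subseteq> V"
    show "J = val_ideal K \<nu> \<or> J = V"
    proof (cases "J \<subseteq> val_ideal K \<nu>")
      case False
      then obtain a where a: "a \<in> J" "a \<notin> val_ideal K \<nu>" by blast
      then have "a \<in> V" using J by blast
      then have az: "a \<in> nz" "\<nu> a = 0" using a by (auto simp: V_iff val_ideal_iff nz_def simp del: nzD)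
      then have "inv a \<in> V" using nz_closed(3)[OF az(1)] by (simp add: V_iff)
      then have "inv a \<otimes>\<^bsub>val_ring K \<nu>\<^esub> a \<in> J" using ideal.I_l_closed[OF J(1) a(1)] by blast
      then have "\<one>\<^bsub>val_ring K \<nu>\<^esub> \<in> J" using az by (simp add: V_ops)
      then show ?thesis using ideal.one_imp_carrier[OF J(1)] by blast
    qed (use J in blast)
  qed
qed

section \<open>The residue field of the valuation and the residue map\<close>

lemma L_field: "field L"
proof -
  show ?thesis unfolding res_field_def
    by (rule maximalideal.quotient_is_field[OF val_ideal_maximal V_cring])
qed

sublocale L: field "res_field K \<nu>" by (rule L_field)

lemma rs_hom: "rs \<in> ring_hom (val_ring K \<nu>) L"
proof -
  have "rs = (+>\<^bsub>val_ring K \<nu>\<^esub>) (val_ideal K \<nu>)" by (simp add: res_def fun_eq_iff)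
  then show ?thesis
    using ideal.rcos_ring_hom[OF maximalideal.axioms(1)[OF val_ideal_maximal]]
    unfolding res_field_def by simp
qed

lemma rs_closed [simp, intro]: "a \<in> V \<Longrightarrow> rs a \<in> carrier L"
  and rs_mult [simp]: "a \<in> V \<Longrightarrow> b \<in> V \<Longrightarrow> rs (a \<otimes> b) = rs a \<otimes>\<^sub>L rs b"
  and rs_add [simp]: "a \<in> V \<Longrightarrow> b \<in> V \<Longrightarrow> rs (a \<oplus> b) = rs a \<oplus>\<^sub>L rs b"
  and rs_one [simp]: "rs \<one> = \<one>\<^bsub>L\<^esub>"
  using ring_hom_memE[OF rs_hom] by (simp_all add: V_ops)

lemma rs_zero_iff: "a \<in> V \<Longrightarrow> rs a = \<zero>\<^bsub>L\<^esub> \<longleftrightarrow> a \<in> val_ideal K \<nu>"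
proof -
  assume a: "a \<in> V"
  have M: "ideal (val_ideal K \<nu>) (val_ring K \<nu>)"
    by (rule maximalideal.axioms(1)[OF val_ideal_maximal])
  note M' = abelian_subgroupI3[OF ideal.axioms(1)[OF M] ring.is_abelian_group[OF cring.axioms(1)[OF V_cring]]]
  have "\<zero>\<^bsub>L\<^esub> = val_ideal K \<nu>" by (simp add: res_field_def FactRing_def)
  then show ?thesis unfolding res_def
    using abelian_subgroup.a_rcos_const[OF M'] abelian_subgroup.a_rcos_self[OF M' a] by metis
qed

lemma rs_zero [simp]: "rs \<zero> = \<zero>\<^bsub>L\<^esub>"
  by (simp add: rs_zero_iff val_ideal_iff)

lemma rs_minus [simp]: "a \<in> V \<Longrightarrow> rs (\<ominus> a) = \<ominus>\<^bsub>L\<^esub> rs a"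
proof -
  assume a: "a \<in> V"
  then have "rs (\<ominus> a) \<oplus>\<^sub>L rs a = \<zero>\<^bsub>L\<^esub>" using rs_add[of "\<ominus> a" a] by (simp add: l_neg del: rs_add)
  then show ?thesis using L.minus_equality a by (metis V_closed(3) rs_closed)
qed

lemma rs_pow [simp]: "a \<in> V \<Longrightarrow> rs (a [^] (k::nat)) = rs a [^]\<^bsub>L\<^esub> k"
  by (induction k) auto

lemma rs_finsum:
  "finite A \<Longrightarrow> (\<And>i. i \<in> A \<Longrightarrow> f i \<in> V) \<Longrightarrow>
     (\<Oplus>i\<in>A. f i) \<in> V \<and> rs (\<Oplus>i\<in>A. f i) = (\<Oplus>\<^bsub>L\<^esub>i\<in>A. rs (f i))"
proof (induction A rule: finite_induct)
  case (insert i A)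
  then have "f ` insert i A \<subseteq> V" by auto
  then have "f \<in> insert i A \<rightarrow> carrier K" "(\<lambda>i. rs (f i)) \<in> insert i A \<rightarrow> carrier L" by auto
  with insert show ?case by (simp add: Pi_def)
qed simp

text \<open>The unit group of the valuation ring. Quotients of monomials of equal value lie here, so
  their residues are nonzero and invertible.\<close>

definition un :: "'a set" where "un = {a \<in> nz. \<nu> a = 0}"

lemma unI: "a \<in> nz \<Longrightarrow> \<nu> a = 0 \<Longrightarrow> a \<in> un"
  and un_nz [simp]: "a \<in> un \<Longrightarrow> a \<in> nz"
  and un_\<nu> [simp]: "a \<in> un \<Longrightarrow> \<nu> a = 0"
  and un_V [simp, intro]: "a \<in> un \<Longrightarrow> a \<in> V"
  by (auto simp: un_def V_iff)

lemma un_closed [simp, intro]: "a \<in> un \<Longrightarrow> b \<in> un \<Longrightarrow> a \<otimes> b \<in> un" "a \<in> un \<Longrightarrow> inv a \<in> un" "\<one> \<in> un"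
  by (rule unI, simp, simp)+

lemma un_pow [simp, intro]: "a \<in> un \<Longrightarrow> a [^] (k::nat) \<in> un"
  by (induction k) auto

lemma rs_un_nonzero [simp]: "a \<in> un \<Longrightarrow> rs a \<noteq> \<zero>\<^bsub>L\<^esub>"
  by (auto simp: rs_zero_iff val_ideal_iff)

lemma rs_inv [simp]: "a \<in> un \<Longrightarrow> rs (inv a) = inv\<^bsub>L\<^esub> (rs a)"
proof -
  assume a: "a \<in> un"
  have "rs a \<otimes>\<^sub>L rs (inv a) = \<one>\<^bsub>L\<^esub>" 
  proof -
    have "a \<in> V" "inv a \<in> V" "a \<otimes> inv a = \<one>" using a by simp_all
    then show ?thesis using rs_mult[of a "inv a"] rs_one by metis
  qed
  then show ?thesis using a L.comm_inv_char[of "rs a" "rs (inv a)"] by simp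
qed

end

section \<open>A case of the principal ideal theorem\<close>

lemma (in primeideal) pow_mem_imp:
  assumes "a \<in> carrier R" "a [^] (k::nat) \<in> I"
  shows "a \<in> I"
  using assms(2)
proof (induction k)
  case 0
  then show ?case using one_imp_carrier I_notcarr by simp
next
  case (Suc k)
  then show ?case using I_prime[of "a [^] k" a] assms(1) by auto
qed

lemma (in cring) genideal_pair_mem:
  assumes "x \<in> carrier R" "y \<in> carrier R" "a \<in> Idl {x, y}"
  obtains r s where "r \<in> carrier R" "s \<in> carrier R" "a = x \<otimes> r \<oplus> y \<otimes> s"
proof -
  have i: "ideal (PIdl x <+>\<^bsub>R\<^esub> PIdl y) R"
    using add_ideals cgenideal_ideal assms by blast
  have mem: "x \<otimes> r \<oplus> y \<otimes> s \<in> PIdl x <+>\<^bsub>R\<^esub> PIdl y" if "r \<in> carrier R" "s \<in> carrier R" for r s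
  proof -
    have "x \<otimes> r \<in> PIdl x" "y \<otimes> s \<in> PIdl y"
      using that assms m_comm unfolding cgenideal_def by blast+
    then show ?thesis unfolding set_add_def' by blast
  qed
  have "x \<otimes> \<one> \<oplus> y \<otimes> \<zero> = x" "x \<otimes> \<zero> \<oplus> y \<otimes> \<one> = y" using assms by simp_all
  then have "{x, y} \<subseteq> PIdl x <+>\<^bsub>R\<^esub> PIdl y" using mem[of \<one> \<zero>] mem[of \<zero> \<one>] by simp
  then have "a \<in> PIdl x <+>\<^bsub>R\<^esub> PIdl y" using genideal_minimal[OF i] assms(3) by blast
  then obtain r s where "r \<in> carrier R" "s \<in> carrier R" "a = r \<otimes> x \<oplus> s \<otimes> y"
    by (auto simp: set_add_def' cgenideal_def)
  then show ?thesis using that[of r s] assms m_comm by simp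
qed

text \<open>A form of Nakayama's lemma, from the ascending chain of the ideals \<open>J + (s k)\<close>, where the \<open>s k\<close> are obtained
  by iterating \<open>step\<close>.\<close>

lemma (in noetherian_domain) subset_of_subset_add_smult:
  assumes J: "ideal J R" and I: "I \<subseteq> carrier R" and x: "x \<in> carrier R"
    and step: "\<And>i. i \<in> I \<Longrightarrow> \<exists>i'\<in>I. \<exists>j\<in>J. i = j \<oplus> x \<otimes> i'"
    and unit: "\<And>r. r \<in> carrier R \<Longrightarrow> \<one> \<ominus> x \<otimes> r \<in> Units R"
  shows "I \<subseteq> J"
proof
  fix i assume "i \<in> I"
  interpret J: ideal J R by (rule J)
  obtain f where f: "\<And>i. i \<in> I \<Longrightarrow> f i \<in> I \<and> (\<exists>j\<in>J. i = j \<oplus> x \<otimes> f i)"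
    using step by metis
  \<comment> \<open>Iterating \<open>step\<close> gives i = j_0 + x (j_1 + x (j_2 + ...)) with all
    j_l in J; s k is what is left after k rounds.\<close>
  define s where "s k = (f ^^ k) i" for k
  have sI: "s k \<in> I" for k
    unfolding s_def using \<open>i \<in> I\<close> f by (induction k) auto
  then have sR [simp]: "s k \<in> carrier R" for k using I by blast
  have sS: "\<exists>j\<in>J. s k = j \<oplus> x \<otimes> s (Suc k)" for k
    using f[OF sI[of k]] unfolding s_def by simp
  define A where "A k = J <+>\<^bsub>R\<^esub> PIdl (s k)" for k
  have A: "ideal (A k) R" for k unfolding A_def by (intro add_ideals J cgenideal_ideal sR)
  have Amem: "j \<oplus> r \<otimes> s k \<in> A k" if "j \<in> J" "r \<in> carrier R" for j r k
    using that unfolding A_def set_add_def' cgenideal_def by blast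
  have JA: "J \<subseteq> A k" for k
  proof
    fix j assume j: "j \<in> J"
    then have "j \<in> carrier R" using J.a_subset by blast
    then show "j \<in> A k" using Amem[OF j, of \<zero> k] by simp
  qed
  have sA: "s k \<in> A k" for k
    using Amem[of \<zero> \<one> k] by simp
  have mono1: "A k \<subseteq> A (Suc k)" for k
  proof
    fix a assume "a \<in> A k"
    then obtain j r where a: "j \<in> J" "r \<in> carrier R" "a = j \<oplus> r \<otimes> s k"
      unfolding A_def set_add_def' cgenideal_def by blast
    interpret A: ideal "A (Suc k)" R by (rule A)
    obtain j' where j': "j' \<in> J" "s k = j' \<oplus> x \<otimes> s (Suc k)" using sS by blast
    have "x \<otimes> s (Suc k) \<in> A (Suc k)" using sA x A.I_l_closed by blast
    then have "s k \<in> A (Suc k)" using j' JA A.a_closed by auto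
    then show "a \<in> A (Suc k)" using a JA A.a_closed A.I_l_closed by blast
  qed
  have mono: "k \<le> l \<Longrightarrow> A k \<subseteq> A l" for k l
    by (rule lift_Suc_mono_le[of A]) (rule mono1)
  have "subset.chain {I. ideal I R} (range A)"
    unfolding subset.chain_def using A mono by (auto simp: image_iff) (metis nat_le_linear subsetD)+
  then have "\<Union>(range A) \<in> range A" by (intro ideal_chain_is_trivial) auto
  then obtain k where k: "\<Union>(range A) = A k" by blast
  then have "s (Suc k) \<in> A k" using sA by blast
  then obtain j r where j: "j \<in> J" "r \<in> carrier R" "s (Suc k) = j \<oplus> r \<otimes> s k"
    unfolding A_def set_add_def' cgenideal_def by blast
  obtain j' where j': "j' \<in> J" "s k = j' \<oplus> x \<otimes> s (Suc k)" using sS by blast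
  have jR: "j \<in> carrier R" "j' \<in> carrier R" using j j' J.a_subset by auto
  \<comment> \<open>Stationarity puts s (k+1) into J + (s k), while s k lies in J + x s (k+1).
    Eliminating s k leaves a unit multiple of s (k+1) in J.\<close>
  have key: "(\<one> \<ominus> x \<otimes> r) \<otimes> s (Suc k) = j \<oplus> r \<otimes> j'"
  proof -
    have "s (Suc k) = j \<oplus> r \<otimes> (j' \<oplus> x \<otimes> s (Suc k))" using j(3) unfolding j'(2)[symmetric] .
    moreover have "(\<one> \<ominus> x \<otimes> r) \<otimes> s (Suc k) = s (Suc k) \<ominus> r \<otimes> (x \<otimes> s (Suc k))"
      using x j(2) sR[of "Suc k"] by algebra
    moreover have "(j \<oplus> r \<otimes> (j' \<oplus> x \<otimes> s (Suc k))) \<ominus> r \<otimes> (x \<otimes> s (Suc k)) = j \<oplus> r \<otimes> j'"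
      using x j(2) jR sR[of "Suc k"] by algebra
    ultimately show ?thesis by metis
  qed
  have "j \<oplus> r \<otimes> j' \<in> J" using j j' J.I_l_closed J.a_closed by blast
  then have "inv (\<one> \<ominus> x \<otimes> r) \<otimes> ((\<one> \<ominus> x \<otimes> r) \<otimes> s (Suc k)) \<in> J"
    unfolding key using unit[OF j(2)] J.I_l_closed Units_inv_closed by blast
  moreover have "inv (\<one> \<ominus> x \<otimes> r) \<otimes> ((\<one> \<ominus> x \<otimes> r) \<otimes> s (Suc k)) = s (Suc k)"
    using unit[OF j(2)] Units_closed[OF unit[OF j(2)]] sR[of "Suc k"]
    by (simp add: m_assoc[symmetric])
  ultimately have "s (Suc k) \<in> J" by simp
  \<comment> \<open>Membership in J now descends from s (k+1) to s 0 = i.\<close>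
  moreover have "s l \<in> J" if "s (Suc l) \<in> J" for l
  proof -
    obtain j where j: "j \<in> J" "s l = j \<oplus> x \<otimes> s (Suc l)" using sS by blast
    have "x \<otimes> s (Suc l) \<in> J" using J.I_l_closed[OF that x] .
    then show ?thesis using j J.a_closed by simp
  qed
  ultimately have "s 0 \<in> J"
    using inc_induct[of 0 "Suc k" "\<lambda>l. s l \<in> J"] by blast
  then show "i \<in> J" by (simp add: s_def)
qed

text \<open>If a power of \<open>y\<close> is a multiple of \<open>x\<close>, then \<open>R/xR\<close> has only finitely many ideals. Hence the descending
  sequence of the \<open>x\<close>-saturations \<open>I n\<close> of \<open>a\<^sup>nR\<close>, for \<open>a \<in> p\<close>, is stationary modulo \<open>x\<close>, and by Nakayama
  it is stationary, which forces a power of \<open>x\<close> into \<open>p\<close>.\<close>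

lemma (in noetherian_domain) parameter_power_not_multiple:
  assumes x: "x \<in> carrier R" and y: "y \<in> carrier R"
    and proper: "\<one> \<notin> Idl {x, y}" and units: "carrier R - Idl {x, y} \<subseteq> Units R"
    and p: "primeideal p R" "p \<noteq> {\<zero>}" "p \<subset> Idl {x, y}"
    and t: "t \<in> carrier R"
  shows "y [^] (N::nat) \<noteq> x \<otimes> t"
proof
  assume yN: "y [^] N = x \<otimes> t"
  interpret p: primeideal p R by (rule p(1))
  interpret m: ideal "Idl {x, y}" R by (rule genideal_ideal) (use x y in auto)
  have xm: "x \<in> Idl {x, y}" using genideal_self[of "{x, y}"] x y by auto
  \<comment> \<open>If x were in p, then so would y^N be, hence y, and p would contain the whole
    ideal (x, y).\<close>
  have x_p: "x \<notin> p"
  proof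
    assume xp: "x \<in> p"
    then have "y [^] N \<in> p" unfolding yN using t p.I_r_closed by blast
    then have "y \<in> p" using p.pow_mem_imp y by blast
    then have "{x, y} \<subseteq> p" using xp by simp
    then have "Idl {x, y} \<subseteq> p" by (rule genideal_minimal[OF p.is_ideal])
    then have "p \<subset> p" by (rule order.strict_trans2[OF p(3)])
    then show False by simp
  qed
  have x0: "x \<noteq> \<zero>" using x_p p.zero_closed by auto
  obtain a where a: "a \<in> p" "a \<noteq> \<zero>" using p(2) p.zero_closed by blast
  have aR: "a \<in> carrier R" using a p.a_subset by blast
  define I where "I n = {r \<in> carrier R. \<exists>k::nat. \<exists>u\<in>carrier R. x [^] k \<otimes> r = a [^] n \<otimes> u}" for n :: nat
  have I_carrier: "I n \<subseteq> carrier R" for n by (auto simp: I_def)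
  have II: "r \<in> I n" if "r \<in> carrier R" "u \<in> carrier R" "x [^] (k::nat) \<otimes> r = a [^] n \<otimes> u" for r n k u
    unfolding I_def using that by blast
  have IE: "\<exists>k u. r \<in> carrier R \<and> u \<in> carrier R \<and> x [^] (k::nat) \<otimes> r = a [^] n \<otimes> u" if "r \<in> I n" for r n
    using that unfolding I_def by blast
  have I_add: "r \<oplus> s \<in> I n" if rs: "r \<in> I n" "s \<in> I n" for r s n
  proof -
    obtain k u where k: "r \<in> carrier R" "u \<in> carrier R" "x [^] (k::nat) \<otimes> r = a [^] n \<otimes> u"
      using IE[OF rs(1)] by auto
    obtain l v where l: "s \<in> carrier R" "v \<in> carrier R" "x [^] (l::nat) \<otimes> s = a [^] n \<otimes> v"
      using IE[OF rs(2)] by auto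
    have c: "x [^] k \<in> carrier R" "x [^] l \<in> carrier R" "a [^] n \<in> carrier R" using x aR by simp_all
    have "x [^] (k + l) \<otimes> (r \<oplus> s) = x [^] l \<otimes> (x [^] k \<otimes> r) \<oplus> x [^] k \<otimes> (x [^] l \<otimes> s)"
      unfolding nat_pow_mult[OF x, symmetric] using c(1,2) k(1) l(1) by algebra
    also have "\<dots> = a [^] n \<otimes> (x [^] l \<otimes> u \<oplus> x [^] k \<otimes> v)"
      unfolding k(3) l(3) using c k(2) l(2) by algebra
    finally show ?thesis using x k l by (intro II) auto
  qed
  have I_mult: "c \<otimes> r \<in> I n" if rs: "r \<in> I n" "c \<in> carrier R" for r c n
  proof -
    obtain k u where k: "r \<in> carrier R" "u \<in> carrier R" "x [^] (k::nat) \<otimes> r = a [^] n \<otimes> u"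
      using IE[OF rs(1)] by auto
    have "x [^] k \<otimes> (c \<otimes> r) = c \<otimes> (x [^] k \<otimes> r)" using x k(1) rs(2) by (simp add: m_lcomm)
    also have "\<dots> = a [^] n \<otimes> (c \<otimes> u)" unfolding k(3) using k(2) rs(2) aR by (simp add: m_lcomm)
    finally show ?thesis using k rs by (intro II) auto
  qed
  have I_zero: "\<zero> \<in> I n" for n
  proof -
    have "x [^] (0::nat) \<otimes> \<zero> = a [^] n \<otimes> \<zero>" using aR by simp
    then show ?thesis by (rule II[rotated 2]) simp_all
  qed
  have I_neg: "\<ominus> r \<in> I n" if "r \<in> I n" for r n
  proof -
    have "r \<in> carrier R" using that I_carrier by blast
    then have "\<ominus> r = \<ominus> \<one> \<otimes> r" by algebra
    then show ?thesis using I_mult[OF that, of "\<ominus> \<one>"] by simp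
  qed
  have I_ideal: "ideal (I n) R" for n
  proof (rule idealI)
    show "ring R" by (rule ring_axioms)
    show "subgroup (I n) (add_monoid R)"
      using I_carrier I_add I_neg I_zero[of n] by (intro add.subgroupI) auto
    show "c \<otimes> r \<in> I n" if "r \<in> I n" "c \<in> carrier R" for r c using I_mult that .
    then show "r \<otimes> c \<in> I n" if "r \<in> I n" "c \<in> carrier R" for r c
      using m_comm[OF subsetD[OF I_carrier that(1)] that(2)] that by simp
  qed
  have I_anti: "I (Suc n) \<subseteq> I n" for n
  proof
    fix r assume "r \<in> I (Suc n)"
    then obtain k u where k: "r \<in> carrier R" "u \<in> carrier R" "x [^] (k::nat) \<otimes> r = a [^] Suc n \<otimes> u"
      using IE by blast
    have "x [^] k \<otimes> r = a [^] n \<otimes> (a \<otimes> u)" unfolding k(3) using k(2) aR by (simp add: m_assoc)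
    then show "r \<in> I n" using k aR by (intro II[of r "a \<otimes> u" k n]) auto
  qed
  have I_x: "r \<in> I n" if xr: "x \<otimes> r \<in> I n" "r \<in> carrier R" for r n
  proof -
    obtain k u where k: "u \<in> carrier R" "x [^] (k::nat) \<otimes> (x \<otimes> r) = a [^] n \<otimes> u"
      using IE[OF xr(1)] by blast
    have "x [^] Suc k \<otimes> r = a [^] n \<otimes> u" using k(2) x xr(2) by (simp add: m_assoc)
    then show ?thesis by (rule II[OF xr(2) k(1)])
  qed
  \<comment> \<open>Modulo x, every element is a unit times a power y^j with j < M, or a multiple of
    y^M: a cofactor that is not a unit lies in (x, y) and supplies one more factor y.\<close>
  have uniserial: "(\<exists>s\<in>carrier R. \<exists>v\<in>carrier R. r = x \<otimes> s \<oplus> y [^] M \<otimes> v) \<or>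
      (\<exists>j<M. \<exists>s\<in>carrier R. \<exists>v\<in>Units R. r = x \<otimes> s \<oplus> y [^] j \<otimes> v)"
    if r: "r \<in> carrier R" for r and M :: nat
  proof (induction M)
    case 0
    have "r = x \<otimes> \<zero> \<oplus> y [^] (0::nat) \<otimes> r" using r x by simp
    then show ?case using r by blast
  next
    case (Suc M)
    show ?case
    proof (cases "\<exists>j<M. \<exists>s\<in>carrier R. \<exists>v\<in>Units R. r = x \<otimes> s \<oplus> y [^] j \<otimes> v")
      case True
      then show ?thesis using less_SucI by blast
    next
      case False
      then obtain s v where sv: "s \<in> carrier R" "v \<in> carrier R" "r = x \<otimes> s \<oplus> y [^] M \<otimes> v"
        using Suc by blast
      show ?thesis
      proof (cases "v \<in> Units R")
        case True
        then show ?thesis using sv by blast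
      next
        case False
        then have "v \<in> Idl {x, y}" using units sv by blast
        then obtain b c where bc: "b \<in> carrier R" "c \<in> carrier R" "v = x \<otimes> b \<oplus> y \<otimes> c"
          using genideal_pair_mem x y by blast
        have yM: "y [^] M \<in> carrier R" using y by simp
        have "r = x \<otimes> (s \<oplus> y [^] M \<otimes> b) \<oplus> y [^] Suc M \<otimes> c"
          unfolding sv(3) bc(3) nat_pow_Suc using x y yM sv(1) bc(1,2) by algebra
        then show ?thesis using x y yM sv bc by blast
      qed
    qed
  qed
  \<comment> \<open>The condition says that y^j lies in I n + xR. The ideals of R/xR are generated
    by powers of y, so the least such j determines the image of I n. It is at most N because y^N is
    in xR.\<close>
  define S where "S n j \<longleftrightarrow> (\<exists>i\<in>I n. \<exists>r\<in>carrier R. y [^] j = i \<oplus> x \<otimes> r)" for n j :: nat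
  have S_N: "S n N" for n
  proof -
    have "y [^] N = \<zero> \<oplus> x \<otimes> t" using yN x t by simp
    then show ?thesis unfolding S_def using I_zero t by blast
  qed
  define J where "J n = (LEAST j. S n j)" for n
  have J: "S n (J n)" "J n \<le> N" for n
    unfolding J_def using S_N by (auto intro: LeastI Least_le)
  have J_least: "J n \<le> j" if "S n j" for n j
    unfolding J_def using that by (rule Least_le)
  have S_anti: "S (Suc n) j \<Longrightarrow> S n j" for n j unfolding S_def using I_anti by blast
  have J_mono: "J n \<le> J (Suc n)" for n using J_least S_anti J(1) by blast
  \<comment> \<open>A nondecreasing sequence bounded by N cannot increase at every step.\<close>
  obtain n where n: "J n = J (Suc n)"
  proof (rule ccontr)
    assume "\<not> thesis"
    then have "J n < J (Suc n)" for n using J_mono[of n] that by (meson le_neq_implies_less)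
    then have "strict_mono J" by (simp add: strict_mono_Suc_iff)
    then have "Suc N \<le> J (Suc N)" by (rule strict_mono_imp_increasing)
    then show False using J(2)[of "Suc N"] by simp
  qed
  have "I n \<subseteq> I (Suc n)"
  proof (rule subset_of_subset_add_smult[OF I_ideal I_carrier x])
    show "\<one> \<ominus> x \<otimes> r \<in> Units R" if r: "r \<in> carrier R" for r
    proof -
      have "x \<otimes> r \<in> Idl {x, y}" using m.I_r_closed[OF xm r] .
      moreover have "\<one> = (\<one> \<ominus> x \<otimes> r) \<oplus> x \<otimes> r" using x r by algebra
      ultimately have "\<one> \<ominus> x \<otimes> r \<notin> Idl {x, y}" using proper m.a_closed[of "\<one> \<ominus> x \<otimes> r" "x \<otimes> r"] by auto
      moreover have "\<one> \<ominus> x \<otimes> r \<in> carrier R" using x r by simp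
      ultimately show ?thesis using units by (meson DiffI subsetD)
    qed
    fix i assume i: "i \<in> I n"
    then have iR: "i \<in> carrier R" using I_carrier by blast
    \<comment> \<open>I n is saturated, so the cofactor of x in an element of I n is again in I n.
      It therefore suffices to find an element of I (n+1) congruent to i modulo x.\<close>
    have *: "\<exists>i'\<in>I n. \<exists>j\<in>I (Suc n). i = j \<oplus> x \<otimes> i'"
      if s: "s \<in> carrier R" "j \<in> I (Suc n)" "i = j \<oplus> x \<otimes> s" for s j
    proof -
      have jI: "j \<in> I n" "j \<in> carrier R" using s I_anti I_carrier by blast+
      have "x \<otimes> s = i \<oplus> \<ominus> j" unfolding s(3) using x s(1) jI(2) by algebra
      also have "\<dots> \<in> I n" using I_add I_neg i jI by blast
      finally show ?thesis using I_x s by blast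
    qed
    show "\<exists>i'\<in>I n. \<exists>j\<in>I (Suc n). i = j \<oplus> x \<otimes> i'"
    proof (cases "\<exists>j<N. \<exists>s\<in>carrier R. \<exists>v\<in>Units R. i = x \<otimes> s \<oplus> y [^] j \<otimes> v")
      case False
      then obtain s v where sv: "s \<in> carrier R" "v \<in> carrier R" "i = x \<otimes> s \<oplus> y [^] N \<otimes> v"
        using uniserial[OF iR, of N] by blast
      have "i = \<zero> \<oplus> x \<otimes> (s \<oplus> t \<otimes> v)"
        unfolding sv(3) yN using x t sv(1,2) by algebra
      then show ?thesis by (rule *[rotated 2]) (use sv t I_zero in auto)
    next
      case True
      then obtain j s v where sv: "s \<in> carrier R" "v \<in> Units R" "i = x \<otimes> s \<oplus> y [^] (j::nat) \<otimes> v"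
        by blast
      have yj: "y [^] j \<in> carrier R" using y by simp
      have vR: "v \<in> carrier R" "inv v \<in> carrier R" "inv v \<otimes> v = \<one>" using sv by auto
      \<comment> \<open>Solving for y^j shows that it lies in I n + xR. Hence j is at least J n = J
        (n+1), so y^j, and with it i, is congruent modulo x to an element of I (n+1).\<close>
      have "y [^] j = (inv v \<otimes> v) \<otimes> y [^] j" using vR yj by simp
      also have "\<dots> = inv v \<otimes> i \<oplus> x \<otimes> (\<ominus> (inv v) \<otimes> s)"
        unfolding sv(3) using x sv(1) vR(1,2) yj by algebra
      finally have eq: "y [^] j = inv v \<otimes> i \<oplus> x \<otimes> (\<ominus> (inv v) \<otimes> s)" .
      have "\<ominus> (inv v) \<otimes> s \<in> carrier R" using sv(1) vR(2) by simp
      then have "S n j" unfolding S_def using I_mult[OF i vR(2)] eq by blast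
      then have "J n \<le> j" by (rule J_least)
      then have "J (Suc n) \<le> j" using n by simp
      then obtain l where l: "j = J (Suc n) + l" using le_Suc_ex by blast
      obtain i' r where i': "i' \<in> I (Suc n)" "r \<in> carrier R" "y [^] J (Suc n) = i' \<oplus> x \<otimes> r"
        using J(1) unfolding S_def by blast
      have i'R: "i' \<in> carrier R" using i' I_carrier by blast
      have yl: "y [^] l \<in> carrier R" using y by simp
      have "y [^] j = (i' \<oplus> x \<otimes> r) \<otimes> y [^] l" unfolding l i'(3)[symmetric] using y by (simp add: nat_pow_mult)
      then have "i = x \<otimes> s \<oplus> (i' \<oplus> x \<otimes> r) \<otimes> y [^] l \<otimes> v" using sv(3) by (rule subst)
      then have eq2: "i = (v \<otimes> y [^] l) \<otimes> i' \<oplus> x \<otimes> (s \<oplus> r \<otimes> y [^] l \<otimes> v)"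
        using x sv(1) vR(1) yl i'(2) i'R by algebra
      have "v \<otimes> y [^] l \<in> carrier R" using vR yl by simp
      then have "(v \<otimes> y [^] l) \<otimes> i' \<in> I (Suc n)" by (rule I_mult[OF i'(1)])
      moreover have "s \<oplus> r \<otimes> y [^] l \<otimes> v \<in> carrier R" using sv(1) vR yl i'(2) by simp
      ultimately show ?thesis by (rule *[OF _ _ eq2, rotated])
    qed
  qed
  \<comment> \<open>As a^n lies in I n, it lies in I (n+1), which means x^k a^n = a^(n+1) u.
    Cancelling a^n gives x^k = a u in p.\<close>
  moreover have "a [^] n \<in> I n"
  proof -
    have "x [^] (0::nat) \<otimes> a [^] n = a [^] n \<otimes> \<one>" using aR by simp
    then show ?thesis by (rule II[rotated 2]) (simp_all add: aR)
  qed
  ultimately obtain k u where k: "u \<in> carrier R" "x [^] (k::nat) \<otimes> a [^] n = a [^] Suc n \<otimes> u"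
    unfolding I_def by blast
  have an: "a [^] n \<noteq> \<zero>" "a [^] n \<in> carrier R"
    using a aR by (induction n) (auto simp: integral_iff)
  have "a [^] n \<otimes> x [^] k = a [^] n \<otimes> (a \<otimes> u)"
    using k aR x an(2) by (simp add: m_ac)
  then have "x [^] k = a \<otimes> u" using m_lcancel[OF an] x aR k by simp
  then have "x [^] k \<in> p" using p.I_r_closed[OF a(1) k(1)] by simp
  then show False using x_p p.pow_mem_imp x by blast
qed

section \<open>Dominating valuations of two-dimensional regular local rings\<close>

text \<open>A nonempty chain of ideals in a noetherian ring contains its union, so Zorn's lemma
  applies to the proper ideals containing a. In a local ring it follows that everything outside the
  maximal ideal is a unit.\<close>

lemma (in cring) noetherian_maximal_above:
  assumes "noetherian_ring R" "a \<in> carrier R" "a \<notin> Units R"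
  obtains M where "maximalideal M R" "a \<in> M"
proof -
  interpret N: noetherian_ring R by (rule assms(1))
  define C where "C = {I. ideal I R \<and> a \<in> I \<and> I \<noteq> carrier R}"
  have "PIdl a \<noteq> carrier R"
  proof
    assume "PIdl a = carrier R"
    then have "\<one> \<in> PIdl a" by simp
    then obtain r where "r \<in> carrier R" "r \<otimes> a = \<one>" unfolding cgenideal_def by auto
    then show False using assms(2,3) m_comm[of r a] unfolding Units_def by auto
  qed
  then have PC: "PIdl a \<in> C"
    unfolding C_def using cgenideal_ideal[OF assms(2)] cgenideal_self[OF assms(2)] by simp
  have "\<exists>U\<in>C. \<forall>A\<in>c. A \<subseteq> U" if "subset.chain C c" for c
  proof (cases "c = {}")
    case False
    have "subset.chain {I. ideal I R} c" using that unfolding subset.chain_def C_def by blast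
    then have "\<Union>c \<in> c" by (rule N.ideal_chain_is_trivial[OF False])
    moreover have "c \<subseteq> C" using that unfolding subset.chain_def by blast
    ultimately show ?thesis by blast
  next
    case True
    then show ?thesis using PC by blast
  qed
  then have "\<exists>M\<in>C. \<forall>Y\<in>C. M \<subseteq> Y \<longrightarrow> Y = M" by (rule subset_Zorn)
  then obtain M where M: "M \<in> C" "\<And>Y. Y \<in> C \<Longrightarrow> M \<subseteq> Y \<Longrightarrow> Y = M" by blast
  have "maximalideal M R"
    by (rule maximalidealI) (use M in \<open>auto simp: C_def\<close>)
  then show ?thesis using that M unfolding C_def by blast
qed

locale dominating_valuation = valued_field K \<nu>
  for K :: "'a ring" (structure) and \<nu> :: "'a \<Rightarrow> 'g::linordered_ab_group_add" +
  fixes R :: "'a ring" and CS :: "'a set" and x y :: 'a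
  assumes regular: "regular_local_ring R" and dim: "krull_dim R = 2"
    and coeffs: "coefficient_set R CS" and quot: "quotient_field K R"
    and dominates: "dominates K \<nu> R" and params: "regular_parameters R x y"
begin

abbreviation "\<mm> \<equiv> max_ideal R"

lemma R_subring: "subring (carrier R) K" and R_eq: "R = K\<lparr>carrier := carrier R\<rparr>"
  using quot unfolding quotient_field_def by auto

lemma R_ops: "a \<otimes>\<^bsub>R\<^esub> b = a \<otimes> b" "a \<oplus>\<^bsub>R\<^esub> b = a \<oplus> b" "\<one>\<^bsub>R\<^esub> = \<one>" "\<zero>\<^bsub>R\<^esub> = \<zero>"
  by (subst R_eq, simp)+

lemma R_pow: "a [^]\<^bsub>R\<^esub> (k::nat) = a [^] k"
  by (subst R_eq) (simp add: nat_pow_def)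

lemma R_closed [simp, intro]: "\<one> \<in> carrier R" "\<zero> \<in> carrier R" "a \<in> carrier R \<Longrightarrow> \<ominus> a \<in> carrier R"
  "a \<in> carrier R \<Longrightarrow> b \<in> carrier R \<Longrightarrow> a \<otimes> b \<in> carrier R"
  "a \<in> carrier R \<Longrightarrow> b \<in> carrier R \<Longrightarrow> a \<oplus> b \<in> carrier R"
  "a \<in> carrier R \<Longrightarrow> a \<in> carrier K"
  using subringE[OF R_subring] by auto

lemma R_pow_closed [simp, intro]: "a \<in> carrier R \<Longrightarrow> a [^] (k::nat) \<in> carrier R"
  by (induction k) auto

lemma R_domain: "domain R"
  using subring_is_domain[OF R_subring] R_eq by simp

lemma R_noetherian: "noetherian_ring R"
  using regular unfolding regular_local_ring_def by simp

sublocale R: noetherian_domain R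
  using R_domain R_noetherian by (simp add: noetherian_domain_def)

lemma max_ideal_unique: "maximalideal M R \<longleftrightarrow> M = \<mm>"
proof -
  have "\<exists>!M. maximalideal M R" using regular unfolding regular_local_ring_def local_ring_def by simp
  then show ?thesis unfolding max_ideal_def by (metis (no_types, lifting) theI_unique)
qed

lemma Units_R_iff: "a \<in> carrier R \<Longrightarrow> a \<notin> \<mm> \<Longrightarrow> a \<in> Units R"
  using R.noetherian_maximal_above[OF R_noetherian] max_ideal_unique by metis

lemma R_in_V [simp, intro]: "a \<in> carrier R \<Longrightarrow> a \<in> V"
  using dominates unfolding dominates_def by auto

lemma max_ideal_iff: "a \<in> \<mm> \<longleftrightarrow> a \<in> carrier R \<and> a \<in> val_ideal K \<nu>"
  using dominates unfolding dominates_def by blast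

lemma params_mem: "x \<in> carrier R" "y \<in> carrier R" "genideal R {x, y} = \<mm>"
  using params unfolding regular_parameters_def by auto

lemma max_ideal_params: "x \<in> \<mm>" "y \<in> \<mm>"
  using R.genideal_self[of "{x, y}"] params_mem by auto

text \<open>If all chains had length at most 1, their supremum could not be 2. So there is a chain p
  0 < p 1 < p 2; its middle term is nonzero because of p 0 and strictly below the maximal ideal
  because of p 2.\<close>

lemma height_one_prime: obtains p where "primeideal p R" "p \<noteq> {\<zero>}" "p \<subset> \<mm>"
proof -
  let ?S = "{enat n | n. \<exists>p :: nat \<Rightarrow> 'a set. (\<forall>i\<le>n. primeideal (p i) R) \<and> (\<forall>i<n. p i \<subset> p (Suc i))}"
  have "\<exists>s\<in>?S. 2 \<le> s"
  proof (rule ccontr)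
    assume less: "\<not> ?thesis"
    have "s \<le> 1" if "s \<in> ?S" for s
    proof -
      have "s < 2" using less that by (meson not_le)
      then show ?thesis by (cases s) (simp_all add: numeral_eq_enat one_enat_def)
    qed
    then have "Sup ?S \<le> 1" by (rule Sup_least)
    then have "(2::enat) \<le> 1" using dim unfolding krull_dim_def by simp
    then show False by (simp add: numeral_eq_enat one_enat_def)
  qed
  then obtain n and p :: "nat \<Rightarrow> 'a set" where "2 \<le> enat n"
    and p': "\<forall>i\<le>n. primeideal (p i) R" "\<forall>i<n. p i \<subset> p (Suc i)" by blast
  then have n: "2 \<le> n" and p: "\<And>i. i \<le> n \<Longrightarrow> primeideal (p i) R"
    "\<And>i. i < n \<Longrightarrow> p i \<subset> p (Suc i)" by (simp_all add: numeral_eq_enat)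
  have p0: "p 0 \<subset> p 1" "p 1 \<subset> p 2" using p(2)[of 0] p(2)[of 1] n by (auto simp: numeral_2_eq_2)
  interpret p0: primeideal "p 0" R using p n by simp
  interpret p1: primeideal "p 1" R using p n by simp
  interpret p2: primeideal "p 2" R using p n by simp
  have "p 2 \<subseteq> \<mm>"
  proof
    fix a assume a: "a \<in> p 2"
    then have "a \<in> carrier R" using p2.a_subset by blast
    moreover have "a \<notin> Units R"
    proof
      assume "a \<in> Units R"
      then have "inv\<^bsub>R\<^esub> a \<otimes>\<^bsub>R\<^esub> a \<in> p 2" using a p2.I_l_closed R.Units_inv_closed by blast
      then show False using \<open>a \<in> Units R\<close> p2.one_imp_carrier p2.I_notcarr by simp
    qed
    ultimately show "a \<in> \<mm>" using Units_R_iff by blast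
  qed
  moreover have "p 1 \<noteq> {\<zero>}" using p0(1) p0.zero_closed R_ops by auto
  ultimately show ?thesis using that[of "p 1"] p(1)[of 1] n p0(2) by auto
qed

text \<open>Stated for arbitrary generators u and v so that it can be used with x and y in either
  order. With exponent 1 and t = 0 it shows that both parameters are nonzero.\<close>

lemma y_power_not_multiple:
  assumes "t \<in> carrier R" "genideal R {u, v} = \<mm>" "u \<in> carrier R" "v \<in> carrier R"
  shows "v [^] (N::nat) \<noteq> u \<otimes> t"
proof -
  obtain p where p: "primeideal p R" "p \<noteq> {\<zero>}" "p \<subset> \<mm>" by (rule height_one_prime)
  have "\<one> \<notin> \<mm>" by (simp add: max_ideal_iff val_ideal_iff)
  then have "v [^]\<^bsub>R\<^esub> N \<noteq> u \<otimes>\<^bsub>R\<^esub> t"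
    using R.parameter_power_not_multiple[of u v p t N] assms p Units_R_iff R_ops by auto
  then show ?thesis by (simp add: R_ops R_pow)
qed

lemma params_nonzero: "x \<in> nz" "y \<in> nz"
proof -
  have "x [^] (1::nat) \<noteq> y \<otimes> \<zero>"
    using y_power_not_multiple[of \<zero> y x 1] params_mem by (simp add: insert_commute)
  moreover have "y [^] (1::nat) \<noteq> x \<otimes> \<zero>"
    using y_power_not_multiple[of \<zero> x y 1] params_mem by simp
  ultimately show "x \<in> nz" "y \<in> nz" using params_mem by (auto simp: nz_def simp del: nzD)
qed

section \<open>Coefficients, the image of the residue field of R, and adjunction of one
  element\<close>

lemma CS_R [simp]: "c \<in> CS \<Longrightarrow> c \<in> carrier R"
  and CS_zero [simp]: "\<zero> \<in> CS"
  using coeffs R_ops unfolding coefficient_set_def by auto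

lemma CS_rep:
  assumes a: "a \<in> carrier R"
  obtains c where "c \<in> CS" "rs c = rs a"
proof -
  have bij: "bij_betw (\<lambda>s. \<mm> +>\<^bsub>R\<^esub> s) CS (carrier (R Quot \<mm>))"
    using coeffs unfolding coefficient_set_def by simp
  have max: "maximalideal \<mm> R" using max_ideal_unique by simp
  interpret m: maximalideal \<mm> R by (rule max)
  have "\<mm> +>\<^bsub>R\<^esub> a \<in> carrier (R Quot \<mm>)" using ring_hom_memE(1)[OF m.rcos_ring_hom a] .
  then obtain c where c: "c \<in> CS" "\<mm> +>\<^bsub>R\<^esub> c = \<mm> +>\<^bsub>R\<^esub> a"
    using bij unfolding bij_betw_def by (metis (no_types, lifting) imageE)
  then have cR: "c \<in> carrier R" by simp
  have "c \<in> \<mm> +>\<^bsub>R\<^esub> a" using m.a_rcos_self[OF cR] c(2) by simp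
  then obtain h where h: "h \<in> \<mm>" "c = h \<oplus> a" unfolding a_r_coset_def' by (auto simp: R_ops)
  then have "rs c = rs h \<oplus>\<^sub>L rs a" "rs h = \<zero>\<^bsub>L\<^esub>" using a by (simp_all add: max_ideal_iff rs_zero_iff)
  then have "rs c = rs a" using a by simp
  then show ?thesis using that c by blast
qed

abbreviation "kk \<equiv> base_field K \<nu> R"

lemma base_subfield: "subfield kk L"
proof (rule L.subfieldI'[OF L.subringI])
  show "kk \<subseteq> carrier L" by (auto simp: base_field_def)
  show "\<one>\<^bsub>L\<^esub> \<in> kk" unfolding base_field_def using rs_one by (metis R_closed(1) imageI)
  show "\<ominus>\<^bsub>L\<^esub> h \<in> kk" if "h \<in> kk" for h
    using that by (auto simp: base_field_def simp flip: rs_minus)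
  show "a \<otimes>\<^sub>L b \<in> kk" if "a \<in> kk" "b \<in> kk" for a b
    using that by (auto simp: base_field_def simp flip: rs_mult)
  show "a \<oplus>\<^sub>L b \<in> kk" if "a \<in> kk" "b \<in> kk" for a b
    using that by (auto simp: base_field_def simp flip: rs_add)
  show "inv\<^bsub>L\<^esub> a \<in> kk" if a: "a \<in> kk - {\<zero>\<^bsub>L\<^esub>}" for a
  proof -
    obtain r where r: "r \<in> carrier R" "a = rs r" using a by (auto simp: base_field_def)
    then have "r \<notin> \<mm>" using a by (auto simp: rs_zero_iff max_ideal_iff)
    then have u: "r \<in> Units R" using Units_R_iff r by blast
    then have i: "inv\<^bsub>R\<^esub> r \<in> carrier R" "r \<otimes> inv\<^bsub>R\<^esub> r = \<one>"
      using R.Units_r_inv[OF u] by (auto simp: R_ops)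
    then have "rs r \<otimes>\<^sub>L rs (inv\<^bsub>R\<^esub> r) = \<one>\<^bsub>L\<^esub>"
      using rs_mult[OF R_in_V[OF r(1)] R_in_V[OF i(1)]] by simp
    then have "inv\<^bsub>L\<^esub> a = rs (inv\<^bsub>R\<^esub> r)" using L.comm_inv_char[of a] r i by simp
    then show ?thesis using i unfolding base_field_def by simp
  qed
qed

lemma base_E:
  assumes "f \<in> kk"
  obtains c where "c \<in> CS" "f = rs c"
proof -
  obtain r where "r \<in> carrier R" "f = rs r" using assms unfolding base_field_def by auto
  then show ?thesis using CS_rep that by metis
qed

lemma base_I [intro]: "a \<in> carrier R \<Longrightarrow> rs a \<in> kk"
  unfolding base_field_def by auto

text \<open>The tower is defined by generators, while degrees and bases are available for simple
  extensions; the two agree when a is algebraic. The second claim turns the stopping condition,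
  which speaks of the dimension of one step of the tower, into algebraicity of the adjoined
  element.\<close>

lemma
  assumes B: "B \<subseteq> carrier L" and a: "a \<in> carrier L"
  defines "F \<equiv> generate_field L B" and "F' \<equiv> generate_field L (insert a B)"
  shows generate_insert_algebraic: "L.algebraic F a \<Longrightarrow> F' = L.simple_extension F a"
    and generate_insert_finite: "L.finite_dimension F F' \<longleftrightarrow> L.algebraic F a"
proof -
  have B': "insert a B \<subseteq> carrier L" using assms by simp
  have F: "subfield F L" unfolding F_def by (rule L.generate_field_is_subfield[OF B])
  have F': "subfield F' L" unfolding F'_def by (rule L.generate_field_is_subfield[OF B'])
  have aF': "a \<in> F'" unfolding F'_def by (rule generate_field.incl) simp
  have FF': "F \<subseteq> F'" unfolding F_def F'_def by (rule L.mono_generate_field[OF _ B']) auto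
  show eq: "F' = L.simple_extension F a" if alg: "L.algebraic F a"
  proof
    show "L.simple_extension F a \<subseteq> F'"
      by (rule L.simple_extension_subring_incl[OF subfieldE(1)[OF F'] FF' aF'])
    have sub: "subfield (L.simple_extension F a) L"
      using L.simple_extension_is_subfield[OF F a] alg by (simp add: over_def)
    have "insert a B \<subseteq> L.simple_extension F a"
      using L.simple_extension_mem[OF subfieldE(1)[OF F] a]
        L.simple_extension_incl[OF subfieldE(3)[OF F] a] generate_field.incl[of _ B L]
      unfolding F_def by blast
    then show "F' \<subseteq> L.simple_extension F a"
      unfolding F'_def by (rule L.generate_field_min_subfield1[OF B' sub])
  qed
  show "L.finite_dimension F F' \<longleftrightarrow> L.algebraic F a"
  proof
    assume "L.finite_dimension F F'"
    then show "L.algebraic F a"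
      using L.finite_dimension_imp_algebraic[OF F subfieldE(1)[OF F'] _ aF'] by (simp add: over_def)
  next
    assume alg: "L.algebraic F a"
    then show "L.finite_dimension F F'"
      using L.finite_dimension_simple_extension[OF F a] eq by (simp add: over_def)
  qed
qed

end

section \<open>Power products and their values\<close>

lemma nat_mult_strict_mono:
  fixes g :: "'g::linordered_ab_group_add"
  assumes "0 < g" "m < k"
  shows "nat_mult m g < nat_mult k g"
  using assms(2)
proof (induction k)
  case (Suc k)
  have "nat_mult k g < nat_mult (Suc k) g" using assms(1) by simp
  then show ?case using Suc by (cases "m = k") (auto intro: less_trans)
qed simp

lemma nat_mult_mono:
  fixes g :: "'g::linordered_ab_group_add"
  assumes "0 < g" "m \<le> k"
  shows "nat_mult m g \<le> nat_mult k g"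
  using nat_mult_strict_mono[OF assms(1), of m k] assms(2) by (cases "m = k") auto

lemma nat_mult_inject:
  fixes g :: "'g::linordered_ab_group_add"
  assumes "0 < g"
  shows "nat_mult m g = nat_mult k g \<longleftrightarrow> m = k"
  using nat_mult_strict_mono[OF assms, of m k] nat_mult_strict_mono[OF assms, of k m]
  by (cases m k rule: linorder_cases) auto

lemma nat_mult_less_cancel:
  fixes g :: "'g::linordered_ab_group_add"
  assumes "0 < g"
  shows "nat_mult m g < nat_mult k g \<longleftrightarrow> m < k"
  using nat_mult_strict_mono[OF assms] nat_mult_mono[OF assms] by (metis leD le_less_linear)

lemma nat_mult_pos:
  fixes g :: "'g::linordered_ab_group_add"
  assumes "0 < g" "0 < m"
  shows "0 < nat_mult m g"
  using nat_mult_strict_mono[OF assms] by simp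

section \<open>Power products and Laurent monomials\<close>

context valued_field
begin

lemma pp_empty [simp]: "power_product K P {} e = \<one>"
  by (simp add: power_product_def)

lemma pp_insert:
  assumes "finite I" "i \<notin> I" "\<And>s. s \<in> insert i I \<Longrightarrow> P s \<in> nz"
  shows "power_product K P (insert i I) e = P i [^] e i \<otimes> power_product K P I e"
  unfolding power_product_def using assms by (intro finprod_insert) auto

lemma pp_nz:
  assumes "finite I" "\<And>s. s \<in> I \<Longrightarrow> P s \<in> nz"
  shows "power_product K P I e \<in> nz"
  using assms
proof (induction I rule: finite_induct)
  case (insert i I)
  then show ?case by (subst pp_insert) auto
qed simp

lemma pp_cong:
  assumes "\<And>s. s \<in> I \<Longrightarrow> P s = Q s" "\<And>s. s \<in> I \<Longrightarrow> e s = e' s" "\<And>s. s \<in> I \<Longrightarrow> P s \<in> nz"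
  shows "power_product K P I e = power_product K Q I e'"
  unfolding power_product_def using assms by (intro finprod_cong') auto

lemma pp_Suc:
  assumes "\<And>s. s \<le> i \<Longrightarrow> P s \<in> nz"
  shows "power_product K P {..<Suc i} e = power_product K P {..<i} e \<otimes> P i [^] e i"
proof -
  have "power_product K P {..<i} e \<in> nz" using assms by (intro pp_nz) auto
  then show ?thesis
    unfolding lessThan_Suc using assms by (subst pp_insert) (auto simp: m_comm)
qed

lemma pp_mult:
  assumes "finite I" "\<And>s. s \<in> I \<Longrightarrow> P s \<in> nz"
  shows "power_product K P I (\<lambda>s. e s + e' s) = power_product K P I e \<otimes> power_product K P I e'"
proof -
  have "power_product K P I (\<lambda>s. e s + e' s) = (\<Otimes>s\<in>I. P s [^] e s \<otimes> P s [^] e' s)"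
    unfolding power_product_def using assms(2) by (intro finprod_cong') (auto simp: nat_pow_mult)
  also have "\<dots> = power_product K P I e \<otimes> power_product K P I e'"
    unfolding power_product_def using assms(2) by (intro finprod_multf) auto
  finally show ?thesis .
qed

lemma pp_zero [simp]: "power_product K P I (\<lambda>_. 0) = \<one>"
  by (simp add: power_product_def)

text \<open>Laurent monomials, as quotients because exponents are natural numbers. The bound is
  strict, as for the smaller group in \<open>val_index\<close>: monomials that involve P_i belong to
  index i + 1.\<close>

definition laurent :: "(nat \<Rightarrow> 'a) \<Rightarrow> nat \<Rightarrow> 'a set" where
  "laurent P i = {power_product K P {..<i} e \<otimes> inv (power_product K P {..<i} e') | e e'. True}"

lemma laurentI:
  "h = power_product K P {..<i} e \<otimes> inv (power_product K P {..<i} e') \<Longrightarrow> h \<in> laurent P i"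
  unfolding laurent_def by blast

lemma laurentE:
  assumes "h \<in> laurent P i"
  obtains e e' where "h = power_product K P {..<i} e \<otimes> inv (power_product K P {..<i} e')"
  using assms unfolding laurent_def by blast

context
  fixes P :: "nat \<Rightarrow> 'a" and i :: nat
  assumes P: "\<And>s. s < i \<Longrightarrow> P s \<in> nz"
begin

lemma pp_less_nz [simp]: "power_product K P {..<i} e \<in> nz"
  using P by (intro pp_nz) auto

lemma laurent_nz [simp]: "h \<in> laurent P i \<Longrightarrow> h \<in> nz"
  by (elim laurentE) simp

lemma laurent_pp [simp]: "power_product K P {..<i} e \<in> laurent P i"
  by (rule laurentI[of _ _ _ e "\<lambda>_. 0"]) (simp add: inv_one)

lemma laurent_one [simp]: "\<one> \<in> laurent P i"
  using laurent_pp[of "\<lambda>_. 0"] by simp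

lemma laurent_mult [simp]: "g \<in> laurent P i \<Longrightarrow> h \<in> laurent P i \<Longrightarrow> g \<otimes> h \<in> laurent P i"
proof -
  assume "g \<in> laurent P i" "h \<in> laurent P i"
  then obtain e e' f f' where
    gh: "g = power_product K P {..<i} e \<otimes> inv (power_product K P {..<i} e')"
      "h = power_product K P {..<i} f \<otimes> inv (power_product K P {..<i} f')"
    by (elim laurentE)
  let ?p = "power_product K P {..<i}"
  have m: "?p (\<lambda>s. e s + f s) = ?p e \<otimes> ?p f" for e f using P by (intro pp_mult) auto
  show ?thesis
    by (rule laurentI[of _ _ _ "\<lambda>s. e s + f s" "\<lambda>s. e' s + f' s"]) (simp add: gh m inv_mult_nz m_ac)
qed

lemma laurent_inv [simp]: "h \<in> laurent P i \<Longrightarrow> inv h \<in> laurent P i"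
proof (elim laurentE)
  fix e e' assume h: "h = power_product K P {..<i} e \<otimes> inv (power_product K P {..<i} e')"
  show "inv h \<in> laurent P i"
    by (rule laurentI[of _ _ _ e' e]) (simp add: h inv_mult_nz m_comm)
qed

lemma laurent_pow [simp]: "h \<in> laurent P i \<Longrightarrow> h [^] (k::nat) \<in> laurent P i"
  by (induction k) auto

lemma laurent_gen: "s < i \<Longrightarrow> P s \<in> laurent P i"
proof -
  assume s: "s < i"
  have "power_product K P {..<i} (\<lambda>t. if t = s then 1 else 0) =
      P s [^] (if s = s then 1 else 0 :: nat) \<otimes> power_product K P ({..<i} - {s}) (\<lambda>t. if t = s then 1 else 0)"
    using pp_insert[of "{..<i} - {s}" s P "\<lambda>t. if t = s then 1 else 0"] s P by (simp add: insert_absorb)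
  also have "power_product K P ({..<i} - {s}) (\<lambda>t. if t = s then 1 else 0) =
      power_product K P ({..<i} - {s}) (\<lambda>_. 0)"
    using P by (intro pp_cong) auto
  finally have "power_product K P {..<i} (\<lambda>t. if t = s then 1 else 0) = P s" using P[OF s] by simp
  then show ?thesis using laurent_pp by metis
qed

text \<open>Quotients of Laurent monomials correspond to differences of values, and the generators
  are values of single P_j. Questions about value groups thus become questions about elements of the
  field.\<close>

lemma \<nu>_laurent: "\<nu> ` laurent P i = group_closure ((\<lambda>j. \<nu> (P j)) ` {..<i})"
proof
  let ?G = "group_closure ((\<lambda>j. \<nu> (P j)) ` {..<i})"
  have pp: "\<nu> (power_product K P I e) \<in> ?G" if "finite I" "I \<subseteq> {..<i}" for I e
    using that
  proof (induction I rule: finite_induct)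
    case (insert s I)
    then have s: "P s \<in> nz" "power_product K P I e \<in> nz" using P by (auto intro: pp_nz)
    have "\<nu> (P s) \<in> ?G" using insert.prems by (intro group_closure.base) auto
    then have "nat_mult (e s) (\<nu> (P s)) \<in> ?G"
      by (intro nat_mult_in) (auto intro: group_closure_add)
    moreover have "power_product K P (insert s I) e = P s [^] e s \<otimes> power_product K P I e"
      using insert P by (intro pp_insert) auto
    ultimately show ?case using insert s by (auto intro: group_closure_add)
  qed simp
  show "\<nu> ` laurent P i \<subseteq> ?G"
  proof (rule image_subsetI)
    fix h assume "h \<in> laurent P i"
    then obtain e e' where h: "h = power_product K P {..<i} e \<otimes> inv (power_product K P {..<i} e')"
      by (elim laurentE)
    have "\<nu> h = \<nu> (power_product K P {..<i} e) - \<nu> (power_product K P {..<i} e')"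
      unfolding h by simp
    then show "\<nu> h \<in> ?G" using group_closure.diff[OF pp pp] by simp
  qed
  show "?G \<subseteq> \<nu> ` laurent P i"
  proof
    fix g assume "g \<in> ?G"
    then show "g \<in> \<nu> ` laurent P i"
    proof (induction rule: group_closure.induct)
      case (base g)
      then show ?case
      proof (elim insertE)
        assume "g = 0" then show ?thesis using laurent_one \<nu>_one by (metis imageI)
      qed (use laurent_gen in auto)
    next
      case (diff s t)
      then obtain g h where "g \<in> laurent P i" "h \<in> laurent P i" "s = \<nu> g" "t = \<nu> h" by auto
      then have "s - t = \<nu> (g \<otimes> inv h)" "g \<otimes> inv h \<in> laurent P i" by simp_all
      then show ?case by simp
    qed
  qed
qed

end

context
  fixes P :: "nat \<Rightarrow> 'a" and i :: nat
  assumes P: "\<And>s. s \<le> i \<Longrightarrow> P s \<in> nz"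
begin

lemma laurent_SucI:
  assumes "h \<in> laurent P i"
  shows "h \<otimes> P i [^] (a::nat) \<otimes> inv (P i [^] (b::nat)) \<in> laurent P (Suc i)"
proof -
  obtain e e' where h: "h = power_product K P {..<i} e \<otimes> inv (power_product K P {..<i} e')"
    using assms by (elim laurentE)
  let ?p = "power_product K P {..<i}"
  have p: "?p e \<in> nz" for e using P by (intro pp_nz) auto
  have s: "power_product K P {..<Suc i} (e(i := a)) = ?p e \<otimes> P i [^] a" for e a
  proof -
    have "?p (e(i := a)) = ?p e" using P by (intro pp_cong) auto
    then show ?thesis using pp_Suc[of i P "e(i := a)"] P by simp
  qed
  show ?thesis
    by (rule laurentI[of _ _ _ "e(i := a)" "e'(i := b)"])
      (use p P in \<open>simp add: s h inv_mult_nz m_ac\<close>)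
qed

lemma laurent_SucE:
  assumes "h \<in> laurent P (Suc i)"
  obtains g a b where "g \<in> laurent P i" "h = g \<otimes> P i [^] (a::nat) \<otimes> inv (P i [^] (b::nat))"
proof -
  obtain e e' where h: "h = power_product K P {..<Suc i} e \<otimes> inv (power_product K P {..<Suc i} e')"
    using assms by (elim laurentE)
  let ?p = "power_product K P {..<i}"
  have p: "?p e \<in> nz" for e using P by (intro pp_nz) auto
  have "h = (?p e \<otimes> inv (?p e')) \<otimes> P i [^] e i \<otimes> inv (P i [^] e' i)"
    unfolding h using p P by (simp add: pp_Suc inv_mult_nz m_ac)
  then show ?thesis using that laurentI by blast
qed

text \<open>The value group at i + 1 arises from the one at i by adjoining \<nu>(P_i), so
  \<open>group_index_cyclic\<close> identifies the index with the order of \<nu>(P_i) modulo the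
  values of the earlier elements.\<close>

lemma nbar_props:
  assumes "val_index \<nu> P i < \<infinity>"
  shows "0 < nbar \<nu> P i \<and> (\<forall>k. nat_mult k (\<nu> (P i)) \<in> \<nu> ` laurent P i \<longleftrightarrow> nbar \<nu> P i dvd k)"
proof -
  have Pi: "P i \<in> nz" and Pless: "\<And>s. s < i \<Longrightarrow> P s \<in> nz" and PSuc: "\<And>s. s < Suc i \<Longrightarrow> P s \<in> nz"
    using P by auto
  let ?A = "\<nu> ` laurent P i" and ?B = "\<nu> ` laurent P (Suc i)"
  have eq: "val_index \<nu> P i = group_index ?B ?A"
  proof -
    have "?A = group_closure ((\<lambda>j. \<nu> (P j)) ` {..<i})" by (rule \<nu>_laurent) (rule Pless)
    moreover have "?B = group_closure ((\<lambda>j. \<nu> (P j)) ` {..<Suc i})" by (rule \<nu>_laurent) (rule PSuc)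
    ultimately show ?thesis unfolding val_index_def lessThan_Suc_atMost by metis
  qed
  have zero: "0 \<in> ?A"
  proof -
    have "\<nu> \<one> \<in> ?A" by (rule imageI) (rule laurent_one[of i P, OF Pless])
    then show ?thesis by simp
  qed
  have diff: "a - b \<in> ?A" if ab: "a \<in> ?A" "b \<in> ?A" for a b
  proof -
    obtain g h where gh: "g \<in> laurent P i" "h \<in> laurent P i" "a = \<nu> g" "b = \<nu> h" using ab by auto
    have nz: "g \<in> nz" "h \<in> nz" using gh laurent_nz[of i P, OF Pless] by blast+
    have "inv h \<in> laurent P i" using gh(2) laurent_inv[of i P, OF Pless] by blast
    then have "g \<otimes> inv h \<in> laurent P i" using gh(1) laurent_mult[of i P, OF Pless] by blast
    moreover have "a - b = \<nu> (g \<otimes> inv h)" using gh nz by simp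
    ultimately show ?thesis by simp
  qed
  have B: "?B = {a + nat_mult m (\<nu> (P i)) - nat_mult k (\<nu> (P i)) | a m k. a \<in> ?A}"
  proof (intro equalityI subsetI)
    fix z assume "z \<in> ?B"
    then obtain h where h: "h \<in> laurent P (Suc i)" "z = \<nu> h" by auto
    obtain g a b where g: "g \<in> laurent P i" "h = g \<otimes> P i [^] (a::nat) \<otimes> inv (P i [^] (b::nat))"
      using laurent_SucE[OF h(1)] by blast
    then have "z = \<nu> g + nat_mult a (\<nu> (P i)) - nat_mult b (\<nu> (P i))"
      using h Pi laurent_nz[of i P, OF Pless] by simp
    then show "z \<in> {a + nat_mult m (\<nu> (P i)) - nat_mult k (\<nu> (P i)) | a m k. a \<in> ?A}" using g by blast
  next
    fix z assume "z \<in> {a + nat_mult m (\<nu> (P i)) - nat_mult k (\<nu> (P i)) | a m k. a \<in> ?A}"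
    then obtain g a b where g: "g \<in> laurent P i" "z = \<nu> g + nat_mult a (\<nu> (P i)) - nat_mult b (\<nu> (P i))"
      by auto
    then have "z = \<nu> (g \<otimes> P i [^] a \<otimes> inv (P i [^] b))"
      using Pi laurent_nz[of i P, OF Pless] by simp
    then show "z \<in> ?B" using laurent_SucI[OF g(1)] by blast
  qed
  show ?thesis using group_index_cyclic(2)[OF zero diff B] assms unfolding eq by blast
qed

end

end

section \<open>Residues of reduced monomials\<close>

text \<open>The state of the construction at N: P_N is there, but finiteness of the index, U_j,
  algebraicity and n_j are assumed only for j < N. From the recursion for P_(j+1) the locale keeps
  the growth of the values. Facts proved here serve both to choose the data at N and, afterwards, to
  prove independence.\<close>

locale key_sequence = dominating_valuation K \<nu> R CS x y
  for K :: "'a ring" (structure) and \<nu> :: "'a \<Rightarrow> 'g::linordered_ab_group_add"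
    and R CS x y +
  fixes P :: "nat \<Rightarrow> 'a" and n :: "nat \<Rightarrow> nat" and w :: "nat \<Rightarrow> nat \<Rightarrow> nat" and N :: nat
  assumes P_mem: "j \<le> N \<Longrightarrow> P j \<in> nz" "j \<le> N \<Longrightarrow> P j \<in> max_ideal R"
    and fin: "1 \<le> j \<Longrightarrow> j < N \<Longrightarrow> val_index \<nu> P j < \<infinity>"
    and U_val: "1 \<le> j \<Longrightarrow> j < N \<Longrightarrow> \<nu> (P j [^] nbar \<nu> P j) = \<nu> (U_elem K P w j)"
    and alg: "1 \<le> j \<Longrightarrow> j < N \<Longrightarrow>
      ring.algebraic (res_field K \<nu>) (tower K \<nu> R P w (j - 1)) (alpha K \<nu> P w j)"
    and n_eq: "1 \<le> j \<Longrightarrow> j < N \<Longrightarrow> n j = nbar \<nu> P j *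
      degree (ring.Irr (res_field K \<nu>) (tower K \<nu> R P w (j - 1)) (alpha K \<nu> P w j))"
    and growth: "1 \<le> j \<Longrightarrow> j < N \<Longrightarrow> nat_mult (n j) (\<nu> (P j)) < \<nu> (P (Suc j))"
begin

abbreviation "F \<equiv> tower K \<nu> R P w"
abbreviation "\<alpha> \<equiv> alpha K \<nu> P w"
abbreviation "U \<equiv> U_elem K P w"
abbreviation "q \<equiv> nbar \<nu> P"
abbreviation "dg j \<equiv> degree (ring.Irr (res_field K \<nu>) (tower K \<nu> R P w (j - 1)) (alpha K \<nu> P w j))"
abbreviation "pp i \<tau> \<equiv> power_product K P {..i} \<tau>"

lemma P_pos: "j \<le> N \<Longrightarrow> 0 < \<nu> (P j)"
proof -
  assume j: "j \<le> N"
  then have "P j \<in> val_ideal K \<nu>" "P j \<noteq> \<zero>" using P_mem(2)[OF j] nzD(2)[OF P_mem(1)[OF j]] max_ideal_iff by simp_all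
  then show ?thesis by (simp add: val_ideal_iff)
qed

lemma pp_nz' [simp]: "i \<le> N \<Longrightarrow> pp i \<tau> \<in> nz"
  using P_mem by (intro pp_nz) auto

lemma laurent_nz': "i \<le> Suc N \<Longrightarrow> h \<in> laurent P i \<Longrightarrow> h \<in> nz"
  by (rule laurent_nz[of i P]) (use P_mem in auto)

lemma laurent_closed [simp]:
  assumes "i \<le> Suc N"
  shows "g \<in> laurent P i \<Longrightarrow> h \<in> laurent P i \<Longrightarrow> g \<otimes> h \<in> laurent P i"
    "h \<in> laurent P i \<Longrightarrow> inv h \<in> laurent P i" "h \<in> laurent P i \<Longrightarrow> h [^] (k::nat) \<in> laurent P i"
    "power_product K P {..<i} e \<in> laurent P i" "\<one> \<in> laurent P i"
proof -
  have P': "s < i \<Longrightarrow> P s \<in> nz" for s using P_mem assms by auto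
  show "g \<in> laurent P i \<Longrightarrow> h \<in> laurent P i \<Longrightarrow> g \<otimes> h \<in> laurent P i" by (rule laurent_mult[of i P, OF P'])
  show "h \<in> laurent P i \<Longrightarrow> inv h \<in> laurent P i" by (rule laurent_inv[of i P, OF P'])
  show "h \<in> laurent P i \<Longrightarrow> h [^] (k::nat) \<in> laurent P i" by (rule laurent_pow[of i P, OF P'])
  show "power_product K P {..<i} e \<in> laurent P i" by (rule laurent_pp[of i P, OF P'])
  show "\<one> \<in> laurent P i" by (rule laurent_one[of i P, OF P'])
qed

lemma pp_laurent [simp]: "i \<le> N \<Longrightarrow> pp i \<tau> \<in> laurent P (Suc i)"
  using laurent_closed(4)[of "Suc i"] by (simp add: lessThan_Suc_atMost)

lemma U_laurent [simp]: "i \<le> Suc N \<Longrightarrow> U i \<in> laurent P i"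
  by (simp add: U_elem_def)

lemma pp_Suc': "Suc i \<le> N \<Longrightarrow> pp (Suc i) \<tau> = pp i \<tau> \<otimes> P (Suc i) [^] \<tau> (Suc i)"
  using pp_Suc[of "Suc i" P \<tau>] P_mem by (simp add: lessThan_Suc_atMost)

lemma pp_0: "pp 0 \<tau> = P 0 [^] \<tau> 0"
  using pp_insert[of "{}" 0 P \<tau>] P_mem by simp

lemma pp_upd: "i < j \<Longrightarrow> i \<le> N \<Longrightarrow> pp i (\<tau>(j := a)) = pp i \<tau>"
  using P_mem by (intro pp_cong) auto

lemma q_props:
  assumes "1 \<le> j" "j \<le> N" "val_index \<nu> P j < \<infinity>"
  shows "0 < q j" "nat_mult k (\<nu> (P j)) \<in> \<nu> ` laurent P j \<longleftrightarrow> q j dvd k"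
  using nbar_props[of j P] assms P_mem by auto

lemma alpha_res:
  assumes "1 \<le> j" "j \<le> N" "\<nu> (P j [^] q j) = \<nu> (U j)"
  shows "P j [^] q j \<otimes> inv (U j) \<in> un" "\<alpha> j = rs (P j [^] q j \<otimes> inv (U j))"
    "\<alpha> j \<in> carrier L" "\<alpha> j \<noteq> \<zero>\<^bsub>L\<^esub>"
proof -
  have "U j \<in> nz" using assms by (intro laurent_nz'[of j]) auto
  then show 1: "P j [^] q j \<otimes> inv (U j) \<in> un"
    using assms P_mem[of j] by (intro unI) auto
  show "\<alpha> j = rs (P j [^] q j \<otimes> inv (U j))" by (simp add: alpha_def)
  then show "\<alpha> j \<in> carrier L" "\<alpha> j \<noteq> \<zero>\<^bsub>L\<^esub>" using 1 by auto
qed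

lemma alpha_carrier: "1 \<le> j \<Longrightarrow> j < N \<Longrightarrow> \<alpha> j \<in> carrier L"
  using alpha_res U_val by simp

lemma tower_base: "kk \<union> \<alpha> ` {1..i} \<subseteq> carrier L" if "i < N"
  using subfieldE(3)[OF base_subfield] alpha_carrier that by auto

lemma F_subfield: "i < N \<Longrightarrow> subfield (F i) L"
  unfolding tower_def using L.generate_field_is_subfield[OF tower_base] .

lemma F_0: "F 0 = kk"
proof -
  have "kk \<subseteq> carrier L" using subfieldE(3)[OF base_subfield] .
  then have "generate_field L kk \<subseteq> kk"
    using L.generate_field_min_subfield1[OF _ base_subfield] by blast
  moreover have "kk \<subseteq> generate_field L kk" by (auto intro: generate_field.incl)
  ultimately show ?thesis unfolding tower_def by simp
qed

lemma F_base [intro]: "f \<in> kk \<Longrightarrow> f \<in> F i"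
  unfolding tower_def by (intro generate_field.incl) simp

lemma tower_Suc: "F (Suc i) = generate_field L (insert (\<alpha> (Suc i)) (kk \<union> \<alpha> ` {1..i}))"
proof -
  have "{1..Suc i} = insert (Suc i) {1..i}" by auto
  then show ?thesis unfolding tower_def by (simp only: image_insert Un_insert_right)
qed

lemma F_Suc_finite_iff:
  assumes "i < N" "\<alpha> (Suc i) \<in> carrier L"
  shows "L.finite_dimension (F i) (F (Suc i)) \<longleftrightarrow> L.algebraic (F i) (\<alpha> (Suc i))"
  unfolding tower_Suc unfolding tower_def
  by (rule generate_insert_finite[OF tower_base[OF assms(1)] assms(2)])

lemma F_Suc:
  assumes "Suc i < N"
  shows "F (Suc i) = L.simple_extension (F i) (\<alpha> (Suc i))"
proof -
  have "L.algebraic (F i) (\<alpha> (Suc i))" using alg[of "Suc i"] assms by simp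
  then show ?thesis
    unfolding tower_Suc using generate_insert_algebraic[OF tower_base alpha_carrier, of i "Suc i"] assms
    unfolding tower_def by simp
qed

lemma F_mono_Suc: "Suc i < N \<Longrightarrow> F i \<subseteq> F (Suc i)"
  unfolding F_Suc using L.simple_extension_incl[OF subfieldE(3)[OF F_subfield] alpha_carrier] by simp

lemma F_alpha: "Suc i < N \<Longrightarrow> \<alpha> (Suc i) \<in> F (Suc i)"
  unfolding F_Suc using L.simple_extension_mem[OF subfieldE(1)[OF F_subfield] alpha_carrier] by simp

lemma F_closed:
  assumes "i < N"
  shows "a \<in> F i \<Longrightarrow> b \<in> F i \<Longrightarrow> a \<otimes>\<^sub>L b \<in> F i" "a \<in> F i \<Longrightarrow> b \<in> F i \<Longrightarrow> a \<oplus>\<^sub>L b \<in> F i"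
    "\<one>\<^bsub>L\<^esub> \<in> F i" "\<zero>\<^bsub>L\<^esub> \<in> F i" "a \<in> F i \<Longrightarrow> a \<noteq> \<zero>\<^bsub>L\<^esub> \<Longrightarrow> inv\<^bsub>L\<^esub> a \<in> F i" "a \<in> F i \<Longrightarrow> a \<in> carrier L"
    "a \<in> F i \<Longrightarrow> a [^]\<^bsub>L\<^esub> (k::nat) \<in> F i"
proof -
  note S = F_subfield[OF assms]
  show m: "a \<in> F i \<Longrightarrow> b \<in> F i \<Longrightarrow> a \<otimes>\<^sub>L b \<in> F i" for a b using subringE(6)[OF subfieldE(1)[OF S]] .
  show "a \<in> F i \<Longrightarrow> b \<in> F i \<Longrightarrow> a \<oplus>\<^sub>L b \<in> F i" using subringE(7)[OF subfieldE(1)[OF S]] .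
  show o: "\<one>\<^bsub>L\<^esub> \<in> F i" "\<zero>\<^bsub>L\<^esub> \<in> F i" using subringE(3,2)[OF subfieldE(1)[OF S]] .
  show "a \<in> F i \<Longrightarrow> a \<noteq> \<zero>\<^bsub>L\<^esub> \<Longrightarrow> inv\<^bsub>L\<^esub> a \<in> F i" using L.subfield_m_inv(1)[OF S] by blast
  show "a \<in> F i \<Longrightarrow> a \<in> carrier L" using subfieldE(3)[OF S] by blast
  show "a \<in> F i \<Longrightarrow> a [^]\<^bsub>L\<^esub> (k::nat) \<in> F i" using m o by (induction k) auto
qed

lemma F_finsum:
  assumes "i < N" "finite A" "\<And>a. a \<in> A \<Longrightarrow> f a \<in> F i"
  shows "(\<Oplus>\<^bsub>L\<^esub>a\<in>A. f a) \<in> F i"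
  using assms(2,3)
proof (induction A rule: finite_induct)
  case (insert a A)
  then have "f \<in> A \<rightarrow> carrier L" "f a \<in> carrier L" using F_closed(6)[OF assms(1)] by auto
  with insert show ?case using F_closed(2)[OF assms(1)] by simp
qed (use F_closed(4)[OF assms(1)] in simp)

text \<open>Value zero forces the exponent of P_i to be a multiple e q_i. Replacing P_i^(q_i) by U_i
  times the unit with residue \<alpha>_i leaves a Laurent monomial of value zero in the earlier
  elements; a negative exponent is treated by passing to the inverse. For i = 0 the monomial is 1,
  since \<nu>(P_0) > 0.\<close>

lemma unit_residue_mem:
  assumes "i < N" "a \<in> laurent P (Suc i)" "\<nu> a = 0"
  shows "rs a \<in> F i"
  using assms
proof (induction i arbitrary: a)
  case 0
  obtain g m k where g: "g \<in> laurent P 0" "a = g \<otimes> P 0 [^] (m::nat) \<otimes> inv (P 0 [^] (k::nat))"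
    using laurent_SucE[of 0 P a] P_mem 0 by auto
  have P0: "P 0 \<in> nz" "0 < \<nu> (P 0)" using P_mem P_pos by auto
  have "g = \<one>" using g(1) unfolding laurent_def by (auto simp: inv_one)
  then have "nat_mult m (\<nu> (P 0)) = nat_mult k (\<nu> (P 0))" using 0 P0 unfolding g by simp
  then have "m = k" using nat_mult_inject[OF P0(2)] by simp
  then have "a = \<one>" unfolding g \<open>g = \<one>\<close> using P0 by simp
  then show ?case using F_closed(3)[OF \<open>0 < N\<close>] by simp
next
  case (Suc i)
  let ?j = "Suc i"
  have j: "1 \<le> ?j" "?j < N" "?j \<le> N" "i < N" "?j \<le> Suc N" using Suc by auto
  have Pj: "P ?j \<in> nz" using P_mem j by simp
  have Uj: "U ?j \<in> laurent P ?j" "U ?j \<in> nz" using j U_laurent laurent_nz'[of ?j] by auto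
  note al = alpha_res[OF j(1,3) U_val[OF j(1,2)]]
  have pos: "rs (h \<otimes> P ?j [^] m) \<in> F ?j"
    if h: "h \<in> laurent P ?j" "\<nu> (h \<otimes> P ?j [^] m) = 0" for h and m :: nat
  proof -
    have hn: "h \<in> nz" using h j laurent_nz'[of ?j] by simp
    have "nat_mult m (\<nu> (P ?j)) = \<nu> (inv h)" using h hn Pj by (simp add: eq_neg_iff_add_eq_0 add.commute)
    then have "nat_mult m (\<nu> (P ?j)) \<in> \<nu> ` laurent P ?j" using h laurent_closed(2)[OF j(5)] by simp
    then obtain e where e: "m = q ?j * e" using q_props(2)[OF j(1,3) fin[OF j(1,2)]] by (auto simp: dvd_def)
    let ?A = "P ?j [^] q ?j \<otimes> inv (U ?j)"
    have eq: "h \<otimes> P ?j [^] m = (h \<otimes> U ?j [^] e) \<otimes> ?A [^] e"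
    proof -
      have "P ?j [^] q ?j = U ?j \<otimes> ?A" using Pj Uj m_lcomm[of "U ?j" "P ?j [^] q ?j" "inv (U ?j)"] by simp
      then have "P ?j [^] m = (U ?j \<otimes> ?A) [^] e" unfolding e using Pj by (simp add: nat_pow_pow[symmetric])
      also have "\<dots> = U ?j [^] e \<otimes> ?A [^] e" using Uj al(1) by (simp add: nat_pow_distrib)
      finally show ?thesis using hn Uj al(1) by (simp add: m_assoc)
    qed
    have u: "h \<otimes> U ?j [^] e \<in> laurent P ?j" using h Uj j by simp
    then have un: "h \<otimes> U ?j [^] e \<in> nz" using j laurent_nz'[of ?j] by simp
    have Ae: "?A [^] e \<in> un" using al(1) by simp
    have "\<nu> (h \<otimes> U ?j [^] e) = 0"
    proof -
      have "\<nu> ((h \<otimes> U ?j [^] e) \<otimes> ?A [^] e) = \<nu> (h \<otimes> U ?j [^] e) + \<nu> (?A [^] e)"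
        by (rule \<nu>_mult[OF un un_nz[OF Ae]])
      then show ?thesis using h(2) eq un_\<nu>[OF Ae] by simp
    qed
    then have "rs (h \<otimes> U ?j [^] e) \<in> F ?j" using Suc.IH[OF j(4) u] F_mono_Suc[OF j(2)] by blast
    moreover have "rs (?A [^] e) = \<alpha> ?j [^]\<^bsub>L\<^esub> e" using al by simp
    moreover have "h \<otimes> U ?j [^] e \<in> un" using un \<open>\<nu> (h \<otimes> U ?j [^] e) = 0\<close> by (rule unI)
    ultimately show ?thesis
      unfolding eq using rs_mult[OF un_V un_V[OF Ae]] F_closed(1,7)[OF j(2)] F_alpha[OF j(2)] by simp
  qed
  obtain g m k where g: "g \<in> laurent P ?j" "a = g \<otimes> P ?j [^] (m::nat) \<otimes> inv (P ?j [^] (k::nat))"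
    using laurent_SucE[of ?j P a] P_mem Suc by auto
  have gn: "g \<in> nz" using g j laurent_nz'[of ?j] by simp
  have aun: "a \<in> un" using gn Pj Suc(4) unfolding g by (intro unI) auto
  show ?case
  proof (cases "k \<le> m")
    case True
    then have "P ?j [^] m = P ?j [^] (m - k) \<otimes> P ?j [^] k" using Pj by (simp add: nat_pow_mult)
    then have "a = g \<otimes> P ?j [^] (m - k)" unfolding g using gn Pj by (simp add: m_assoc)
    then show ?thesis using pos[OF g(1)] Suc(4) by simp
  next
    case False
    then have "P ?j [^] k = P ?j [^] (k - m) \<otimes> P ?j [^] m" using Pj by (simp add: nat_pow_mult)
    then have "inv a = inv g \<otimes> inv (P ?j [^] m) \<otimes> (P ?j [^] m \<otimes> P ?j [^] (k - m))"
      unfolding g using gn Pj by (simp add: inv_mult_nz m_comm)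
    also have "\<dots> = inv g \<otimes> (inv (P ?j [^] m) \<otimes> P ?j [^] m) \<otimes> P ?j [^] (k - m)"
      using gn Pj by (simp add: m_assoc del: nz_inv)
    finally have ia: "inv a = inv g \<otimes> P ?j [^] (k - m)" using gn Pj by simp
    have "rs (inv a) \<in> F ?j"
      unfolding ia using pos[of "inv g" "k - m"] g(1) j aun un_\<nu>[OF un_closed(2)[OF aun]] unfolding ia by simp
    then have "inv\<^bsub>L\<^esub> (rs (inv a)) \<in> F ?j" using F_closed(5)[OF j(2)] aun rs_un_nonzero[of "inv a"] by simp
    moreover have "inv\<^bsub>L\<^esub> (rs (inv a)) = rs a" using rs_inv[of "inv a"] aun by simp
    ultimately show ?thesis by simp
  qed
qed

text \<open>Exponents beyond i are set to zero so that each reduced monomial has exactly one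
  exponent function and sums over this set count it once. The exponent of P_0 is
  unrestricted.\<close>

definition red_exps :: "nat \<Rightarrow> 'g \<Rightarrow> (nat \<Rightarrow> nat) set" where
  "red_exps i g = {\<tau>. (\<forall>s\<in>{1..i}. \<tau> s < n s) \<and> (\<forall>s>i. \<tau> s = 0) \<and> \<nu> (pp i \<tau>) = g}"

lemma red_exps_0: "red_exps 0 g = {\<tau>. (\<forall>s>0. \<tau> s = 0) \<and> nat_mult (\<tau> 0) (\<nu> (P 0)) = g}"
  unfolding red_exps_def pp_0 using P_mem(1)[of 0] by auto

lemma red_exps_0_unique: "\<tau> \<in> red_exps 0 g \<Longrightarrow> red_exps 0 g = {\<tau>}"
  unfolding red_exps_0 using nat_mult_inject[OF P_pos[of 0]]
  by (auto intro!: ext) (metis gr0I)+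

text \<open>The residue of a combination of reduced monomials divided by h. It is defined as a sum
  of residues, so no carrier condition on the combination itself has to be maintained.\<close>

definition red_sum :: "nat \<Rightarrow> 'a \<Rightarrow> ((nat \<Rightarrow> nat) \<Rightarrow> 'a) \<Rightarrow> 'a set" where
  "red_sum i h c = (\<Oplus>\<^bsub>L\<^esub>\<tau>\<in>red_exps i (\<nu> h). rs (c \<tau>) \<otimes>\<^sub>L rs (pp i \<tau> \<otimes> inv h))"

lemma red_un:
  assumes "i \<le> N" "h \<in> nz" "\<tau> \<in> red_exps i (\<nu> h)"
  shows "pp i \<tau> \<otimes> inv h \<in> un"
  using assms by (intro unI) (auto simp: red_exps_def)

text \<open>Only the value of h is normalized, not h itself: q_j \<nu>(P_j) may be traded for
  \<nu>(U_j), which reduces the exponent of P_j modulo q_j.\<close>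

lemma normal_value:
  assumes j: "1 \<le> j" "j < N" and h: "h \<in> laurent P (Suc j)"
  obtains M r where "M \<in> laurent P j" "r < q j" "\<nu> h = \<nu> (M \<otimes> P j [^] r)"
proof -
  obtain g a b where g: "g \<in> laurent P j" "h = g \<otimes> P j [^] (a::nat) \<otimes> inv (P j [^] (b::nat))"
    using laurent_SucE[of j P h] P_mem h j by auto
  have qj: "0 < q j" using q_props(1)[OF j(1) _ fin[OF j]] j by simp
  have nzs: "g \<in> nz" "P j \<in> nz" "U j \<in> nz" "U j \<in> laurent P j" "j \<le> Suc N"
    using g j P_mem laurent_nz'[of j] by auto
  \<comment> \<open>This is (a - b) + b q_j, a natural number congruent to a - b modulo q_j. The
    surplus b q_j is compensated by U_j^b in the denominator of M.\<close>
  define m where "m = a + b * (q j - 1)"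
  define M where "M = g \<otimes> U j [^] (m div q j) \<otimes> inv (U j [^] b)"
  have M: "M \<in> laurent P j" unfolding M_def using g nzs by simp
  have mb: "m + b = m div q j * q j + m mod q j + b" by simp
  have Uv: "nat_mult k (\<nu> (U j)) = nat_mult (k * q j) (\<nu> (P j))" for k
    using U_val[OF j] nzs by (simp add: nat_mult_mult)
  have "m + b = a + b * q j" unfolding m_def using qj by (cases "q j") auto
  then have "nat_mult m (\<nu> (P j)) + nat_mult b (\<nu> (P j)) = nat_mult a (\<nu> (P j)) + nat_mult (b * q j) (\<nu> (P j))"
    by (metis nat_mult_add)
  moreover have "nat_mult m (\<nu> (P j)) = nat_mult (m div q j * q j) (\<nu> (P j)) + nat_mult (m mod q j) (\<nu> (P j))"
    by (simp flip: nat_mult_add)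
  ultimately have "nat_mult a (\<nu> (P j)) - nat_mult b (\<nu> (P j)) =
      nat_mult (m div q j * q j) (\<nu> (P j)) - nat_mult (b * q j) (\<nu> (P j)) + nat_mult (m mod q j) (\<nu> (P j))"
    by (simp add: algebra_simps)
  then have "\<nu> h = \<nu> (M \<otimes> P j [^] (m mod q j))"
    unfolding g M_def using nzs by (simp add: Uv algebra_simps)
  then show ?thesis using that[OF M mod_less_divisor[OF qj]] by blast
qed

text \<open>The reduced monomials of value \<open>\<nu> h\<close> are grouped by the exponent of \<open>P\<^sub>j\<close>, which is congruent to \<open>r\<close>
  modulo \<open>q j\<close>.\<close>

context
  fixes i j :: nat and h M :: 'a and r :: nat
  assumes j_def: "j = Suc i" and jN: "j < N" and h: "h \<in> laurent P (Suc j)"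
    and M: "M \<in> laurent P j" and r: "r < q j" and hM: "\<nu> h = \<nu> (M \<otimes> P j [^] r)"
begin

lemma j_facts: "1 \<le> j" "j \<le> N" "i < N" "i \<le> N" "j \<le> Suc N" "Suc j \<le> Suc N" "j - 1 = i" "i < j"
  using j_def jN by auto

lemma qj: "0 < q j" "nat_mult k (\<nu> (P j)) \<in> \<nu> ` laurent P j \<longleftrightarrow> q j dvd k"
  using q_props[OF j_facts(1,2) fin[OF j_facts(1) jN]] .

lemma local_nz: "h \<in> nz" "M \<in> nz" "P j \<in> nz" "U j \<in> nz"
  using h M j_facts P_mem[of j] laurent_nz'[of j] laurent_nz'[of "Suc j"] U_laurent[of j] by auto

lemma ppj: "pp j \<tau> = pp i \<tau> \<otimes> P j [^] \<tau> j" "pp i (\<tau>(j := a)) = pp i \<tau>"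
proof -
  have "Suc i \<le> N" using j_facts(2) unfolding j_def .
  then show "pp j \<tau> = pp i \<tau> \<otimes> P j [^] \<tau> j" unfolding j_def by (rule pp_Suc')
  show "pp i (\<tau>(j := a)) = pp i \<tau>" by (rule pp_upd[OF j_facts(8,4)])
qed

text \<open>The denominator left for the earlier elements when P_j carries the exponent r + e q_j:
  each further factor P_j^(q_j) costs one U_j.\<close>

definition NE :: "nat \<Rightarrow> 'a" where "NE e = M \<otimes> inv (U j [^] e)"

lemma NE: "NE e \<in> laurent P j" "NE e \<in> nz"
  using M j_facts laurent_nz'[of j] unfolding NE_def by auto

lemma NE_val: "\<nu> h = \<nu> (NE e) + nat_mult (r + e * q j) (\<nu> (P j))"
  unfolding hM NE_def using local_nz U_val[OF j_facts(1) jN]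
  by (simp add: nat_mult_add nat_mult_mult)

text \<open>For a reduced exponent function, the difference between its entry at j and r, multiplied
  by \<nu>(P_j), is the value of a Laurent monomial in earlier elements, so q_j divides that
  difference. The entry cannot be below r because r < q_j, and the bound n_j = q_j d_j leaves
  exactly the d_j possibilities e < d_j.\<close>

lemma red_exps_decomp:
  "red_exps j (\<nu> h) = (\<Union>e<dg j. (\<lambda>\<tau>. \<tau>(j := r + e * q j)) ` red_exps i (\<nu> (NE e)))"
proof (intro equalityI subsetI)
  fix \<tau> assume \<tau>: "\<tau> \<in> red_exps j (\<nu> h)"
  have sj: "\<tau> j < n j" using \<tau> j_facts by (auto simp: red_exps_def)
  have ppi: "pp i \<tau> \<in> nz" "pp i \<tau> \<in> laurent P j"
    using pp_nz'[OF j_facts(4)] pp_laurent[OF j_facts(4)] j_def by simp_all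
  have val: "\<nu> (pp i \<tau>) + nat_mult (\<tau> j) (\<nu> (P j)) = \<nu> M + nat_mult r (\<nu> (P j))"
  proof -
    have "\<nu> (pp j \<tau>) = \<nu> (M \<otimes> P j [^] r)" using \<tau> hM unfolding red_exps_def by simp
    then show ?thesis using ppi local_nz unfolding ppj by simp
  qed
  have "\<exists>e. \<tau> j = r + e * q j"
  proof (cases "r \<le> \<tau> j")
    case True
    have "nat_mult (\<tau> j) (\<nu> (P j)) = nat_mult (\<tau> j - r) (\<nu> (P j)) + nat_mult r (\<nu> (P j))"
      using True by (simp flip: nat_mult_add)
    then have "nat_mult (\<tau> j - r) (\<nu> (P j)) = \<nu> (M \<otimes> inv (pp i \<tau>))"
      using val ppi local_nz by (simp add: algebra_simps)
    moreover have "M \<otimes> inv (pp i \<tau>) \<in> laurent P j" using M ppi j_facts by simp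
    ultimately have "nat_mult (\<tau> j - r) (\<nu> (P j)) \<in> \<nu> ` laurent P j" by (metis imageI)
    then have "q j dvd \<tau> j - r" using qj(2) by simp
    then obtain e where "\<tau> j - r = q j * e" by (auto simp: dvd_def)
    then show ?thesis using True by (intro exI[of _ e]) (simp add: mult.commute)
  next
    case False
    have "nat_mult r (\<nu> (P j)) = nat_mult (r - \<tau> j) (\<nu> (P j)) + nat_mult (\<tau> j) (\<nu> (P j))"
      using False by (simp flip: nat_mult_add)
    then have "nat_mult (r - \<tau> j) (\<nu> (P j)) = \<nu> (pp i \<tau> \<otimes> inv M)"
      using val ppi local_nz by (simp add: algebra_simps)
    moreover have "pp i \<tau> \<otimes> inv M \<in> laurent P j" using M ppi j_facts by simp
    ultimately have "nat_mult (r - \<tau> j) (\<nu> (P j)) \<in> \<nu> ` laurent P j" by (metis imageI)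
    then have "q j dvd r - \<tau> j" using qj(2) by simp
    then show ?thesis using False r by (auto dest: dvd_imp_le)
  qed
  then obtain e where e: "\<tau> j = r + e * q j" by blast
  have ed: "e < dg j"
  proof (rule ccontr)
    assume "\<not> e < dg j"
    then have "n j \<le> q j * e" unfolding n_eq[OF j_facts(1) jN] not_less by (rule mult_le_mono2)
    then show False using sj e by (simp add: mult.commute)
  qed
  have "\<nu> (pp i \<tau>) + nat_mult (\<tau> j) (\<nu> (P j)) = \<nu> (NE e) + nat_mult (\<tau> j) (\<nu> (P j))"
    using val NE_val[of e] hM local_nz unfolding e by simp
  then have vN: "\<nu> (pp i \<tau>) = \<nu> (NE e)" by simp
  have "\<tau>(j := 0) \<in> red_exps i (\<nu> (NE e))"
    using \<tau> vN ppj(2) j_def unfolding red_exps_def by auto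
  moreover have "\<tau> = (\<tau>(j := 0))(j := r + e * q j)" using e by auto
  ultimately show "\<tau> \<in> (\<Union>e<dg j. (\<lambda>\<tau>. \<tau>(j := r + e * q j)) ` red_exps i (\<nu> (NE e)))"
    using ed by blast
next
  fix \<rho> assume "\<rho> \<in> (\<Union>e<dg j. (\<lambda>\<tau>. \<tau>(j := r + e * q j)) ` red_exps i (\<nu> (NE e)))"
  then obtain e \<tau> where e: "e < dg j" "\<tau> \<in> red_exps i (\<nu> (NE e))" "\<rho> = \<tau>(j := r + e * q j)" by auto
  have "r + e * q j < Suc e * q j" using r by simp
  also have "\<dots> \<le> dg j * q j" using e(1) by (intro mult_right_mono) auto
  finally have less: "r + e * q j < n j" using n_eq[OF j_facts(1) jN] by (simp add: mult.commute)
  have "\<nu> (pp j \<rho>) = \<nu> (pp i \<tau>) + nat_mult (r + e * q j) (\<nu> (P j))"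
    using pp_nz'[OF j_facts(4)] local_nz unfolding e(3) ppj by simp
  also have "\<dots> = \<nu> h" using e(2) NE_val[of e] unfolding red_exps_def by simp
  finally show "\<rho> \<in> red_exps j (\<nu> h)"
    using e less unfolding red_exps_def by (auto simp: j_def le_Suc_eq)
qed

lemma red_exps_disjoint:
  "e \<noteq> e' \<Longrightarrow> disjnt ((\<lambda>\<tau>. \<tau>(j := r + e * q j)) ` A) ((\<lambda>\<tau>. \<tau>(j := r + e' * q j)) ` B)"
proof -
  assume "e \<noteq> e'"
  then have "r + e * q j \<noteq> r + e' * q j" using qj(1) by simp
  then show ?thesis unfolding disjnt_def by (auto dest: fun_cong[of _ _ j])
qed

lemma red_exps_inj: "inj_on (\<lambda>\<tau>. \<tau>(j := a)) (red_exps i g)"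
proof (rule inj_onI)
  fix \<tau> \<rho> assume st: "\<tau> \<in> red_exps i g" "\<rho> \<in> red_exps i g" "\<tau>(j := a) = \<rho>(j := a)"
  then have "\<tau> j = \<rho> j" using j_facts unfolding red_exps_def by auto
  then show "\<tau> = \<rho>" using st(3) by (metis fun_upd_triv fun_upd_upd)
qed

text \<open>The correction for replacing h by its normal form of the same value. It is a nonzero
  element of \<open>F j\<close>, so it affects neither independence nor spanning.\<close>

definition \<mu> :: "'a set" where "\<mu> = rs (M \<otimes> P j [^] r \<otimes> inv h)"

lemma \<mu>: "M \<otimes> P j [^] r \<otimes> inv h \<in> un" "\<mu> \<in> F j" "\<mu> \<noteq> \<zero>\<^bsub>L\<^esub>" "\<mu> \<in> carrier L"
proof -
  show 1: "M \<otimes> P j [^] r \<otimes> inv h \<in> un" using local_nz hM by (intro unI) auto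
  show "\<mu> \<noteq> \<zero>\<^bsub>L\<^esub>" "\<mu> \<in> carrier L" unfolding \<mu>_def using 1 by auto
  have "M \<otimes> P j [^] r \<in> laurent P (Suc j)"
  proof -
    have "P s \<in> nz" if "s \<le> j" for s using P_mem(1)[of s] that j_facts(2) by simp
    then have "M \<otimes> P j [^] r \<otimes> inv (P j [^] (0::nat)) \<in> laurent P (Suc j)" by (rule laurent_SucI[OF _ M])
    then show ?thesis using local_nz by (simp add: inv_one)
  qed
  then have "M \<otimes> P j [^] r \<otimes> inv h \<in> laurent P (Suc j)" using h j_facts by simp
  then show "\<mu> \<in> F j" unfolding \<mu>_def using unit_residue_mem[OF jN] 1 by simp
qed

lemma red_term:
  assumes \<tau>: "\<tau> \<in> red_exps i (\<nu> (NE e))"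
  shows "rs (pp j (\<tau>(j := r + e * q j)) \<otimes> inv h) = \<mu> \<otimes>\<^sub>L (rs (pp i \<tau> \<otimes> inv (NE e)) \<otimes>\<^sub>L \<alpha> j [^]\<^bsub>L\<^esub> e)"
proof -
  let ?A = "P j [^] q j \<otimes> inv (U j)"
  note al = alpha_res[OF j_facts(1,2) U_val[OF j_facts(1) jN]]
  have s: "pp i \<tau> \<in> nz" using j_facts by simp
  have un: "pp i \<tau> \<otimes> inv (NE e) \<in> un" using red_un[OF j_facts(4) NE(2) \<tau>] .
  \<comment> \<open>The field identity behind the factorization, to be used with m = M, t = U_j^e, u
    = P_j^r and v = P_j^(e q_j).\<close>
  have cancel: "a \<otimes> (u \<otimes> v) \<otimes> inv h = (m \<otimes> u \<otimes> inv h) \<otimes> ((a \<otimes> inv (m \<otimes> inv t)) \<otimes> (v \<otimes> inv t))"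
    if "a \<in> nz" "u \<in> nz" "v \<in> nz" "m \<in> nz" "t \<in> nz" for a u v m t
  proof -
    have car: "a \<in> carrier K" "u \<in> carrier K" "v \<in> carrier K" "m \<in> carrier K" "t \<in> carrier K"
      "inv m \<in> carrier K" "inv t \<in> carrier K" "inv h \<in> carrier K"
      using that local_nz(1) by (simp_all only: nzD inv_closed)
    have eq: "inv (m \<otimes> inv t) = inv m \<otimes> t" using that by (simp add: inv_mult_nz)
    have "(m \<otimes> u \<otimes> inv h) \<otimes> ((a \<otimes> inv (m \<otimes> inv t)) \<otimes> (v \<otimes> inv t))
        = (m \<otimes> inv m) \<otimes> (t \<otimes> inv t) \<otimes> (a \<otimes> (u \<otimes> v) \<otimes> inv h)"
      unfolding eq using car by algebra
    then show ?thesis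
      unfolding nz_inv(2)[OF that(4)] nz_inv(2)[OF that(5)] using car by (simp only: l_one m_closed one_closed)
  qed
  have "pp j (\<tau>(j := r + e * q j)) = pp i \<tau> \<otimes> (P j [^] r \<otimes> P j [^] (e * q j))"
    unfolding ppj using local_nz by (simp add: nat_pow_mult)
  then have "pp j (\<tau>(j := r + e * q j)) \<otimes> inv h = (M \<otimes> P j [^] r \<otimes> inv h) \<otimes>
      ((pp i \<tau> \<otimes> inv (NE e)) \<otimes> (P j [^] (e * q j) \<otimes> inv (U j [^] e)))"
    unfolding NE_def using cancel[of "pp i \<tau>" "P j [^] r" "P j [^] (e * q j)" M "U j [^] e"] s local_nz by simp
  also have "P j [^] (e * q j) \<otimes> inv (U j [^] e) = ?A [^] e"
  proof -
    have "?A [^] e \<otimes> U j [^] e = (?A \<otimes> U j) [^] e" using local_nz by (simp add: nat_pow_distrib)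
    also have "?A \<otimes> U j = P j [^] q j" using local_nz by (simp add: m_assoc)
    also have "(P j [^] q j) [^] e = P j [^] (e * q j)" using local_nz by (simp add: nat_pow_pow mult.commute)
    finally have "P j [^] (e * q j) \<otimes> inv (U j [^] e) = ?A [^] e \<otimes> U j [^] e \<otimes> inv (U j [^] e)" by simp
    then show ?thesis using local_nz by (simp add: m_assoc)
  qed
  finally have eq: "pp j (\<tau>(j := r + e * q j)) \<otimes> inv h =
      (M \<otimes> P j [^] r \<otimes> inv h) \<otimes> ((pp i \<tau> \<otimes> inv (NE e)) \<otimes> ?A [^] e)" .
  have V: "?A [^] e \<in> V" "?A \<in> V" using al(1) by blast+
  show ?thesis
    unfolding \<mu>_def eq al(2)
      rs_mult[OF un_V[OF \<mu>(1)] V_closed(4)[OF un_V[OF un] V(1)]] rs_mult[OF un_V[OF un] V(1)] rs_pow[OF V(2)] ..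
qed

text \<open>Up to the factor \<mu>, the sums of level i are the coordinates of the sum of level j
  with respect to 1, \<alpha>_j, ..., \<alpha>_j^(d_j - 1). Uniqueness of coordinates gives
  independence, their existence gives spanning.\<close>

lemma red_sum_decomp:
  assumes c: "\<And>\<tau>. c \<tau> \<in> carrier R" and fin: "\<And>e. finite (red_exps i (\<nu> (NE e)))"
  shows "finite (red_exps j (\<nu> h))"
    "red_sum j h c = \<mu> \<otimes>\<^sub>L (\<Oplus>\<^bsub>L\<^esub>e\<in>{..<dg j}. red_sum i (NE e) (\<lambda>\<tau>. c (\<tau>(j := r + e * q j))) \<otimes>\<^sub>L \<alpha> j [^]\<^bsub>L\<^esub> e)"
    "red_sum i (NE e) c \<in> carrier L"
proof -
  let ?A = "\<lambda>e. (\<lambda>\<tau>. \<tau>(j := r + e * q j)) ` red_exps i (\<nu> (NE e))"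
  let ?f = "\<lambda>\<tau>. rs (c \<tau>) \<otimes>\<^sub>L rs (pp j \<tau> \<otimes> inv h)"
  note al = alpha_res[OF j_facts(1,2) U_val[OF j_facts(1) jN]]
  show "finite (red_exps j (\<nu> h))" unfolding red_exps_decomp using fin by auto
  have cV: "rs (c \<tau>) \<in> carrier L" for \<tau> using c by auto
  have f: "?f \<tau> \<in> carrier L" if "\<tau> \<in> red_exps j (\<nu> h)" for \<tau>
    using red_un[OF j_facts(2) local_nz(1) that] cV by simp
  have t: "rs (pp i \<tau> \<otimes> inv (NE e)) \<in> carrier L" if "\<tau> \<in> red_exps i (\<nu> (NE e))" for \<tau> e
    using red_un[OF j_facts(4) NE(2) that] by simp
  have s: "red_sum i (NE e) b \<in> carrier L" if "\<And>\<tau>. b \<tau> \<in> carrier R" for b e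
    unfolding red_sum_def using t that by (intro L.finsum_closed) auto
  show "red_sum i (NE e) c \<in> carrier L" by (rule s[OF c])
  have inner: "(\<Oplus>\<^bsub>L\<^esub>\<tau>\<in>?A e. ?f \<tau>) =
      \<mu> \<otimes>\<^sub>L (red_sum i (NE e) (\<lambda>\<tau>. c (\<tau>(j := r + e * q j))) \<otimes>\<^sub>L \<alpha> j [^]\<^bsub>L\<^esub> e)" if e: "e < dg j" for e
  proof -
    have sub: "?A e \<subseteq> red_exps j (\<nu> h)" unfolding red_exps_decomp using e by blast
    have "(\<Oplus>\<^bsub>L\<^esub>\<tau>\<in>?A e. ?f \<tau>) = (\<Oplus>\<^bsub>L\<^esub>\<tau>\<in>red_exps i (\<nu> (NE e)). ?f (\<tau>(j := r + e * q j)))"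
      using f sub by (intro L.add.finprod_reindex red_exps_inj) auto
    also have "\<dots> = (\<Oplus>\<^bsub>L\<^esub>\<tau>\<in>red_exps i (\<nu> (NE e)). (\<mu> \<otimes>\<^sub>L \<alpha> j [^]\<^bsub>L\<^esub> e) \<otimes>\<^sub>L
        (rs (c (\<tau>(j := r + e * q j))) \<otimes>\<^sub>L rs (pp i \<tau> \<otimes> inv (NE e))))"
    proof (intro L.finsum_cong')
      fix \<tau> assume \<tau>: "\<tau> \<in> red_exps i (\<nu> (NE e))"
      show "?f (\<tau>(j := r + e * q j)) = (\<mu> \<otimes>\<^sub>L \<alpha> j [^]\<^bsub>L\<^esub> e) \<otimes>\<^sub>L
        (rs (c (\<tau>(j := r + e * q j))) \<otimes>\<^sub>L rs (pp i \<tau> \<otimes> inv (NE e)))"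
        unfolding red_term[OF \<tau>] using cV t[OF \<tau>] \<mu>(4) al(3) by (simp add: L.m_ac)
    qed (use cV t \<mu>(4) al(3) in auto)
    also have "\<dots> = (\<mu> \<otimes>\<^sub>L \<alpha> j [^]\<^bsub>L\<^esub> e) \<otimes>\<^sub>L red_sum i (NE e) (\<lambda>\<tau>. c (\<tau>(j := r + e * q j)))"
      unfolding red_sum_def using cV t \<mu>(4) al(3) fin by (intro L.finsum_rdistr[symmetric]) auto
    also have "\<dots> = \<mu> \<otimes>\<^sub>L (red_sum i (NE e) (\<lambda>\<tau>. c (\<tau>(j := r + e * q j))) \<otimes>\<^sub>L \<alpha> j [^]\<^bsub>L\<^esub> e)"
      using s[of "\<lambda>\<tau>. c (\<tau>(j := r + e * q j))" e] c \<mu>(4) al(3) by (simp add: L.m_ac)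
    finally show ?thesis .
  qed
  have "red_sum j h c = (\<Oplus>\<^bsub>L\<^esub>e\<in>{..<dg j}. \<Oplus>\<^bsub>L\<^esub>\<tau>\<in>?A e. ?f \<tau>)"
    unfolding red_sum_def red_exps_decomp
  proof (rule L.add.finprod_UN_disjoint)
    show "pairwise (\<lambda>e e'. disjnt (?A e) (?A e')) {..<dg j}"
      unfolding pairwise_def using red_exps_disjoint by blast
    show "?f \<tau> \<in> carrier L" if "e \<in> {..<dg j}" "\<tau> \<in> ?A e" for e \<tau>
      using f that unfolding red_exps_decomp by blast
  qed (use fin in auto)
  also have "\<dots> = (\<Oplus>\<^bsub>L\<^esub>e\<in>{..<dg j}. \<mu> \<otimes>\<^sub>L (red_sum i (NE e) (\<lambda>\<tau>. c (\<tau>(j := r + e * q j))) \<otimes>\<^sub>L \<alpha> j [^]\<^bsub>L\<^esub> e))"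
    using inner s c \<mu>(4) al(3) by (intro L.finsum_cong') auto
  also have "\<dots> = \<mu> \<otimes>\<^sub>L (\<Oplus>\<^bsub>L\<^esub>e\<in>{..<dg j}. red_sum i (NE e) (\<lambda>\<tau>. c (\<tau>(j := r + e * q j))) \<otimes>\<^sub>L \<alpha> j [^]\<^bsub>L\<^esub> e)"
    using s c \<mu>(4) al(3) by (intro L.finsum_rdistr[symmetric]) auto
  finally show "red_sum j h c = \<mu> \<otimes>\<^sub>L (\<Oplus>\<^bsub>L\<^esub>e\<in>{..<dg j}. red_sum i (NE e) (\<lambda>\<tau>. c (\<tau>(j := r + e * q j))) \<otimes>\<^sub>L \<alpha> j [^]\<^bsub>L\<^esub> e)" .
qed

end

end

text \<open>\<open>combine\<close> pairs two lists and ignores the excess of the longer one, whereas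
  \<open>red_sum\<close> runs over a set. For distinct entries the coefficients become a function on
  the set, taken to be zero past the end of \<open>Ks\<close>.\<close>

lemma (in ring) combine_distinct:
  assumes "subring K R" "distinct xs" "g \<in> set xs \<rightarrow> carrier R" "set Ks \<subseteq> K"
  shows "\<exists>\<kappa>. (\<forall>x. \<kappa> x \<in> K) \<and> combine Ks (map g xs) = (\<Oplus>x\<in>set xs. \<kappa> x \<otimes> g x) \<and>
    (\<forall>i<length xs. i < length Ks \<longrightarrow> \<kappa> (xs ! i) = Ks ! i)"
  using assms(2-)
proof (induction xs arbitrary: Ks)
  case Nil
  then show ?case using subringE(2)[OF assms(1)] by (intro exI[of _ "\<lambda>_. \<zero>"]) simp
next
  case (Cons x xs)
  have KR: "K \<subseteq> carrier R" by (rule subringE(1)[OF assms(1)])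
  have g: "g x \<in> carrier R" "g \<in> set xs \<rightarrow> carrier R" using Cons.prems by auto
  show ?case
  proof (cases Ks)
    case Nil
    have "(\<Oplus>y\<in>set (x # xs). \<zero> \<otimes> g y) = (\<Oplus>y\<in>set (x # xs). \<zero>)"
      using Cons.prems(2) by (intro finsum_cong') (auto simp: Pi_def)
    then show ?thesis unfolding Nil using subringE(2)[OF assms(1)]
      by (intro exI[of _ "\<lambda>_. \<zero>"]) simp
  next
    case Ks: (Cons k ks)
    obtain \<kappa> where \<kappa>: "\<And>x. \<kappa> x \<in> K" "combine ks (map g xs) = (\<Oplus>x\<in>set xs. \<kappa> x \<otimes> g x)"
        "\<And>i. i < length xs \<Longrightarrow> i < length ks \<Longrightarrow> \<kappa> (xs ! i) = ks ! i"
      using Cons.IH[of ks] Cons.prems g(2) unfolding Ks by auto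
    have k: "k \<in> K" "k \<in> carrier R" using Cons.prems KR unfolding Ks by auto
    have \<kappa>R: "\<kappa> y \<in> carrier R" for y using \<kappa>(1) KR by blast
    have x: "x \<notin> set xs" using Cons.prems by simp
    have "(\<Oplus>y\<in>set xs. \<kappa> y \<otimes> g y) = (\<Oplus>y\<in>set xs. (\<kappa>(x := k)) y \<otimes> g y)"
      using x g(2) \<kappa>R by (intro finsum_cong') auto
    moreover have "(\<Oplus>y\<in>insert x (set xs). (\<kappa>(x := k)) y \<otimes> g y) =
        k \<otimes> g x \<oplus> (\<Oplus>y\<in>set xs. (\<kappa>(x := k)) y \<otimes> g y)"
      using x g k \<kappa>R by (subst finsum_insert) (auto simp: Pi_def)
    ultimately have "combine Ks (map g (x # xs)) = (\<Oplus>y\<in>set (x # xs). (\<kappa>(x := k)) y \<otimes> g y)"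
      unfolding Ks using \<kappa>(2) by simp
    moreover have "\<forall>i<length (x # xs). i < length Ks \<longrightarrow> (\<kappa>(x := k)) ((x # xs) ! i) = Ks ! i"
    proof (intro allI impI)
      fix i assume i: "i < length (x # xs)" "i < length Ks"
      show "(\<kappa>(x := k)) ((x # xs) ! i) = Ks ! i"
      proof (cases i)
        case (Suc l)
        then have "xs ! l \<noteq> x" using x i by (metis Suc_less_eq length_Cons nth_mem)
        then show ?thesis using Suc i \<kappa>(3)[of l] unfolding Ks by simp
      qed (simp add: Ks)
    qed
    ultimately show ?thesis using \<kappa>(1) k(1) by (intro exI[of _ "\<kappa>(x := k)"]) auto
  qed
qed

section \<open>Independence of the reduced monomials, and spanning above a threshold\<close>

context key_sequence
begin

lemma red_sum_mem:
  assumes "i < N" "h \<in> laurent P (Suc i)" "\<And>\<tau>. c \<tau> \<in> carrier R" "finite (red_exps i (\<nu> h))"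
  shows "red_sum i h c \<in> F i"
  unfolding red_sum_def
proof (rule F_finsum[OF assms(1,4)])
  fix \<tau> assume \<tau>: "\<tau> \<in> red_exps i (\<nu> h)"
  have i: "i \<le> N" "Suc i \<le> Suc N" using assms(1) by auto
  have h: "h \<in> nz" using laurent_nz'[OF i(2) assms(2)] .
  have "pp i \<tau> \<otimes> inv h \<in> laurent P (Suc i)" using assms(2) i by simp
  then have "rs (pp i \<tau> \<otimes> inv h) \<in> F i"
    using unit_residue_mem[OF assms(1)] un_\<nu>[OF red_un[OF i(1) h \<tau>]] by blast
  moreover have "rs (c \<tau>) \<in> F i" using assms(3) by blast
  ultimately show "rs (c \<tau>) \<otimes>\<^sub>L rs (pp i \<tau> \<otimes> inv h) \<in> F i" using F_closed(1)[OF assms(1)] by blast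
qed

text \<open>As \<nu>(P_0) > 0, the value determines the exponent of P_0, and the sum has a single
  term.\<close>

lemma red_sum_0:
  assumes h: "h \<in> laurent P 1" and \<tau>: "\<tau> \<in> red_exps 0 (\<nu> h)" and c: "\<And>\<tau>. c \<tau> \<in> carrier R"
  shows "red_sum 0 h c = rs (c \<tau>) \<otimes>\<^sub>L rs (pp 0 \<tau> \<otimes> inv h)"
    and "pp 0 \<tau> \<otimes> inv h \<in> un"
proof -
  have "h \<in> nz" using laurent_nz'[of 1] h by simp
  then show u: "pp 0 \<tau> \<otimes> inv h \<in> un" using red_un[of 0 h \<tau>] \<tau> by simp
  have "rs (c \<tau>) \<in> carrier L" using c by auto
  then show "red_sum 0 h c = rs (c \<tau>) \<otimes>\<^sub>L rs (pp 0 \<tau> \<otimes> inv h)"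
    unfolding red_sum_def red_exps_0_unique[OF \<tau>] using u by simp
qed

lemma red_finite:
  assumes "i < N" "h \<in> laurent P (Suc i)"
  shows "finite (red_exps i (\<nu> h))"
  using assms
proof (induction i arbitrary: h)
  case 0
  then show ?case using red_exps_0_unique finite.simps by (metis finite.emptyI finite_insert all_not_in_conv)
next
  case (Suc i)
  obtain M r where Mr: "M \<in> laurent P (Suc i)" "r < q (Suc i)" "\<nu> h = \<nu> (M \<otimes> P (Suc i) [^] r)"
    using normal_value[of "Suc i" h] Suc.prems by auto
  note red_exps_decomp[OF refl Suc.prems Mr] NE(1)[OF refl Suc.prems Mr]
  then show ?case using Suc.IH Suc.prems by simp
qed

text \<open>Divide by \<mu>: the powers of \<alpha>_j below its degree are independent over
  \<open>F i\<close>, so each sum of level i vanishes and the induction hypothesis applies to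
  it.\<close>

lemma red_sum_eq_zero_imp:
  assumes "i < N" "h \<in> laurent P (Suc i)" "\<And>\<tau>. c \<tau> \<in> carrier R" "red_sum i h c = \<zero>\<^bsub>L\<^esub>"
    "\<tau> \<in> red_exps i (\<nu> h)"
  shows "rs (c \<tau>) = \<zero>\<^bsub>L\<^esub>"
  using assms
proof (induction i arbitrary: h c \<tau>)
  case 0
  have h: "h \<in> laurent P 1" using 0(2) by simp
  note r = red_sum_0[OF h 0(5,3)]
  have c: "rs (c \<tau>) \<in> carrier L" using 0(3) by blast
  have "rs (c \<tau>) \<otimes>\<^sub>L rs (pp 0 \<tau> \<otimes> inv h) = \<zero>\<^bsub>L\<^esub>" using r(1) 0(4) by (rule subst)
  then show ?case
    using L.integral[OF _ c rs_closed[OF un_V[OF r(2)]]] rs_un_nonzero[OF r(2)] by blast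
next
  case (Suc i)
  let ?j = "Suc i"
  have j: "1 \<le> ?j" "?j < N" "i < N" "i \<le> N" using Suc by auto
  obtain M r where Mr: "M \<in> laurent P ?j" "r < q ?j" "\<nu> h = \<nu> (M \<otimes> P ?j [^] r)"
    using normal_value[OF j(1,2) Suc.prems(2)] by blast
  note ctx = refl[of ?j] j(2) Suc.prems(2) Mr
  let ?N = "NE ?j M" and ?c = "\<lambda>e \<rho>. c (\<rho>(?j := r + e * q ?j))"
  have N: "?N e \<in> laurent P ?j" for e by (rule NE(1)[OF ctx])
  have fin: "finite (red_exps i (\<nu> (?N e)))" for e by (rule red_finite[OF j(3) N])
  let ?S = "\<Oplus>\<^bsub>L\<^esub>e\<in>{..<dg ?j}. red_sum i (?N e) (?c e) \<otimes>\<^sub>L \<alpha> ?j [^]\<^bsub>L\<^esub> e"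
  have \<mu>L: "\<mu> ?j h M r \<noteq> \<zero>\<^bsub>L\<^esub>" "\<mu> ?j h M r \<in> carrier L" by (rule \<mu>(3)[OF ctx], rule \<mu>(4)[OF ctx])
  have s: "red_sum i (?N e) (?c e) \<in> F i" for e by (rule red_sum_mem[OF j(3) N Suc.prems(3) fin])
  have al: "\<alpha> ?j \<in> carrier L" using alpha_carrier[OF j(1,2)] .
  have SL: "?S \<in> carrier L" using s F_closed(6)[OF j(3)] al by (intro L.finsum_closed) auto
  have "red_sum ?j h c = \<mu> ?j h M r \<otimes>\<^sub>L ?S"
    by (rule red_sum_decomp(2)[OF ctx Suc.prems(3) fin])
  then have "\<mu> ?j h M r \<otimes>\<^sub>L ?S = \<zero>\<^bsub>L\<^esub>" using Suc.prems(4) by simp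
  then have "?S = \<zero>\<^bsub>L\<^esub>" using L.integral[OF _ \<mu>L(2) SL] \<mu>L(1) by blast
  then have z: "\<forall>e<dg ?j. red_sum i (?N e) (?c e) = \<zero>\<^bsub>L\<^esub>"
    using L.exp_base_finsum_unique[OF F_subfield[OF j(3)] al, of "dg ?j" "\<lambda>e. red_sum i (?N e) (?c e)"]
      alg[OF j(1,2)] s by simp
  obtain e \<rho> where e: "e < dg ?j" "\<rho> \<in> red_exps i (\<nu> (?N e))" "\<tau> = \<rho>(?j := r + e * q ?j)"
    using Suc.prems(5) unfolding red_exps_decomp[OF ctx] by blast
  have "rs (?c e \<rho>) = \<zero>\<^bsub>L\<^esub>"
    by (rule Suc.IH[OF j(3) N _ z[rule_format, OF e(1)] e(2)]) (rule Suc.prems(3))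
  then show ?case unfolding e(3) .
qed

text \<open>The largest reduced monomial without P_0; its value is the threshold for
  spanning.\<close>

abbreviation "big i \<equiv> power_product K P {1..i} (\<lambda>s. n s - 1)"

lemma pp1_nz: "i \<le> N \<Longrightarrow> power_product K P {1..i} e \<in> nz"
  using P_mem(1) by (intro pp_nz) auto

lemma pp1_Suc:
  assumes "Suc i \<le> N"
  shows "power_product K P {1..Suc i} e = P (Suc i) [^] e (Suc i) \<otimes> power_product K P {1..i} e"
proof -
  have "{1..Suc i} = insert (Suc i) {1..i}" by auto
  moreover have "power_product K P (insert (Suc i) {1..i}) e = P (Suc i) [^] e (Suc i) \<otimes> power_product K P {1..i} e"
    using P_mem(1) assms by (intro pp_insert) auto
  ultimately show ?thesis by metis
qed

text \<open>Expand f / \<mu> in powers of \<alpha>_j over the previous field and realize each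
  coordinate by induction. At the bottom there is one monomial, and its coefficient is lifted from k
  to the coefficient set.\<close>

lemma red_sum_surj:
  assumes "i < N" "h \<in> laurent P (Suc i)" "\<nu> (big i) \<le> \<nu> h" "f \<in> F i"
  shows "\<exists>c. (\<forall>\<tau>. c \<tau> \<in> CS) \<and> red_sum i h c = f"
  using assms
proof (induction i arbitrary: h f)
  case 0
  have N0: "P s \<in> nz" if "s \<le> 0" for s using that P_mem(1)[of s] by simp
  have P0: "P 0 \<in> nz" using N0 by simp
  have hnz: "h \<in> nz" using laurent_nz'[of 1 h] 0 by simp
  obtain g m k where g: "g \<in> laurent P 0" "h = g \<otimes> P 0 [^] (m::nat) \<otimes> inv (P 0 [^] (k::nat))"
    using laurent_SucE[of 0 P h, OF N0] 0(2) by blast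
  have "g = \<one>" using g(1) unfolding laurent_def by (auto simp: inv_one)
  then have vh: "\<nu> h = nat_mult m (\<nu> (P 0)) - nat_mult k (\<nu> (P 0))" unfolding g using P0 by simp
  \<comment> \<open>\<open>big 0\<close> is the empty product, so the threshold says that the value
    of h is a nonnegative multiple of \<nu>(P_0).\<close>
  then have "nat_mult k (\<nu> (P 0)) \<le> nat_mult m (\<nu> (P 0))" using 0(3) by simp
  then have "k \<le> m" using nat_mult_strict_mono[OF P_pos[of 0], of m k] by (meson leD not_le zero_le)
  then have "nat_mult m (\<nu> (P 0)) = nat_mult (m - k) (\<nu> (P 0)) + nat_mult k (\<nu> (P 0))"
    by (simp flip: nat_mult_add)
  then have "(\<lambda>s. if s = 0 then m - k else 0) \<in> red_exps 0 (\<nu> h)" unfolding red_exps_0 vh by simp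
  then obtain \<tau> where \<tau>: "\<tau> \<in> red_exps 0 (\<nu> h)" by blast
  have h1: "h \<in> laurent P 1" using 0(2) by simp
  have un: "pp 0 \<tau> \<otimes> inv h \<in> un" using red_un[OF _ hnz \<tau>] by simp
  have "pp 0 \<tau> \<otimes> inv h \<in> laurent P (Suc 0)" using 0 pp_laurent[of 0 \<tau>] by simp
  then have u: "rs (pp 0 \<tau> \<otimes> inv h) \<in> F 0" using unit_residue_mem[OF 0(1)] un_\<nu>[OF un] by blast
  let ?u = "rs (pp 0 \<tau> \<otimes> inv h)"
  have "f \<otimes>\<^sub>L inv\<^bsub>L\<^esub> ?u \<in> kk"
    using F_closed(1,5)[OF 0(1)] u 0(4) rs_un_nonzero[OF un] unfolding F_0 by blast
  then obtain a where a: "a \<in> CS" "f \<otimes>\<^sub>L inv\<^bsub>L\<^esub> ?u = rs a" using base_E by metis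
  have fL: "f \<in> carrier L" "?u \<in> carrier L" using F_closed(6)[OF 0(1)] 0(4) u by blast+
  have ui: "inv\<^bsub>L\<^esub> ?u \<otimes>\<^sub>L ?u = \<one>\<^bsub>L\<^esub>" "inv\<^bsub>L\<^esub> ?u \<in> carrier L"
    using L.field_Units fL(2) rs_un_nonzero[OF un] by (simp_all add: L.Units_l_inv)
  have "red_sum 0 h (\<lambda>_. a) = rs a \<otimes>\<^sub>L ?u" using red_sum_0(1)[OF h1 \<tau>, of "\<lambda>_. a"] a(1) by simp
  also have "\<dots> = f" unfolding a(2)[symmetric] using fL ui by (simp add: L.m_assoc)
  finally show ?case by (intro exI[of _ "\<lambda>_. a"] conjI allI a(1))
next
  case (Suc i)
  let ?j = "Suc i"
  have j: "1 \<le> ?j" "?j < N" "i < N" "i \<le> N" "?j \<le> N" using Suc by auto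
  obtain M r where Mr: "M \<in> laurent P ?j" "r < q ?j" "\<nu> h = \<nu> (M \<otimes> P ?j [^] r)"
    using normal_value[OF j(1,2) Suc.prems(2)] by blast
  note ctx = refl[of ?j] j(2) Suc.prems(2) Mr
  let ?N = "NE ?j M"
  have N: "?N e \<in> laurent P ?j" for e by (rule NE(1)[OF ctx])
  have fin: "finite (red_exps i (\<nu> (?N e)))" for e by (rule red_finite[OF j(3) N])
  have \<mu>L: "\<mu> ?j h M r \<noteq> \<zero>\<^bsub>L\<^esub>" "\<mu> ?j h M r \<in> F ?j" "\<mu> ?j h M r \<in> carrier L"
    by (rule \<mu>(3)[OF ctx], rule \<mu>(2)[OF ctx], rule \<mu>(4)[OF ctx])
  have al: "\<alpha> ?j \<in> carrier L" using alpha_carrier[OF j(1,2)] .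
  let ?\<mu> = "\<mu> ?j h M r"
  have "inv\<^bsub>L\<^esub> ?\<mu> \<otimes>\<^sub>L f \<in> F ?j" using F_closed(1,5)[OF j(2)] \<mu>L Suc.prems(4) by blast
  then have se: "inv\<^bsub>L\<^esub> ?\<mu> \<otimes>\<^sub>L f \<in> L.simple_extension (F i) (\<alpha> ?j)" unfolding F_Suc[OF j(2)] .
  have ag: "L.algebraic (F i) (\<alpha> ?j)" "dg ?j = degree (L.Irr (F i) (\<alpha> ?j))"
    using alg[OF j(1,2)] by simp_all
  obtain g where g: "\<And>e. g e \<in> F i" "inv\<^bsub>L\<^esub> ?\<mu> \<otimes>\<^sub>L f = (\<Oplus>\<^bsub>L\<^esub>e\<in>{..<dg ?j}. g e \<otimes>\<^sub>L \<alpha> ?j [^]\<^bsub>L\<^esub> e)"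
    by (rule L.simple_extension_finsum[OF F_subfield[OF j(3)] al ag se]) (rule that)
  have qj: "0 < q ?j" using Mr(2) by simp
  have "\<exists>c. (\<forall>\<tau>. c \<tau> \<in> CS) \<and> red_sum i (?N e) c = g e" if e: "e < dg ?j" for e
  proof (rule Suc.IH[OF j(3) N _ g(1)])
    \<comment> \<open>The exponent r + e q_j is at most n_j - 1, the exponent of P_j in the
      threshold monomial. Splitting off this power therefore leaves a value that still reaches the
      threshold of level i.\<close>
    have "r + e * q ?j < Suc e * q ?j" using Mr by simp
    also have "\<dots> \<le> dg ?j * q ?j" using e by (intro mult_le_mono1) simp
    finally have "r + e * q ?j \<le> n ?j - 1" using n_eq[OF j(1,2)] by (simp add: mult.commute)
    then have "nat_mult (r + e * q ?j) (\<nu> (P ?j)) \<le> nat_mult (n ?j - 1) (\<nu> (P ?j))"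
      by (rule nat_mult_mono[OF P_pos[OF j(5)]])
    then have "nat_mult (r + e * q ?j) (\<nu> (P ?j)) + \<nu> (big i) \<le> nat_mult (n ?j - 1) (\<nu> (P ?j)) + \<nu> (big i)"
      by (rule add_right_mono)
    also have "\<dots> \<le> \<nu> h"
      using Suc.prems(3) pp1_nz[OF j(4)] P_mem(1)[OF j(5)] unfolding pp1_Suc[OF j(5)] by simp
    also have "\<nu> h = nat_mult (r + e * q ?j) (\<nu> (P ?j)) + \<nu> (?N e)"
      by (subst add.commute) (rule NE_val[OF ctx])
    finally show "\<nu> (big i) \<le> \<nu> (?N e)" by (simp only: add_le_cancel_left)
  qed
  then obtain c where c: "\<And>e \<tau>. e < dg ?j \<Longrightarrow> c e \<tau> \<in> CS"
      "\<And>e. e < dg ?j \<Longrightarrow> red_sum i (?N e) (c e) = g e" by metis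
  \<comment> \<open>The families for the different e are glued by reading e off the exponent of P_j.
    Resetting that exponent to zero recovers the exponent function of level i; the default zero
    keeps b inside \<open>CS\<close>.\<close>
  define b where "b \<tau> = (let e = (\<tau> ?j - r) div q ?j in if e < dg ?j then c e (\<tau>(?j := 0)) else \<zero>)" for \<tau>
  have bCS: "b \<tau> \<in> CS" for \<tau> unfolding b_def Let_def using c(1) by simp
  have br: "red_sum i (?N e) (\<lambda>\<tau>. b (\<tau>(?j := r + e * q ?j))) = g e" if e: "e < dg ?j" for e
  proof -
    have "b (\<tau>(?j := r + e * q ?j)) = c e \<tau>" if \<tau>: "\<tau> \<in> red_exps i (\<nu> (?N e))" for \<tau>
    proof -
      have "\<tau> ?j = 0" using \<tau> unfolding red_exps_def by simp
      then have "(\<tau>(?j := r + e * q ?j))(?j := 0) = \<tau>" by auto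
      then show ?thesis unfolding b_def Let_def using e qj by simp
    qed
    then have "red_sum i (?N e) (\<lambda>\<tau>. b (\<tau>(?j := r + e * q ?j))) = red_sum i (?N e) (c e)"
      unfolding red_sum_def using c(1)[OF e] red_un[OF j(4) NE(2)[OF ctx]]
      by (intro L.finsum_cong') auto
    then show ?thesis using c(2)[OF e] by simp
  qed
  have "red_sum ?j h b = ?\<mu> \<otimes>\<^sub>L (\<Oplus>\<^bsub>L\<^esub>e\<in>{..<dg ?j}. red_sum i (?N e) (\<lambda>\<tau>. b (\<tau>(?j := r + e * q ?j))) \<otimes>\<^sub>L \<alpha> ?j [^]\<^bsub>L\<^esub> e)"
    by (rule red_sum_decomp(2)[OF ctx CS_R[OF bCS] fin])
  also have "\<dots> = ?\<mu> \<otimes>\<^sub>L (\<Oplus>\<^bsub>L\<^esub>e\<in>{..<dg ?j}. g e \<otimes>\<^sub>L \<alpha> ?j [^]\<^bsub>L\<^esub> e)"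
    using br g(1) F_closed(6)[OF j(3)] al by (intro arg_cong[of _ _ "\<lambda>z. ?\<mu> \<otimes>\<^sub>L z"] L.finsum_cong') auto
  also have "\<dots> = ?\<mu> \<otimes>\<^sub>L (inv\<^bsub>L\<^esub> ?\<mu> \<otimes>\<^sub>L f)" unfolding g(2) ..
  also have "\<dots> = f"
    using \<mu>L F_closed(6)[OF j(2) Suc.prems(4)] L.field_Units
    by (simp add: L.m_assoc[symmetric] L.Units_r_inv)
  finally show ?case using bCS by blast
qed

lemma monomials_independent:
  assumes r: "r < N" and m: "0 < m"
    and less: "\<forall>l\<in>{1..m}. \<forall>k\<in>{1..r}. e k l < n k"
    and inj: "inj_on (\<lambda>l. map (\<lambda>k. e k l) [0..<r + 1]) {1..m}"
    and val: "\<forall>l\<in>{1..m}. \<nu> (pp r (\<lambda>k. e k l)) = \<nu> (pp r (\<lambda>k. e k 1))"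
  shows "L.independent kk (\<one>\<^bsub>L\<^esub> # map (\<lambda>l. rs (pp r (\<lambda>k. e k l) \<otimes> inv (pp r (\<lambda>k. e k 1)))) [2..<m + 1])"
proof -
  define h where "h = pp r (\<lambda>k. e k 1)"
  \<comment> \<open>Truncated beyond r, as \<open>red_exps\<close> requires; the given exponents are
    arbitrary there.\<close>
  define f where "f l = (\<lambda>k. if k \<le> r then e k l else 0)" for l
  define g where "g \<tau> = rs (pp r \<tau> \<otimes> inv h)" for \<tau>
  define xs where "xs = map f [1..<m + 1]"
  have rN: "r \<le> N" "Suc r \<le> Suc N" using r by auto
  have h: "h \<in> nz" "h \<in> laurent P (Suc r)" unfolding h_def using rN by simp_all
  have ppf: "pp r (f l) = pp r (\<lambda>k. e k l)" for l
    unfolding f_def using P_mem(1) r by (intro pp_cong) auto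
  have fE: "f l \<in> red_exps r (\<nu> h)" if "l \<in> {1..m}" for l
  proof -
    have "\<forall>s\<in>{1..r}. f l s < n s" "\<forall>s>r. f l s = 0" using that less unfolding f_def by auto
    moreover have "\<nu> (pp r (f l)) = \<nu> h" unfolding ppf h_def using val that by blast
    ultimately show ?thesis unfolding red_exps_def by blast
  qed
  have set_xs: "set xs \<subseteq> red_exps r (\<nu> h)" unfolding xs_def using fE by auto
  have gL: "g \<tau> \<in> carrier L" if "\<tau> \<in> red_exps r (\<nu> h)" for \<tau>
    unfolding g_def using red_un[OF rN(1) h(1) that] by blast
  have "inj_on f {1..m}"
  proof (rule inj_onI)
    fix l l' assume l: "l \<in> {1..m}" "l' \<in> {1..m}" "f l = f l'"
    have "e k l = e k l'" if "k \<le> r" for k using fun_cong[OF l(3), of k] that by (simp add: f_def)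
    then have "map (\<lambda>k. e k l) [0..<r + 1] = map (\<lambda>k. e k l') [0..<r + 1]" by simp
    then show "l = l'" using inj_onD[OF inj] l by blast
  qed
  moreover have "set [1..<m + 1] = {1..m}" by auto
  ultimately have "inj_on f (set [1..<m + 1])" by (simp only:)
  then have dist: "distinct xs" unfolding xs_def by (simp only: distinct_map distinct_upt)
  have "[1..<m + 1] = 1 # [2..<m + 1]" using m by (simp add: upt_conv_Cons numeral_2_eq_2)
  then have "map g xs = g (f 1) # map (\<lambda>l. g (f l)) [2..<m + 1]" unfolding xs_def by simp
  moreover have "g (f 1) = \<one>\<^bsub>L\<^esub>"
  proof -
    have "pp r (f 1) \<otimes> inv h = \<one>" unfolding ppf using h(1) unfolding h_def by simp
    then show ?thesis unfolding g_def by simp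
  qed
  ultimately have list: "map g xs = \<one>\<^bsub>L\<^esub> # map (\<lambda>l. rs (pp r (\<lambda>k. e k l) \<otimes> inv h)) [2..<m + 1]"
    unfolding g_def ppf by simp
  have "L.independent kk (map g xs)"
  proof (rule L.trivial_combine_imp_independent[OF base_subfield])
    show "set (map g xs) \<subseteq> carrier L" using set_xs gL by auto
    fix Ks assume Ks: "set Ks \<subseteq> kk" "L.combine Ks (map g xs) = \<zero>\<^bsub>L\<^esub>"
    obtain \<kappa> where \<kappa>: "\<And>\<tau>. \<kappa> \<tau> \<in> kk" "L.combine Ks (map g xs) = (\<Oplus>\<^bsub>L\<^esub>\<tau>\<in>set xs. \<kappa> \<tau> \<otimes>\<^sub>L g \<tau>)"
        "\<And>i. i < length xs \<Longrightarrow> i < length Ks \<Longrightarrow> \<kappa> (xs ! i) = Ks ! i"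
      using L.combine_distinct[OF subfieldE(1)[OF base_subfield] dist _ Ks(1), of g] set_xs gL by blast
    \<comment> \<open>A relation among the listed monomials is lifted to R and extended by zero to
      all reduced monomials of the same value.\<close>
    have "\<forall>\<tau>. \<exists>c. c \<in> carrier R \<and> rs c = (if \<tau> \<in> set xs then \<kappa> \<tau> else \<zero>\<^bsub>L\<^esub>)"
    proof
      fix \<tau>
      obtain c where "c \<in> CS" "\<kappa> \<tau> = rs c" using base_E[OF \<kappa>(1)] by blast
      then show "\<exists>c. c \<in> carrier R \<and> rs c = (if \<tau> \<in> set xs then \<kappa> \<tau> else \<zero>\<^bsub>L\<^esub>)"
        using rs_zero R_closed(2) CS_R[of c] by (intro exI[of _ "if \<tau> \<in> set xs then c else \<zero>"]) simp
    qed
    then obtain c where c: "\<And>\<tau>. c \<tau> \<in> carrier R" "\<And>\<tau>. rs (c \<tau>) = (if \<tau> \<in> set xs then \<kappa> \<tau> else \<zero>\<^bsub>L\<^esub>)"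
      by metis
    have fin: "finite (red_exps r (\<nu> h))" by (rule red_finite[OF r h(2)])
    have cL: "rs (c \<tau>) \<in> carrier L" for \<tau> using c(1) by blast
    have "red_sum r h c = (\<Oplus>\<^bsub>L\<^esub>\<tau>\<in>set xs. \<kappa> \<tau> \<otimes>\<^sub>L g \<tau>)"
      unfolding red_sum_def g_def[symmetric]
    proof (rule L.add.finprod_mono_neutral_cong_right[OF fin set_xs])
      show "rs (c \<tau>) \<otimes>\<^sub>L g \<tau> = \<zero>\<^bsub>L\<^esub>" if "\<tau> \<in> red_exps r (\<nu> h) - set xs" for \<tau>
        using that gL unfolding c(2) by simp
      show "rs (c \<tau>) \<otimes>\<^sub>L g \<tau> = \<kappa> \<tau> \<otimes>\<^sub>L g \<tau>" if "\<tau> \<in> set xs" for \<tau>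
        using that unfolding c(2) by simp
      show "(\<lambda>\<tau>. rs (c \<tau>) \<otimes>\<^sub>L g \<tau>) \<in> red_exps r (\<nu> h) \<rightarrow> carrier L" using gL cL by auto
    qed
    then have "red_sum r h c = \<zero>\<^bsub>L\<^esub>" using \<kappa>(2) Ks(2) by simp
    then have rz: "rs (c \<tau>) = \<zero>\<^bsub>L\<^esub>" if "\<tau> \<in> set xs" for \<tau>
      by (rule red_sum_eq_zero_imp[OF r h(2) c(1) _ subsetD[OF set_xs that]])
    then have z: "\<kappa> \<tau> = \<zero>\<^bsub>L\<^esub>" if "\<tau> \<in> set xs" for \<tau> using c(2) rz that by simp
    show "set (take (length (map g xs)) Ks) \<subseteq> {\<zero>\<^bsub>L\<^esub>}"
    proof
      fix k assume "k \<in> set (take (length (map g xs)) Ks)"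
      then obtain l where l: "l < length xs" "l < length Ks" "k = Ks ! l"
        unfolding in_set_conv_nth by auto
      then have "k = \<kappa> (xs ! l)" using \<kappa>(3)[of l] by simp
      then show "k \<in> {\<zero>\<^bsub>L\<^esub>}" using z[OF nth_mem[OF l(1)]] by simp
    qed
  qed
  then show ?thesis unfolding list unfolding h_def .
qed

end

section \<open>The next element of the sequence\<close>

context key_sequence
begin

lemma dg_pos:
  assumes "1 \<le> j" "j < N"
  shows "0 < dg j" "0 < n j"
proof -
  have jN: "j \<le> N" "j - 1 < N" using assms by auto
  note al = alpha_res[OF assms(1) jN(1) U_val[OF assms]]
  show d: "0 < dg j" by (rule L.Irr_expansion(1)[OF F_subfield[OF jN(2)] al(3,4) alg[OF assms] refl])
  have "0 < q j" by (rule q_props(1)[OF assms(1) jN(1) fin[OF assms]])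
  with d show "0 < n j" unfolding n_eq[OF assms] by (rule mult_pos_pos[rotated])
qed

text \<open>One more factor P_i outweighs all maximal powers of the earlier elements: (n_i - 1)
  \<nu>(P_i) + \<nu>(P_i) = n_i \<nu>(P_i) < \<nu>(P_(i+1)). The estimate is used to enter the
  spanning range and to show that x divides the correction terms.\<close>

lemma big_less: "Suc i \<le> N \<Longrightarrow> \<nu> (big i) < \<nu> (P (Suc i))"
proof (induction i)
  case 0
  have "power_product K P {1..0} (\<lambda>s. n s - 1) = \<one>" by simp
  then show ?case using P_pos[OF 0] by (metis \<nu>_one)
next
  case (Suc i)
  have j: "1 \<le> Suc i" "Suc i < N" "Suc i \<le> N" "i \<le> N" using Suc.prems by auto
  have Pj: "P (Suc i) \<in> nz" by (rule P_mem(1)[OF j(3)])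
  have nj: "n (Suc i) = Suc (n (Suc i) - 1)" using dg_pos(2)[OF j(1,2)] by simp
  have "\<nu> (big (Suc i)) = nat_mult (n (Suc i) - 1) (\<nu> (P (Suc i))) + \<nu> (big i)"
    unfolding pp1_Suc[OF j(3)] using Pj pp1_nz[OF j(4)] by simp
  also have "\<dots> < nat_mult (n (Suc i) - 1) (\<nu> (P (Suc i))) + \<nu> (P (Suc i))"
    using Suc.IH[OF j(3)] by simp
  also have "\<dots> = nat_mult (n (Suc i)) (\<nu> (P (Suc i)))" by (subst nj) simp
  also have "\<dots> < \<nu> (P (Suc (Suc i)))" by (rule growth[OF j(1,2)])
  finally show ?case .
qed

lemma pp1_mono:
  assumes "i \<le> N" "\<And>s. s \<in> {1..i} \<Longrightarrow> e s \<le> f s"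
  shows "\<nu> (power_product K P {1..i} e) \<le> \<nu> (power_product K P {1..i} f)"
  using assms
proof (induction i)
  case 0
  have "power_product K P {1..0} e = \<one>" for e by simp
  then show ?case by simp
next
  case (Suc i)
  have j: "Suc i \<le> N" "i \<le> N" using Suc.prems by auto
  have "nat_mult (e (Suc i)) (\<nu> (P (Suc i))) \<le> nat_mult (f (Suc i)) (\<nu> (P (Suc i)))"
    using nat_mult_mono[OF P_pos[OF j(1)]] Suc.prems(2)[of "Suc i"] by simp
  moreover have "\<nu> (power_product K P {1..i} e) \<le> \<nu> (power_product K P {1..i} f)"
    using Suc.IH[OF j(2)] Suc.prems(2) by simp
  ultimately show ?case
    unfolding pp1_Suc[OF j(1)] using P_mem(1)[OF j(1)] pp1_nz[OF j(2)] by (simp add: add_mono)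
qed

lemma pp_split: "i \<le> N \<Longrightarrow> pp i e = P 0 [^] e 0 \<otimes> power_product K P {1..i} e"
proof -
  assume i: "i \<le> N"
  have "{..i} = insert 0 {1..i}" by auto
  moreover have "power_product K P (insert 0 {1..i}) e = P 0 [^] e 0 \<otimes> power_product K P {1..i} e"
    using P_mem(1) i by (intro pp_insert) auto
  ultimately show ?thesis by metis
qed

text \<open>Apply spanning to the element 1 at the value q_N \<nu>(P_N): a sum that is not zero has
  at least one term, and its exponents are those of U_N.\<close>

lemma U_exists:
  assumes N: "1 \<le> N" and fN: "val_index \<nu> P N < \<infinity>"
  shows "\<exists>e. (\<forall>j\<in>{1..<N}. e j < n j) \<and> \<nu> (P N [^] q N) = \<nu> (power_product K P {..<N} e)"
proof -
  obtain i where i: "N = Suc i" using N by (cases N) auto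
  have iN: "i < N" "i \<le> N" "Suc i \<le> N" using i by auto
  have PN: "P N \<in> nz" "0 < \<nu> (P N)" using P_mem P_pos by auto
  have "0 < q N" "nat_mult (q N) (\<nu> (P N)) \<in> \<nu> ` laurent P N" using q_props[OF N _ fN] by auto
  then obtain h where h: "h \<in> laurent P (Suc i)" "nat_mult (q N) (\<nu> (P N)) = \<nu> h" unfolding i by auto
  have "\<nu> (big i) \<le> nat_mult (Suc 0) (\<nu> (P N))" using big_less[OF iN(3)] unfolding i by simp
  also have "\<dots> \<le> nat_mult (q N) (\<nu> (P N))" using \<open>0 < q N\<close> by (intro nat_mult_mono PN) simp
  finally have "\<nu> (big i) \<le> \<nu> h" using h by simp
  then obtain c where c: "\<And>\<tau>. c \<tau> \<in> CS" "red_sum i h c = \<one>\<^bsub>L\<^esub>"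
    using red_sum_surj[OF iN(1) h(1) _ F_closed(3)[OF iN(1)]] by blast
  have "red_exps i (\<nu> h) \<noteq> {}"
  proof
    assume "red_exps i (\<nu> h) = {}"
    then have "red_sum i h c = \<zero>\<^bsub>L\<^esub>" unfolding red_sum_def by simp
    then show False using c(2) by simp
  qed
  then obtain \<tau> where "\<tau> \<in> red_exps i (\<nu> h)" by blast
  then have \<tau>: "\<forall>s\<in>{1..i}. \<tau> s < n s" "\<nu> (pp i \<tau>) = \<nu> h" unfolding red_exps_def by auto
  have "{1..<N} = {1..i}" "{..<N} = {..i}" unfolding i by auto
  moreover have "\<nu> (P N [^] q N) = \<nu> h" using h PN by simp
  ultimately show ?thesis using \<tau> by (intro exI[of _ \<tau>]) simp
qed

definition succ_poly :: "nat \<Rightarrow> (nat \<Rightarrow> 'a) \<Rightarrow> (nat \<Rightarrow> nat \<Rightarrow> nat) \<Rightarrow> 'a" where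
  "succ_poly len c e = P N [^] n N \<oplus> (\<Oplus>k\<in>{1..len}. c k \<otimes> pp N (\<lambda>s. e s k))"

text \<open>A lift to the valuation ring of the coefficient of u^t in the minimal polynomial of
  \<alpha>_N.\<close>

definition coeff_lift :: "nat \<Rightarrow> (nat \<Rightarrow> 'a) \<Rightarrow> (nat \<Rightarrow> nat \<Rightarrow> nat) \<Rightarrow> nat \<Rightarrow> 'a" where
  "coeff_lift len c e t = (\<Oplus>k\<in>{k \<in> {1..len}. e N k = t * q N}.
     c k \<otimes> (power_product K P {..<N} (\<lambda>s. e s k) \<otimes> inv (U N [^] (dg N - t))))"

text \<open>The new element is the minimal polynomial of \<alpha>_N, homogenized as U_N^d f(P_N^q /
  U_N), where the product of U_N^(d-t) with the coefficient of u^t is replaced by a combination of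
  reduced monomials of value (d - t) q \<nu>(P_N). The hypothesis \<open>shape\<close> is the
  invariant that P_N is a power of y modulo x; the last conclusion renews it.\<close>

lemma next_element:
  assumes N: "1 \<le> N" and fN: "val_index \<nu> P N < \<infinity>"
    and UN: "\<nu> (P N [^] q N) = \<nu> (U N)"
    and algN: "L.algebraic (F (N - 1)) (\<alpha> N)"
    and nN: "n N = q N * dg N"
    and P0: "P 0 = x" and shape: "t0 \<in> carrier R" "P N = y [^] (m0::nat) \<oplus> x \<otimes> t0"
  obtains len c e where "1 \<le> (len::nat)"
    "\<And>k. k \<in> {1..len} \<Longrightarrow> c k \<in> CS \<and> c k \<noteq> \<zero> \<and> (\<forall>s\<in>{1..N}. e s k < n s) \<and> q N dvd e N k \<and>
      nat_mult (n N) (\<nu> (P N)) = \<nu> (pp N (\<lambda>s. e s k))"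
    "0 < dg N" "0 < q N"
    "L.Irr (F (N - 1)) (\<alpha> N) = \<one>\<^bsub>L\<^esub> # map (\<lambda>t. rs (coeff_lift len c e t)) (rev [0..<dg N])"
    "\<And>t. t < dg N \<Longrightarrow> rs (coeff_lift len c e t) \<in> F (N - 1)"
    "succ_poly len c e \<in> nz"
    "succ_poly len c e \<in> \<mm>"
    "nat_mult (n N) (\<nu> (P N)) < \<nu> (succ_poly len c e)"
    "\<exists>m t. t \<in> carrier R \<and> succ_poly len c e = y [^] (m::nat) \<oplus> x \<otimes> t"
proof -
  obtain i where i: "N = Suc i" using N by (cases N) auto
  have iN: "i < N" "i \<le> N" "Suc i \<le> N" "N - 1 = i" using i by auto
  have PN: "P N \<in> nz" "0 < \<nu> (P N)" using P_mem P_pos by auto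
  have UNz: "U N \<in> nz" "U N \<in> laurent P N" using laurent_nz'[of N] by auto
  note al = alpha_res[OF N order_refl UN]
  let ?d = "dg N"
  let ?A = "P N [^] q N \<otimes> inv (U N)"
  define b where "b = L.coeff (L.Irr (F i) (\<alpha> N))"
  have dgi: "?d = degree (L.Irr (F i) (\<alpha> N))" unfolding iN(4) ..
  have algi: "L.algebraic (F i) (\<alpha> N)" using algN unfolding iN(4) .
  note irr = L.Irr_expansion[OF F_subfield[OF iN(1)] al(3,4) algi dgi, folded b_def]
  have qN: "0 < q N" by (rule q_props(1)[OF N order_refl fN])
  have UNv: "nat_mult k (\<nu> (U N)) = nat_mult (k * q N) (\<nu> (P N))" for k
    using UN PN by (simp add: nat_mult_mult)
  define h where "h t = U N [^] (?d - t)" for t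
  have h: "h t \<in> laurent P (Suc i)" "h t \<in> nz" for t unfolding h_def using UNz i by auto
  have hv: "\<nu> (h t) = nat_mult ((?d - t) * q N) (\<nu> (P N))" for t
    unfolding h_def using UNz by (simp add: UNv)
  have "\<exists>c. (\<forall>\<tau>. c \<tau> \<in> CS) \<and> red_sum i (h t) c = b t" if t: "t < ?d" for t
  proof (rule red_sum_surj[OF iN(1) h(1) _ irr(2)])
    have "\<nu> (big i) \<le> nat_mult (Suc 0) (\<nu> (P N))" using big_less[OF iN(3)] unfolding i by simp
    also have "\<dots> \<le> \<nu> (h t)" unfolding hv using qN t by (intro nat_mult_mono PN) (simp add: Suc_le_eq)
    finally show "\<nu> (big i) \<le> \<nu> (h t)" .
  qed
  then obtain cc where cc: "\<And>t \<tau>. t < ?d \<Longrightarrow> cc t \<tau> \<in> CS"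
      "\<And>t. t < ?d \<Longrightarrow> red_sum i (h t) (cc t) = b t" by metis
  \<comment> \<open>Terms with coefficient zero are discarded, since the coefficients of the
    expression have to be nonzero.\<close>
  define S where "S t = {\<tau> \<in> red_exps i (\<nu> (h t)). cc t \<tau> \<noteq> \<zero>}" for t
  have S: "S t \<subseteq> red_exps i (\<nu> (h t))" "finite (S t)" for t
    unfolding S_def using red_finite[OF iN(1) h(1)[of t]] by auto
  \<comment> \<open>Pairs of a degree t and a monomial accompanying P_N^(t q_N). The bijection g
    numbers them from 1, as in the expression for the new element.\<close>
  define T where "T = Sigma {..<?d} S"
  have finT: "finite T" unfolding T_def using S(2) by simp
  obtain g where g: "bij_betw g {1..card T} T" using ex_bij_betw_nat_finite_1[OF finT] by blast
  define c where "c k = cc (fst (g k)) (snd (g k))" for k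
  define e where "e s k = (if s = N then fst (g k) * q N else snd (g k) s)" for s k
  have gk: "fst (g k) < ?d" "snd (g k) \<in> S (fst (g k))" if "k \<in> {1..card T}" for k
    using bij_betwE[OF g] that unfolding T_def by force+
  have un: "pp i \<tau> \<otimes> inv (h t) \<in> un" if "\<tau> \<in> S t" for \<tau> t
    using red_un[OF iN(2) h(2)] S(1) that by blast
  have ppi: "pp i \<tau> \<in> nz" for \<tau> using iN(2) by simp
  have ppless: "power_product K P {..<N} (\<lambda>s. e s k) = pp i (snd (g k))" for k
  proof -
    have "{..<N} = {..i}" unfolding i by auto
    moreover have "pp i (\<lambda>s. e s k) = pp i (snd (g k))"
      unfolding e_def using P_mem(1) iN by (intro pp_cong) auto
    ultimately show ?thesis by metis
  qed
  have ppN: "pp N (\<lambda>s. e s k) = pp i (snd (g k)) \<otimes> P N [^] (fst (g k) * q N)" for k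
    using pp_Suc'[OF iN(3), of "\<lambda>s. e s k"] ppless[of k] unfolding i by (simp add: e_def i lessThan_Suc_atMost)
  have bsum: "(\<Oplus>\<^bsub>L\<^esub>\<tau>\<in>S t. rs (cc t \<tau>) \<otimes>\<^sub>L rs (pp i \<tau> \<otimes> inv (h t))) = b t" if t: "t < ?d" for t
  proof -
    have u: "rs (pp i \<tau> \<otimes> inv (h t)) \<in> carrier L" if "\<tau> \<in> red_exps i (\<nu> (h t))" for \<tau>
      using red_un[OF iN(2) h(2) that] by blast
    have ccL: "rs (cc t \<tau>) \<in> carrier L" for \<tau> using cc(1)[OF t] CS_R by blast
    show ?thesis
      unfolding cc(2)[OF t, symmetric] red_sum_def
      using u ccL S(1)[of t]
      by (intro L.add.finprod_mono_neutral_cong_left red_finite[OF iN(1) h(1)]) (auto simp: S_def)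
  qed
  have filt: "bij_betw (\<lambda>k. snd (g k)) {k \<in> {1..card T}. e N k = t * q N} (S t)" if t: "t < ?d" for t
  proof -
    have eq: "{k \<in> {1..card T}. e N k = t * q N} = {k \<in> {1..card T}. fst (g k) = t}"
      using qN unfolding e_def by auto
    show ?thesis unfolding eq bij_betw_def
    proof
      show "inj_on (\<lambda>k. snd (g k)) {k \<in> {1..card T}. fst (g k) = t}"
      proof (rule inj_onI)
        fix k l assume "k \<in> {k \<in> {1..card T}. fst (g k) = t}" "l \<in> {k \<in> {1..card T}. fst (g k) = t}"
          "snd (g k) = snd (g l)"
        then have "k \<in> {1..card T}" "l \<in> {1..card T}" "g k = g l" by (auto intro: prod_eqI)
        then show "k = l" using bij_betw_imp_inj_on[OF g] inj_onD by metis
      qed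
      show "(\<lambda>k. snd (g k)) ` {k \<in> {1..card T}. fst (g k) = t} = S t"
      proof (intro equalityI subsetI)
        fix \<tau> assume "\<tau> \<in> S t"
        then have "(t, \<tau>) \<in> T" unfolding T_def using t by simp
        then obtain k where "k \<in> {1..card T}" "g k = (t, \<tau>)"
          using bij_betw_imp_surj_on[OF g] by (metis imageE)
        then show "\<tau> \<in> (\<lambda>k. snd (g k)) ` {k \<in> {1..card T}. fst (g k) = t}"
          by (intro image_eqI[of _ _ k]) auto
      qed (use gk in auto)
    qed
  qed
  have bres: "rs (coeff_lift (card T) c e t) = b t" if t: "t < ?d" for t
  proof -
    let ?I = "{k \<in> {1..card T}. e N k = t * q N}"
    have fst: "fst (g k) = t" if "k \<in> ?I" for k using that qN unfolding e_def by auto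
    have tm: "c k \<otimes> (power_product K P {..<N} (\<lambda>s. e s k) \<otimes> inv (U N [^] (?d - t))) =
        cc t (snd (g k)) \<otimes> (pp i (snd (g k)) \<otimes> inv (h t))" if "k \<in> ?I" for k
      unfolding ppless c_def fst[OF that] h_def ..
    have V: "cc t \<tau> \<in> V" "pp i \<tau> \<otimes> inv (h t) \<in> V" if "\<tau> \<in> S t" for \<tau>
      using un[OF that] cc(1)[OF t] CS_R by blast+
    have sI: "snd (g k) \<in> S t" if "k \<in> ?I" for k using bij_betwE[OF filt[OF t]] that by blast
    have "rs (\<Oplus>k\<in>?I. c k \<otimes> (power_product K P {..<N} (\<lambda>s. e s k) \<otimes> inv (U N [^] (?d - t)))) =
       (\<Oplus>\<^bsub>L\<^esub>k\<in>?I. rs (c k \<otimes> (power_product K P {..<N} (\<lambda>s. e s k) \<otimes> inv (U N [^] (?d - t)))))"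
      using tm V sI by (intro rs_finsum[THEN conjunct2]) auto
    also have "\<dots> = (\<Oplus>\<^bsub>L\<^esub>k\<in>?I. (\<lambda>\<tau>. rs (cc t \<tau>) \<otimes>\<^sub>L rs (pp i \<tau> \<otimes> inv (h t))) (snd (g k)))"
    proof (rule L.finsum_cong')
      fix k assume k: "k \<in> ?I"
      show "rs (c k \<otimes> (power_product K P {..<N} (\<lambda>s. e s k) \<otimes> inv (U N [^] (?d - t)))) =
          (\<lambda>\<tau>. rs (cc t \<tau>) \<otimes>\<^sub>L rs (pp i \<tau> \<otimes> inv (h t))) (snd (g k))"
        unfolding tm[OF k] by (rule rs_mult[OF V[OF sI[OF k]]])
    qed (use V sI in auto)
    also have "\<dots> = (\<Oplus>\<^bsub>L\<^esub>\<tau>\<in>S t. rs (cc t \<tau>) \<otimes>\<^sub>L rs (pp i \<tau> \<otimes> inv (h t)))"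
      unfolding bij_betw_imp_surj_on[OF filt[OF t], symmetric]
      using V sI bij_betw_imp_inj_on[OF filt[OF t]]
      by (intro L.add.finprod_reindex[symmetric]) auto
    also have "\<dots> = b t" by (rule bsum[OF t])
    finally show ?thesis unfolding coeff_lift_def .
  qed
  have props: "c k \<in> CS \<and> c k \<noteq> \<zero> \<and> (\<forall>s\<in>{1..N}. e s k < n s) \<and> q N dvd e N k \<and>
      nat_mult (n N) (\<nu> (P N)) = \<nu> (pp N (\<lambda>s. e s k))" if k: "k \<in> {1..card T}" for k
  proof -
    let ?t = "fst (g k)" and ?\<tau> = "snd (g k)"
    have \<tau>: "?\<tau> \<in> red_exps i (\<nu> (h ?t))" "cc ?t ?\<tau> \<noteq> \<zero>" using gk(2)[OF k] unfolding S_def by auto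
    have 1: "e s k < n s" if "s \<in> {1..N}" for s
    proof (cases "s = N")
      case True
      then show ?thesis unfolding True nN e_def using gk(1)[OF k] qN by (simp add: mult.commute)
    next
      case False
      then show ?thesis using \<tau>(1) that unfolding e_def red_exps_def i by auto
    qed
    have "\<nu> (pp N (\<lambda>s. e s k)) = nat_mult ((?d - ?t) * q N) (\<nu> (P N)) + nat_mult (?t * q N) (\<nu> (P N))"
      unfolding ppN using ppi PN \<tau>(1) hv unfolding red_exps_def by simp
    also have "\<dots> = nat_mult (n N) (\<nu> (P N))"
      unfolding nat_mult_add[symmetric] nN add_mult_distrib[symmetric]
        le_add_diff_inverse2[OF less_imp_le[OF gk(1)[OF k]]] by (simp only: mult.commute)
    finally show ?thesis using 1 \<tau>(2) cc(1)[OF gk(1)[OF k]] unfolding c_def by (simp add: e_def)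
  qed
  \<comment> \<open>At least one term survives because the constant coefficient of the minimal
    polynomial is nonzero.\<close>
  have cardT: "1 \<le> card T"
  proof -
    have "S 0 \<noteq> {}"
    proof
      assume "S 0 = {}"
      then have "b 0 = \<zero>\<^bsub>L\<^esub>" using bsum[OF irr(1)] by simp
      then show False using irr(5) by simp
    qed
    then obtain \<tau> where "\<tau> \<in> S 0" by blast
    then have "(0, \<tau>) \<in> T" unfolding T_def using irr(1) by simp
    then have "T \<noteq> {}" by blast
    then show ?thesis using finT by (simp add: Suc_le_eq card_gt_0_iff)
  qed
  let ?Q = "P N [^] n N \<oplus> (\<Oplus>k\<in>{1..card T}. c k \<otimes> pp N (\<lambda>s. e s k))"
  have PR: "P j \<in> carrier R" if "j \<le> N" for j using P_mem(2)[OF that] unfolding max_ideal_iff by simp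
  have ppR: "power_product K P I f \<in> carrier R" if "finite I" "I \<subseteq> {..N}" for I f
    using that
  proof (induction I rule: finite_induct)
    case (insert s I)
    then have "power_product K P (insert s I) f = P s [^] f s \<otimes> power_product K P I f"
      using P_mem(1) by (intro pp_insert) auto
    moreover have "P s [^] f s \<in> carrier R" using PR insert.prems by simp
    ultimately show ?case using insert R_closed(4) by simp
  qed simp
  have cR: "c k \<in> carrier R" if "k \<in> {1..card T}" for k using props[OF that] CS_R by blast
  have xR: "x \<in> carrier R" "y \<in> carrier R" using params_mem by auto
  have divx: "\<exists>t\<in>carrier R. c k \<otimes> pp N (\<lambda>s. e s k) = x \<otimes> t" if k: "k \<in> {1..card T}" for k
  proof -
    \<comment> \<open>Without P_0, the value would be at most that of P_N^(e N k) times the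
      threshold monomial, hence less than (e N k + 1) \<nu>(P_N), which is at most n_N \<nu>(P_N).
      But all terms have value n_N \<nu>(P_N).\<close>
    have "e 0 k \<noteq> 0"
    proof
      assume e0: "e 0 k = 0"
      let ?f = "\<lambda>s. e s k"
      have p1: "power_product K P {1..i} ?f \<in> nz" by (rule pp1_nz[OF iN(2)])
      have "pp N ?f = P N [^] e N k \<otimes> power_product K P {1..i} ?f"
        using pp_split[OF order_refl, of ?f] pp1_Suc[OF iN(3), of ?f] e0 P_mem(1)[of 0] PN p1
        unfolding i by simp
      then have "nat_mult (n N) (\<nu> (P N)) = nat_mult (e N k) (\<nu> (P N)) + \<nu> (power_product K P {1..i} ?f)"
        using props[OF k] PN p1 by simp
      also have "\<nu> (power_product K P {1..i} ?f) \<le> \<nu> (big i)"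
      proof (rule pp1_mono[OF iN(2)])
        fix s assume "s \<in> {1..i}"
        then have "e s k < n s" using props[OF k] unfolding i by auto
        then show "e s k \<le> n s - 1" by simp
      qed
      also have "\<nu> (big i) < \<nu> (P N)" using big_less[OF iN(3)] unfolding i .
      finally have "nat_mult (n N) (\<nu> (P N)) < nat_mult (Suc (e N k)) (\<nu> (P N))" by simp
      then have "n N < Suc (e N k)" using nat_mult_less_cancel[OF PN(2)] by blast
      moreover have "e N k < n N" using props[OF k] N by auto
      ultimately show False by simp
    qed
    then obtain a where a: "e 0 k = Suc a" using not0_implies_Suc by blast
    let ?p = "power_product K P {1..N} (\<lambda>s. e s k)"
    have pR: "?p \<in> carrier R" by (rule ppR) auto
    have xa: "x [^] a \<in> carrier R" using xR by simp
    have "pp N (\<lambda>s. e s k) = x [^] Suc a \<otimes> ?p" using pp_split[OF order_refl] P0 a by simp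
    then have "c k \<otimes> pp N (\<lambda>s. e s k) = x \<otimes> (c k \<otimes> (x [^] a \<otimes> ?p))"
      using R_closed(6)[OF pR] R_closed(6)[OF xa] R_closed(6)[OF xR(1)] R_closed(6)[OF cR[OF k]]
      by (simp add: m_ac)
    then show ?thesis using cR[OF k] xa pR R_closed(4) by blast
  qed
  then obtain tk where tk: "\<And>k. k \<in> {1..card T} \<Longrightarrow> tk k \<in> carrier R"
      "\<And>k. k \<in> {1..card T} \<Longrightarrow> c k \<otimes> pp N (\<lambda>s. e s k) = x \<otimes> tk k" by metis
  have finsumR: "(\<Oplus>k\<in>I. f k) \<in> carrier R" if "finite I" "\<And>k. k \<in> I \<Longrightarrow> f k \<in> carrier R" for I and f :: "nat \<Rightarrow> 'a"
    using that
  proof (induction I rule: finite_induct)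
    case (insert k I)
    then have "f \<in> I \<rightarrow> carrier K" "f k \<in> carrier K" by auto
    then have "(\<Oplus>k\<in>insert k I. f k) = f k \<oplus> (\<Oplus>k\<in>I. f k)" using insert by simp
    then show ?case using insert R_closed(5) by simp
  qed simp
  have shapeQ: "\<exists>m t. t \<in> carrier R \<and> ?Q = y [^] (m::nat) \<oplus> x \<otimes> t"
  proof -
    have pow: "\<exists>t\<in>carrier R. P N [^] k = y [^] (m0 * k) \<oplus> x \<otimes> t" for k :: nat
    proof (induction k)
      case 0
      show ?case using xR by (intro bexI[of _ \<zero>]) simp_all
    next
      case (Suc k)
      then obtain t where t: "t \<in> carrier R" "P N [^] k = y [^] (m0 * k) \<oplus> x \<otimes> t" by blast
      have Y: "y [^] (m0 * k) \<in> carrier R" "y [^] m0 \<in> carrier R" using xR by simp_all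
      have "P N [^] Suc k = (y [^] (m0 * k) \<oplus> x \<otimes> t) \<otimes> (y [^] m0 \<oplus> x \<otimes> t0)"
        using t(2) shape(2) by simp
      also have "\<dots> = (y [^] (m0 * k) \<otimes> y [^] m0) \<oplus> x \<otimes> (y [^] (m0 * k) \<otimes> t0 \<oplus> t \<otimes> (y [^] m0 \<oplus> x \<otimes> t0))"
        using Y[THEN R_closed(6)] xR(1)[THEN R_closed(6)] t(1)[THEN R_closed(6)] shape(1)[THEN R_closed(6)]
        by algebra
      also have "y [^] (m0 * k) \<otimes> y [^] m0 = y [^] (m0 * Suc k)"
        using xR by (simp add: nat_pow_mult add.commute)
      finally show ?case using Y xR t(1) shape(1) R_closed(4,5) by blast
    qed
    obtain t where t: "t \<in> carrier R" "P N [^] n N = y [^] (m0 * n N) \<oplus> x \<otimes> t" using pow by blast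
    have sR: "(\<Oplus>k\<in>{1..card T}. tk k) \<in> carrier R" using tk(1) by (intro finsumR) auto
    have "(\<Oplus>k\<in>{1..card T}. c k \<otimes> pp N (\<lambda>s. e s k)) = (\<Oplus>k\<in>{1..card T}. x \<otimes> tk k)"
      using tk xR by (intro finsum_cong') auto
    also have "\<dots> = x \<otimes> (\<Oplus>k\<in>{1..card T}. tk k)"
      using tk(1) xR by (intro finsum_rdistr[symmetric]) auto
    finally have "?Q = (y [^] (m0 * n N) \<oplus> x \<otimes> t) \<oplus> x \<otimes> (\<Oplus>k\<in>{1..card T}. tk k)" using t(2) by simp
    also have "\<dots> = y [^] (m0 * n N) \<oplus> x \<otimes> (t \<oplus> (\<Oplus>k\<in>{1..card T}. tk k))"
      using t(1)[THEN R_closed(6)] xR[THEN R_closed(6)] sR[THEN R_closed(6)]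
      by (simp add: a_assoc r_distr)
    finally show ?thesis using t(1) sR R_closed(5) by blast
  qed
  have QR: "?Q \<in> carrier R"
  proof -
    have "(\<Oplus>k\<in>{1..card T}. c k \<otimes> pp N (\<lambda>s. e s k)) \<in> carrier R"
      using cR ppR R_closed(4) by (intro finsumR) auto
    moreover have "P N [^] n N \<in> carrier R" using PR[OF order_refl] by simp
    ultimately show ?thesis by (intro R_closed(5))
  qed
  have Qnz: "?Q \<in> nz"
  proof -
    obtain m t where mt: "t \<in> carrier R" "?Q = y [^] (m::nat) \<oplus> x \<otimes> t" using shapeQ by blast
    have "?Q \<noteq> \<zero>"
    proof
      assume "?Q = \<zero>"
      then have z: "y [^] m \<oplus> x \<otimes> t = \<zero>" using mt(2) by simp
      have car: "y [^] m \<in> carrier K" "x \<in> carrier K" "t \<in> carrier K"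
        using xR mt(1) R_closed(6) R_pow_closed by blast+
      have "y [^] m = (y [^] m \<oplus> x \<otimes> t) \<oplus> x \<otimes> (\<ominus> t)" using car by algebra
      then have "y [^] m = x \<otimes> (\<ominus> t)" unfolding z using car by simp
      then show False using y_power_not_multiple[of "\<ominus> t" x y m] params_mem mt(1) R_closed(3) by blast
    qed
    then show ?thesis using QR[THEN R_closed(6)] unfolding nz_def by blast
  qed
  \<comment> \<open>Dividing by U_N^d turns the leading term into the d-th power of the unit with
    residue \<alpha>_N. The residue of the whole quotient is then the minimal polynomial evaluated
    at \<alpha>_N, which is zero, and the value of the new element exceeds n_N \<nu>(P_N).\<close>
  define D where "D = inv (U N [^] ?d)"
  have D: "D \<in> nz" "\<nu> D = - nat_mult (n N) (\<nu> (P N))"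
    unfolding D_def nN using UNz by (simp_all add: UNv mult.commute)
  have QD: "?Q \<otimes> D \<in> val_ideal K \<nu>"
  proof -
    have Apow: "P N [^] (t * q N) = ?A [^] t \<otimes> U N [^] t" for t
    proof -
      have "?A [^] t \<otimes> U N [^] t = (?A \<otimes> U N) [^] t" using UNz PN by (simp add: nat_pow_distrib)
      also have "?A \<otimes> U N = P N [^] q N" using UNz PN by (simp add: m_assoc)
      finally show ?thesis using PN by (simp add: nat_pow_pow mult.commute)
    qed
    have Dt: "U N [^] t \<otimes> D = inv (h t)" if "t \<le> ?d" for t
    proof -
      have "U N [^] ?d = U N [^] t \<otimes> U N [^] (?d - t)" 
        unfolding nat_pow_mult[OF nzD(1)[OF UNz(1)]] le_add_diff_inverse[OF that] ..
      then have "D = inv (U N [^] t) \<otimes> inv (h t)" unfolding D_def h_def using UNz by (simp add: inv_mult_nz)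
      moreover have "U N [^] t \<otimes> (inv (U N [^] t) \<otimes> inv (h t)) = (U N [^] t \<otimes> inv (U N [^] t)) \<otimes> inv (h t)"
        using UNz h(2) by (simp add: m_assoc del: nz_inv)
      ultimately show ?thesis using UNz h(2) by simp
    qed
    have AV: "?A [^] t \<in> V" for t :: nat using al(1) by blast
    have lead: "P N [^] n N \<otimes> D = ?A [^] ?d"
    proof -
      have "P N [^] n N = ?A [^] ?d \<otimes> U N [^] ?d" using Apow[of ?d] nN by (simp add: mult.commute)
      then show ?thesis unfolding D_def using UNz al(1) by (simp add: m_assoc)
    qed
    \<comment> \<open>The residue of the term belonging to a pair in T. Summing over the monomials
      first, for fixed t, produces the coefficient of \<alpha>_N^t.\<close>
    define W where "W = (\<lambda>(t, \<tau>). (rs (cc t \<tau>) \<otimes>\<^sub>L rs (pp i \<tau> \<otimes> inv (h t))) \<otimes>\<^sub>L \<alpha> N [^]\<^bsub>L\<^esub> t)"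
    have tm: "c k \<otimes> pp N (\<lambda>s. e s k) \<otimes> D =
        (c k \<otimes> (pp i (snd (g k)) \<otimes> inv (h (fst (g k))))) \<otimes> ?A [^] fst (g k)"
      "c k \<in> V" "pp i (snd (g k)) \<otimes> inv (h (fst (g k))) \<in> V" if k: "k \<in> {1..card T}" for k
    proof -
      let ?t = "fst (g k)"
      have car: "c k \<in> carrier K" "pp i (snd (g k)) \<in> carrier K" "?A [^] ?t \<in> carrier K" "U N [^] ?t \<in> carrier K" "D \<in> carrier K"
        using cR[OF k] ppi UNz D(1) AV by auto
      have "c k \<otimes> pp N (\<lambda>s. e s k) \<otimes> D = (c k \<otimes> (pp i (snd (g k)) \<otimes> (U N [^] ?t \<otimes> D))) \<otimes> ?A [^] ?t"
        unfolding ppN Apow using car by algebra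
      then show "c k \<otimes> pp N (\<lambda>s. e s k) \<otimes> D = (c k \<otimes> (pp i (snd (g k)) \<otimes> inv (h ?t))) \<otimes> ?A [^] ?t"
        using Dt[of ?t] gk(1)[OF k] by simp
      show "c k \<in> V" using cR[OF k] by blast
      show "pp i (snd (g k)) \<otimes> inv (h ?t) \<in> V" using un[OF gk(2)[OF k]] by blast
    qed
    have cV: "c k \<otimes> pp N (\<lambda>s. e s k) \<otimes> D \<in> V" "rs (c k \<otimes> pp N (\<lambda>s. e s k) \<otimes> D) = W (g k)"
      if k: "k \<in> {1..card T}" for k
    proof -
      note t = tm[OF k]
      show "c k \<otimes> pp N (\<lambda>s. e s k) \<otimes> D \<in> V" unfolding t(1) using t(2,3) AV V_closed(4) by blast
      have "rs (c k \<otimes> pp N (\<lambda>s. e s k) \<otimes> D) =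
          (rs (c k) \<otimes>\<^sub>L rs (pp i (snd (g k)) \<otimes> inv (h (fst (g k))))) \<otimes>\<^sub>L rs (?A [^] fst (g k))"
        unfolding t(1) by (simp only: rs_mult[OF V_closed(4)[OF t(2,3)] AV] rs_mult[OF t(2,3)])
      also have "rs (?A [^] fst (g k)) = \<alpha> N [^]\<^bsub>L\<^esub> fst (g k)"
        unfolding al(2) by (rule rs_pow) (use al(1) in blast)
      finally show "rs (c k \<otimes> pp N (\<lambda>s. e s k) \<otimes> D) = W (g k)"
        unfolding W_def c_def by (simp add: case_prod_beta)
    qed
    have WL: "W p \<in> carrier L" if "p \<in> T" for p
      using that un cc(1) CS_R al(3) unfolding W_def T_def by (auto intro!: L.m_closed)
    have "?Q \<otimes> D = ?A [^] ?d \<oplus> (\<Oplus>k\<in>{1..card T}. c k \<otimes> pp N (\<lambda>s. e s k) \<otimes> D)"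
    proof -
      have "c k \<otimes> pp N (\<lambda>s. e s k) \<in> carrier K" if "k \<in> {1..card T}" for k
        using cR[OF that] pp_nz'[of N] by simp
      then have f: "(\<lambda>k. c k \<otimes> pp N (\<lambda>s. e s k)) \<in> {1..card T} \<rightarrow> carrier K" by blast
      then have "?Q \<otimes> D = P N [^] n N \<otimes> D \<oplus> (\<Oplus>k\<in>{1..card T}. c k \<otimes> pp N (\<lambda>s. e s k)) \<otimes> D"
        using PN D(1) by (intro l_distr) auto
      also have "(\<Oplus>k\<in>{1..card T}. c k \<otimes> pp N (\<lambda>s. e s k)) \<otimes> D = (\<Oplus>k\<in>{1..card T}. c k \<otimes> pp N (\<lambda>s. e s k) \<otimes> D)"
        using D(1) f by (intro finsum_ldistr) auto
      finally show ?thesis unfolding lead .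
    qed
    moreover have "(\<Oplus>k\<in>{1..card T}. c k \<otimes> pp N (\<lambda>s. e s k) \<otimes> D) \<in> V \<and>
        rs (\<Oplus>k\<in>{1..card T}. c k \<otimes> pp N (\<lambda>s. e s k) \<otimes> D) = (\<Oplus>\<^bsub>L\<^esub>k\<in>{1..card T}. W (g k))"
    proof -
      have "(\<Oplus>\<^bsub>L\<^esub>k\<in>{1..card T}. rs (c k \<otimes> pp N (\<lambda>s. e s k) \<otimes> D)) = (\<Oplus>\<^bsub>L\<^esub>k\<in>{1..card T}. W (g k))"
        using cV(2) WL bij_betwE[OF g] by (intro L.finsum_cong') auto
      then show ?thesis using rs_finsum[of "{1..card T}" "\<lambda>k. c k \<otimes> pp N (\<lambda>s. e s k) \<otimes> D"] cV(1) by simp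
    qed
    moreover have "(\<Oplus>\<^bsub>L\<^esub>k\<in>{1..card T}. W (g k)) = (\<Oplus>\<^bsub>L\<^esub>t\<in>{..<?d}. b t \<otimes>\<^sub>L \<alpha> N [^]\<^bsub>L\<^esub> t)"
    proof -
      have "(\<Oplus>\<^bsub>L\<^esub>k\<in>{1..card T}. W (g k)) = (\<Oplus>\<^bsub>L\<^esub>p\<in>g ` {1..card T}. W p)"
      proof (rule L.add.finprod_reindex[symmetric])
        show "W \<in> g ` {1..card T} \<rightarrow> carrier L" unfolding bij_betw_imp_surj_on[OF g] using WL by blast
      qed (rule bij_betw_imp_inj_on[OF g])
      also have "g ` {1..card T} = (\<Union>t\<in>{..<?d}. Pair t ` S t)"
        unfolding bij_betw_imp_surj_on[OF g] unfolding T_def by auto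
      also have "(\<Oplus>\<^bsub>L\<^esub>p\<in>(\<Union>t\<in>{..<?d}. Pair t ` S t). W p) = (\<Oplus>\<^bsub>L\<^esub>t\<in>{..<?d}. \<Oplus>\<^bsub>L\<^esub>p\<in>Pair t ` S t. W p)"
      proof (rule L.add.finprod_UN_disjoint)
        show "pairwise (\<lambda>t t'. disjnt (Pair t ` S t) (Pair t' ` S t')) {..<?d}"
          unfolding pairwise_def disjnt_def by auto
        show "W p \<in> carrier L" if "t \<in> {..<?d}" "p \<in> Pair t ` S t" for t p
          using that WL unfolding T_def by auto
      qed (use S(2) in auto)
      also have "\<dots> = (\<Oplus>\<^bsub>L\<^esub>t\<in>{..<?d}. b t \<otimes>\<^sub>L \<alpha> N [^]\<^bsub>L\<^esub> t)"
      proof (rule L.finsum_cong')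
        fix t assume "t \<in> {..<?d}"
        then have t: "t < ?d" by simp
        have u: "rs (cc t \<tau>) \<otimes>\<^sub>L rs (pp i \<tau> \<otimes> inv (h t)) \<in> carrier L" if "\<tau> \<in> S t" for \<tau>
          using un[OF that] cc(1)[OF t, of \<tau>] CS_R by (intro L.m_closed) auto
        have "(\<Oplus>\<^bsub>L\<^esub>p\<in>Pair t ` S t. W p) = (\<Oplus>\<^bsub>L\<^esub>\<tau>\<in>S t. W (t, \<tau>))"
          using t WL unfolding T_def by (intro L.add.finprod_reindex) (auto intro: inj_onI)
        also have "\<dots> = (\<Oplus>\<^bsub>L\<^esub>\<tau>\<in>S t. rs (cc t \<tau>) \<otimes>\<^sub>L rs (pp i \<tau> \<otimes> inv (h t))) \<otimes>\<^sub>L \<alpha> N [^]\<^bsub>L\<^esub> t"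
          unfolding W_def prod.case using u al(3) S(2) by (intro L.finsum_ldistr[symmetric]) auto
        finally show "(\<Oplus>\<^bsub>L\<^esub>p\<in>Pair t ` S t. W p) = b t \<otimes>\<^sub>L \<alpha> N [^]\<^bsub>L\<^esub> t" unfolding bsum[OF t] .
      qed (use irr(2) F_closed(6)[OF iN(1)] al(3) in auto)
      finally show ?thesis .
    qed
    moreover have "rs (?A [^] ?d) = \<alpha> N [^]\<^bsub>L\<^esub> ?d" unfolding al(2) by (rule rs_pow) (use al(1) in blast)
    ultimately have "?Q \<otimes> D \<in> V" "rs (?Q \<otimes> D) = \<alpha> N [^]\<^bsub>L\<^esub> ?d \<oplus>\<^sub>L (\<Oplus>\<^bsub>L\<^esub>t\<in>{..<?d}. b t \<otimes>\<^sub>L \<alpha> N [^]\<^bsub>L\<^esub> t)"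
      using AV rs_add V_closed(5) by simp_all
    then show ?thesis using irr(4) rs_zero_iff by simp
  qed
  have "?Q \<otimes> D \<noteq> \<zero>" using nz_closed(2)[OF Qnz D(1)] nzD(2) by blast
  then have "0 < \<nu> (?Q \<otimes> D)" using QD unfolding val_ideal_iff by blast
  also have "\<nu> (?Q \<otimes> D) = \<nu> ?Q - nat_mult (n N) (\<nu> (P N))" using \<nu>_mult[OF Qnz D(1)] D(2) by simp
  finally have Qval: "nat_mult (n N) (\<nu> (P N)) < \<nu> ?Q" by simp
  have npos: "0 < n N" unfolding nN using qN irr(1) by simp
  have "0 < \<nu> ?Q" using nat_mult_pos[OF PN(2) npos] Qval by (rule less_trans)
  then have Qm: "?Q \<in> \<mm>" using QR R_closed(6)[OF QR] unfolding max_ideal_iff val_ideal_iff by blast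
  let ?b = "\<lambda>t. rs (coeff_lift (card T) c e t)"
  have mapb: "map ?b (rev [0..<?d]) = map b (rev [0..<?d])"
    by (rule map_cong[OF refl], rule bres) (simp only: set_rev set_upt atLeastLessThan_iff)
  have Irr: "L.Irr (F (N - 1)) (\<alpha> N) = \<one>\<^bsub>L\<^esub> # map ?b (rev [0..<?d])"
    unfolding mapb using irr(3) unfolding iN(4) .
  have bF: "?b t \<in> F (N - 1)" if "t < ?d" for t
  proof -
    have "F i = F (N - 1)" unfolding iN(4) ..
    then show ?thesis unfolding bres[OF that] using irr(2) by simp
  qed
  show ?thesis
    by (rule that[of "card T" c e], unfold succ_poly_def) (fact cardT props irr(1) qN Irr bF Qnz Qm Qval shapeQ)+
qed

end

section \<open>Existence of the sequence\<close>

lemma foldSetD_local: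
  assumes "(A, y) \<in> foldSetD D f e" "\<And>x. x \<in> A \<Longrightarrow> f x = g x"
  shows "(A, y) \<in> foldSetD D g e"
  using assms
proof (induction rule: foldSetD.induct)
  case (insertI x A y)
  then have "(insert x A, g x y) \<in> foldSetD D g e" by (intro foldSetD.insertI) auto
  then show ?case using insertI.prems by simp
qed (rule foldSetD.emptyI)

text \<open>Unlike the congruence rules of the library, this does not need the factors to be in the carrier.\<close>

lemma power_product_local:
  assumes "\<And>s. s \<in> I \<Longrightarrow> P s = Q s" "\<And>s. s \<in> I \<Longrightarrow> e s = e' s"
  shows "power_product K P I e = power_product K Q I e'"
proof -
  have "(I, y) \<in> foldSetD (carrier K) ((\<otimes>\<^bsub>K\<^esub>) \<circ> (\<lambda>s. P s [^]\<^bsub>K\<^esub> e s)) \<one>\<^bsub>K\<^esub> \<longleftrightarrow>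
      (I, y) \<in> foldSetD (carrier K) ((\<otimes>\<^bsub>K\<^esub>) \<circ> (\<lambda>s. Q s [^]\<^bsub>K\<^esub> e' s)) \<one>\<^bsub>K\<^esub>" for y
    using assms by (intro iffI; elim foldSetD_local) auto
  then show ?thesis unfolding power_product_def finprod_def foldD_def by simp
qed

lemma val_index_local: "(\<And>j. j \<le> i \<Longrightarrow> P j = Q j) \<Longrightarrow> val_index \<nu> P i = val_index \<nu> Q i"
  unfolding val_index_def by (intro arg_cong2[of _ _ _ _ group_index] arg_cong[of _ _ group_closure] image_cong) auto

lemma alpha_local:
  assumes "\<And>j. j \<le> i \<Longrightarrow> P j = Q j" "w i = v i"
  shows "alpha K \<nu> P w i = alpha K \<nu> Q v i"
proof -
  have "U_elem K P w i = U_elem K Q v i"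
    unfolding U_elem_def using assms by (intro power_product_local) auto
  then show ?thesis unfolding alpha_def using val_index_local[of i P Q \<nu>] assms by simp
qed

lemma tower_local:
  assumes "\<And>j. j \<le> i \<Longrightarrow> P j = Q j" "\<And>j. j \<le> i \<Longrightarrow> w j = v j"
  shows "tower K \<nu> R P w i = tower K \<nu> R Q v i"
proof -
  have "alpha K \<nu> P w ` {1..i} = alpha K \<nu> Q v ` {1..i}"
    using assms by (intro image_cong refl alpha_local) auto
  then show ?thesis unfolding tower_def by simp
qed

lemma stops_local:
  assumes "\<And>j. j \<le> i \<Longrightarrow> P j = Q j" "\<And>j. j \<le> i \<Longrightarrow> w j = v j"
  shows "stops_at K \<nu> R P w i = stops_at K \<nu> R Q v i"
  unfolding stops_at_def
  using val_index_local[of i P Q \<nu>] tower_local[of i P Q w v K \<nu> R] tower_local[of "i - 1" P Q w v K \<nu> R] assms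
  by simp

text \<open>The data belonging to one index of the sequence: \<open>P\<^sub>i\<close>, the exponents of \<open>U\<^sub>i\<close>, and the exponent
  \<open>n\<^sub>i\<close>, the number of terms, the coefficients and the exponents in the expression for \<open>P\<^sub>i\<^sub>+\<^sub>1\<close>.\<close>

datatype 'a entry = Entry (ent_P: 'a) (ent_w: "nat \<Rightarrow> nat") (ent_n: nat) (ent_len: nat)
  (ent_c: "nat \<Rightarrow> 'a") (ent_e: "nat \<Rightarrow> nat \<Rightarrow> nat")

context dominating_valuation
begin

abbreviation "PP f \<equiv> \<lambda>j. ent_P (f j)"
abbreviation "UU f \<equiv> U_elem K (PP f) (\<lambda>j. ent_w (f j))"

definition succ_elem :: "(nat \<Rightarrow> 'a entry) \<Rightarrow> nat \<Rightarrow> 'a" where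
  "succ_elem f i = ent_P (f i) [^] ent_n (f i) \<oplus>
     (\<Oplus>k\<in>{1..ent_len (f i)}. ent_c (f i) k \<otimes> power_product K (PP f) {..i} (\<lambda>s. ent_e (f i) s k))"

definition coeff_res :: "(nat \<Rightarrow> 'a entry) \<Rightarrow> nat \<Rightarrow> nat \<Rightarrow> nat \<Rightarrow> 'a set" where
  "coeff_res f i d t = rs (\<Oplus>k\<in>{k \<in> {1..ent_len (f i)}. ent_e (f i) i k = t * nbar \<nu> (PP f) i}.
     ent_c (f i) k \<otimes> (power_product K (PP f) {..<i} (\<lambda>s. ent_e (f i) s k) \<otimes>
       inv (UU f i [^] (d - t))))"

abbreviation "tow f \<equiv> tower K \<nu> R (PP f) (\<lambda>j. ent_w (f j))"
abbreviation "alp f \<equiv> alpha K \<nu> (PP f) (\<lambda>j. ent_w (f j))"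
abbreviation "stp f \<equiv> stops_at K \<nu> R (PP f) (\<lambda>j. ent_w (f j))"
abbreviation "qq f \<equiv> nbar \<nu> (PP f)"
abbreviation "dd f i \<equiv> degree (L.Irr (tow f (i - 1)) (alp f i))"

text \<open>The requirements on the next element are stated for \<open>succ_elem f i\<close> instead
  of the entry at i + 1, so that only entries up to i are involved. The last conjunct is the
  invariant modulo x that keeps later elements nonzero.\<close>

definition good_expr :: "(nat \<Rightarrow> 'a entry) \<Rightarrow> nat \<Rightarrow> bool" where
  "good_expr f i \<longleftrightarrow> L.algebraic (tow f (i - 1)) (alp f i) \<and>
     ent_n (f i) = qq f i * dd f i \<and> 1 \<le> ent_len (f i) \<and>
     (\<forall>k\<in>{1..ent_len (f i)}. ent_c (f i) k \<in> CS \<and> ent_c (f i) k \<noteq> \<zero> \<and>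
        (\<forall>s\<in>{1..i}. ent_e (f i) s k < ent_n (f s)) \<and> qq f i dvd ent_e (f i) i k \<and>
        nat_mult (ent_n (f i)) (\<nu> (ent_P (f i))) =
          \<nu> (power_product K (PP f) {..i} (\<lambda>s. ent_e (f i) s k))) \<and>
     0 < dd f i \<and> 0 < qq f i \<and>
     L.Irr (tow f (i - 1)) (alp f i) = \<one>\<^bsub>L\<^esub> # map (coeff_res f i (dd f i)) (rev [0..<dd f i]) \<and>
     (\<forall>t<dd f i. coeff_res f i (dd f i) t \<in> tow f (i - 1)) \<and>
     succ_elem f i \<in> nz \<and> succ_elem f i \<in> \<mm> \<and>
     nat_mult (ent_n (f i)) (\<nu> (ent_P (f i))) < \<nu> (succ_elem f i) \<and>
     (\<exists>m t. t \<in> carrier R \<and> succ_elem f i = y [^] (m::nat) \<oplus> x \<otimes> t)"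

definition good_elem :: "(nat \<Rightarrow> 'a entry) \<Rightarrow> nat \<Rightarrow> bool" where
  "good_elem f i \<longleftrightarrow> ent_P (f i) = (if i = 0 then x else if i = 1 then y else succ_elem f (i - 1))"

definition good_U :: "(nat \<Rightarrow> 'a entry) \<Rightarrow> nat \<Rightarrow> bool" where
  "good_U f i \<longleftrightarrow> (1 \<le> i \<and> val_index \<nu> (PP f) i < \<infinity> \<longrightarrow>
     (\<forall>j\<in>{1..<i}. ent_w (f i) j < ent_n (f j)) \<and>
     \<nu> (ent_P (f i) [^] qq f i) = \<nu> (UU f i))"

text \<open>Entries after an index at which the sequence stops are arbitrary.\<close>

definition good :: "(nat \<Rightarrow> 'a entry) \<Rightarrow> nat \<Rightarrow> bool" where
  "good f i \<longleftrightarrow> (\<exists>j<i. 1 \<le> j \<and> stp f j) \<or>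
     good_elem f i \<and> good_U f i \<and> (1 \<le> i \<and> \<not> stp f i \<longrightarrow> good_expr f i)"

lemma good_local:
  assumes "\<And>j. j \<le> i \<Longrightarrow> f j = g j"
  shows "good f i = good g i" "good_elem f i = good_elem g i"
proof -
  let ?w = "\<lambda>f j. ent_w (f j)"
  have fi: "f i = g i" using assms by simp
  have st: "stp f j = stp g j" if "j \<le> i" for j
    using assms that by (intro stops_local) auto
  have pp: "power_product K (PP f) I e = power_product K (PP g) I e" if "I \<subseteq> {..i}" for I e
    using assms that by (intro power_product_local) auto
  have se: "succ_elem f j = succ_elem g j" if "j \<le> i" for j
  proof -
    have "power_product K (PP f) {..j} e = power_product K (PP g) {..j} e" for e
      using that by (intro pp) auto
    then show ?thesis unfolding succ_elem_def assms[OF that] by simp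
  qed
  have vi: "val_index \<nu> (PP f) i = val_index \<nu> (PP g) i" using assms by (intro val_index_local) auto
  have al: "alp f i = alp g i" using assms by (intro alpha_local) auto
  have to: "tow f (i - 1) = tow g (i - 1)" using assms by (intro tower_local) auto
  have U: "U_elem K (PP f) (?w f) i = U_elem K (PP g) (?w g) i"
    unfolding U_elem_def fi by (intro pp) auto
  have ppi: "power_product K (PP f) {..<i} e = power_product K (PP g) {..<i} e"
    "power_product K (PP f) {..i} e = power_product K (PP g) {..i} e" for e
    by (intro pp; auto)+
  have cr: "coeff_res f i = coeff_res g i"
    unfolding coeff_res_def fi vi U ppi ..
  have n: "(\<forall>s\<in>{1..i}. E s < ent_n (f s)) = (\<forall>s\<in>{1..i}. E s < ent_n (g s))" for E :: "nat \<Rightarrow> nat"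
    using assms by auto
  have e: "good_expr f i = good_expr g i"
    unfolding good_expr_def to al cr se[OF order_refl] vi ppi n unfolding fi ..
  show el: "good_elem f i = good_elem g i"
    unfolding good_elem_def fi using se[of "i - 1"] by simp
  have "(\<forall>j\<in>{1..<i}. ent_w (g i) j < ent_n (f j)) = (\<forall>j\<in>{1..<i}. ent_w (g i) j < ent_n (g j))"
    using assms by auto
  then have u: "good_U f i = good_U g i"
    unfolding good_U_def vi U fi by simp
  show "good f i = good g i"
    unfolding good_def e el u using st by auto
qed

text \<open>At N only the element itself is prescribed. The exponents of U_N and the number n_N may
  still be placeholders, so the locale is available while they are being chosen.\<close>

lemma good_key_sequence:
  assumes good: "\<And>j. j < N \<Longrightarrow> good f j" and el: "good_elem f N" and N: "1 \<le> N"
    and ns: "\<And>j. 1 \<le> j \<Longrightarrow> j < N \<Longrightarrow> \<not> stp f j"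
  shows "key_sequence K \<nu> R CS x y (PP f) (\<lambda>j. ent_n (f j)) (\<lambda>j. ent_w (f j)) N"
    and "ent_P (f 0) = x"
    and "\<exists>m t. t \<in> carrier R \<and> ent_P (f N) = y [^] (m::nat) \<oplus> x \<otimes> t"
proof -
  have all: "good_elem f j \<and> good_U f j \<and> (1 \<le> j \<and> \<not> stp f j \<longrightarrow> good_expr f j)" if "j < N" for j
  proof -
    have "\<not> (\<exists>i<j. 1 \<le> i \<and> stp f i)" using ns less_trans[OF _ that] by blast
    then show ?thesis using good[OF that] unfolding good_def by blast
  qed
  have ge: "good_elem f j" if "j \<le> N" for j
    using all[of j] that el by (cases "j = N") auto
  have gx: "good_expr f j" "good_U f j" if "1 \<le> j" "j < N" for j
    using all[OF that(2)] that(1) ns[OF that] by blast+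
  have P: "ent_P (f j) = (if j = 0 then x else if j = 1 then y else succ_elem f (j - 1))" if "j \<le> N" for j
    using ge[OF that] unfolding good_elem_def .
  show P0: "ent_P (f 0) = x" using P[of 0] by simp
  have PS: "ent_P (f (Suc j)) = succ_elem f j" if "1 \<le> j" "j < N" for j
    using P[of "Suc j"] that by simp
  have sx: "succ_elem f j \<in> nz" "succ_elem f j \<in> \<mm>"
     "nat_mult (ent_n (f j)) (\<nu> (ent_P (f j))) < \<nu> (succ_elem f j)"
     "\<exists>m t. t \<in> carrier R \<and> succ_elem f j = y [^] (m::nat) \<oplus> x \<otimes> t"
     "L.algebraic (tow f (j - 1)) (alp f j)" "ent_n (f j) = qq f j * dd f j"
    if "1 \<le> j" "j < N" for j
    using gx(1)[OF that] unfolding good_expr_def by blast+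
  have cases: "j = 0 \<or> j = 1 \<or> (\<exists>i. j = Suc i \<and> 1 \<le> i \<and> i < N)" if "j \<le> N" for j
    using that by (cases j; cases "j = 1") auto
  show "\<exists>m t. t \<in> carrier R \<and> ent_P (f N) = y [^] (m::nat) \<oplus> x \<otimes> t"
  proof (cases "N = 1")
    case True
    have "y = y [^] (1::nat) \<oplus> x \<otimes> \<zero>" using params_nonzero by simp
    then show ?thesis using P[of 1] N unfolding True by (metis R_closed(2) One_nat_def order_refl zero_neq_one)
  next
    case False
    then obtain i where "N = Suc i" "1 \<le> i" "i < N" using cases[of N] N by auto
    then show ?thesis using PS[of i] sx(4)[of i] by simp
  qed
  show "key_sequence K \<nu> R CS x y (PP f) (\<lambda>j. ent_n (f j)) (\<lambda>j. ent_w (f j)) N"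
  proof unfold_locales
    show "ent_P (f j) \<in> nz" "ent_P (f j) \<in> \<mm>" if "j \<le> N" for j
      using cases[OF that] P[of 0] P[of 1] N PS sx(1,2) params_nonzero max_ideal_params by auto
    fix j assume j: "1 \<le> j" "j < N"
    show vi: "val_index \<nu> (PP f) j < \<infinity>" using ns[OF j] unfolding stops_at_def by auto
    show "\<nu> (ent_P (f j) [^] qq f j) = \<nu> (UU f j)"
      using gx(2)[OF j] vi j unfolding good_U_def by blast
    show "L.algebraic (tow f (j - 1)) (alp f j)" by (rule sx(5)[OF j])
    show "ent_n (f j) = qq f j * dd f j" by (rule sx(6)[OF j])
    show "nat_mult (ent_n (f j)) (\<nu> (ent_P (f j))) < \<nu> (ent_P (f (Suc j)))"
      unfolding PS[OF j] by (rule sx(3)[OF j])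
  qed
qed

text \<open>The fields of the entry are chosen in order of dependence: P_N is forced by the previous
  entry, U_N needs P_N, n_N needs the degree of \<alpha>_N and hence U_N, and the expression for the
  next element needs n_N. Locality makes each choice independent of the fields still open.\<close>

lemma good_extend:
  assumes good: "\<And>j. j < N \<Longrightarrow> good f j"
  shows "\<exists>r. good (f(N := r)) N"
proof (cases "\<exists>j<N. 1 \<le> j \<and> stp f j")
  case True
  then obtain j where j: "j < N" "1 \<le> j" "stp f j" by blast
  have "stp (f(N := r)) j = stp f j" for r using j by (intro stops_local) auto
  then show ?thesis using j unfolding good_def by blast
next
  case False
  define p where "p = (if N = 0 then x else if N = 1 then y else succ_elem f (N - 1))"
  have g: "good (f(N := r)) j" if "j < N" for r j
    using good[OF that] good_local(1)[of j "f(N := r)" f] that by simp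
  have ns: "\<not> stp (f(N := r)) j" if "1 \<le> j" "j < N" for r j
  proof -
    have "stp (f(N := r)) j = stp f j" using that by (intro stops_local) auto
    then show ?thesis using False that by blast
  qed
  have el: "good_elem (f(N := r)) N" if "ent_P r = p" for r
  proof -
    have "succ_elem (f(N := r)) (N - 1) = succ_elem f (N - 1)" if "N \<noteq> 0"
    proof -
      have "power_product K (\<lambda>j. ent_P ((f(N := r)) j)) {..N - 1} e = power_product K (PP f) {..N - 1} e" for e
        using that by (intro power_product_local) auto
      moreover have "N - 1 \<noteq> N" using that by simp
      ultimately show ?thesis unfolding succ_elem_def by simp
    qed
    then show ?thesis using that unfolding good_elem_def p_def by simp
  qed
  show ?thesis
  proof (cases "N = 0")
    case True
    have "good_elem (f(N := Entry p undefined undefined undefined undefined undefined)) N" by (rule el) simp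
    then show ?thesis unfolding good_def good_U_def True by auto
  next
    case N0: False
    then have N: "1 \<le> N" by simp
    note KS = good_key_sequence[OF g el N ns]
    define f1 where "f1 = f(N := Entry p undefined undefined undefined undefined undefined)"
    have "\<exists>w. val_index \<nu> (PP f1) N < \<infinity> \<longrightarrow> (\<forall>j\<in>{1..<N}. w j < ent_n (f1 j)) \<and>
        \<nu> (ent_P (f1 N) [^] qq f1 N) = \<nu> (power_product K (PP f1) {..<N} w)"
    proof -
      interpret k1: key_sequence K \<nu> R CS x y "PP f1" "\<lambda>j. ent_n (f1 j)" "\<lambda>j. ent_w (f1 j)" N
        unfolding f1_def by (rule KS(1)) simp_all
      show ?thesis using k1.U_exists[OF N] by blast
    qed
    then obtain w where w: "val_index \<nu> (PP f1) N < \<infinity> \<Longrightarrow> (\<forall>j\<in>{1..<N}. w j < ent_n (f1 j)) \<and>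
        \<nu> (ent_P (f1 N) [^] qq f1 N) = \<nu> (power_product K (PP f1) {..<N} w)" by blast
    have gU: "good_U (f(N := Entry p w n len c e)) N" for n len c e
    proof -
      let ?f = "f(N := Entry p w n len c e)"
      have vi: "val_index \<nu> (\<lambda>j. ent_P (?f j)) N = val_index \<nu> (PP f1) N"
        unfolding f1_def by (intro val_index_local) auto
      have pp: "power_product K (\<lambda>j. ent_P (?f j)) {..<N} w = power_product K (PP f1) {..<N} w"
        unfolding f1_def by (intro power_product_local) auto
      have "ent_P (?f N) = ent_P (f1 N)" "ent_w (?f N) = w" unfolding f1_def by simp_all
      moreover have "\<forall>j\<in>{1..<N}. ent_n (?f j) = ent_n (f1 j)" unfolding f1_def by auto
      ultimately show ?thesis using w unfolding good_U_def U_elem_def vi using pp by simp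
    qed
    define f2 where "f2 = f(N := Entry p w undefined undefined undefined undefined)"
    show ?thesis
    proof (cases "stp f2 N")
      case True
      then have "good f2 N" using gU el unfolding good_def f2_def by simp
      then show ?thesis unfolding f2_def by blast
    next
      case nst: False
      define f3 where "f3 = f(N := Entry p w (qq f2 N * dd f2 N) undefined undefined undefined)"
      interpret k3: key_sequence K \<nu> R CS x y "PP f3" "\<lambda>j. ent_n (f3 j)" "\<lambda>j. ent_w (f3 j)" N
        unfolding f3_def by (rule KS(1)) simp_all
      have loc: "val_index \<nu> (\<lambda>j. ent_P ((f(N := Entry p w a l c e)) j)) N = val_index \<nu> (PP f3) N"
          "alp (f(N := Entry p w a l c e)) N = alp f3 N" "tow (f(N := Entry p w a l c e)) (N - 1) = tow f3 (N - 1)"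
          "stp (f(N := Entry p w a l c e)) N = stp f3 N" for a l c e
        unfolding f3_def
        by (intro val_index_local alpha_local tower_local stops_local; auto)+
      have n3: "ent_n (f3 N) = qq f3 N * dd f3 N"
        using loc(1-3)[of undefined undefined undefined undefined, folded f2_def] unfolding f3_def by simp
      have nst3: "\<not> stp f3 N" using nst loc(4)[of undefined undefined undefined undefined, folded f2_def] by simp
      then have fin3: "val_index \<nu> (PP f3) N < \<infinity>"
        and fd: "L.finite_dimension (tow f3 (N - 1)) (tow f3 N)" unfolding stops_at_def by auto
      have U3: "\<nu> (ent_P (f3 N) [^] qq f3 N) = \<nu> (UU f3 N)"
        using gU fin3 N unfolding good_U_def f3_def by blast
      obtain i where i: "N = Suc i" using N by (cases N) auto
      \<comment> \<open>Not stopping means that this step of the tower has finite dimension, which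
        is equivalent to \<alpha>_N being algebraic.\<close>
      have alg3: "L.algebraic (tow f3 (N - 1)) (alp f3 N)"
        using fd k3.F_Suc_finite_iff[of i] k3.alpha_res(3)[OF N order_refl U3] unfolding i by simp
      have P03: "ent_P (f3 0) = x" unfolding f3_def by (rule KS(2)) simp_all
      obtain m t where mt: "t \<in> carrier R" "ent_P (f3 N) = y [^] (m::nat) \<oplus> x \<otimes> t"
        using KS(3)[of "Entry p w (qq f2 N * dd f2 N) undefined undefined undefined"] unfolding f3_def by auto
      obtain len c e where E: "1 \<le> (len::nat)"
        "\<And>k. k \<in> {1..len} \<Longrightarrow> c k \<in> CS \<and> c k \<noteq> \<zero> \<and> (\<forall>s\<in>{1..N}. e s k < ent_n (f3 s)) \<and> qq f3 N dvd e N k \<and>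
          nat_mult (ent_n (f3 N)) (\<nu> (ent_P (f3 N))) = \<nu> (power_product K (PP f3) {..N} (\<lambda>s. e s k))"
        "0 < dd f3 N" "0 < qq f3 N"
        "L.Irr (tow f3 (N - 1)) (alp f3 N) = \<one>\<^bsub>L\<^esub> # map (\<lambda>t. rs (k3.coeff_lift len c e t)) (rev [0..<dd f3 N])"
        "\<And>t. t < dd f3 N \<Longrightarrow> rs (k3.coeff_lift len c e t) \<in> tow f3 (N - 1)"
        "k3.succ_poly len c e \<in> nz" "k3.succ_poly len c e \<in> \<mm>"
        "nat_mult (ent_n (f3 N)) (\<nu> (ent_P (f3 N))) < \<nu> (k3.succ_poly len c e)"
        "\<exists>m t. t \<in> carrier R \<and> k3.succ_poly len c e = y [^] (m::nat) \<oplus> x \<otimes> t"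
        using k3.next_element[OF N fin3 U3 alg3 n3 P03 mt] by blast
      define f4 where "f4 = f(N := Entry p w (qq f2 N * dd f2 N) len c e)"
      have same: "ent_P (f4 j) = ent_P (f3 j)" "ent_w (f4 j) = ent_w (f3 j)" "ent_n (f4 j) = ent_n (f3 j)" for j
        unfolding f3_def f4_def by simp_all
      have new: "ent_len (f4 N) = len" "ent_c (f4 N) = c" "ent_e (f4 N) = e" unfolding f4_def by simp_all
      have "coeff_res f4 N (dd f3 N) = (\<lambda>t. rs (k3.coeff_lift len c e t))" "succ_elem f4 N = k3.succ_poly len c e"
        unfolding coeff_res_def k3.coeff_lift_def succ_elem_def k3.succ_poly_def same new by (rule refl)+
      then have "good_expr f4 N"
        unfolding good_expr_def same new
        by (simp only:) (intro conjI ballI allI impI alg3 n3 E(1,3-); use E(2) in auto)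
      moreover have "good_elem f4 N" "good_U f4 N" using el gU unfolding f4_def by simp_all
      ultimately have "good f4 N" unfolding good_def by blast
      then show ?thesis unfolding f4_def by blast
    qed
  qed
qed

text \<open>The choice principle asks for a predicate on the entries before i and the candidate at
  i, unaffected by later entries. The function \<open>cut\<close> builds an argument of
  \<open>good\<close> from exactly this information.\<close>

lemma good_sequence: "\<exists>f. \<forall>i. good f i"
proof -
  define cut where "cut f i r = (\<lambda>j. if j < i then f j else if j = i then r else undefined)"
    for f :: "nat \<Rightarrow> 'a entry" and i r
  have "\<exists>f. \<forall>i. good (cut f i (f i)) i"
  proof (rule dependent_wellorder_choice)
    show "good (cut f i r) i = good (cut g i r) i" if "\<And>j. j < i \<Longrightarrow> f j = g j" for r f g and i :: nat
    proof -
      have "cut f i r = cut g i r" unfolding cut_def using that by auto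
      then show ?thesis by simp
    qed
    fix i :: nat and f assume IH: "\<And>j. j < i \<Longrightarrow> good (cut f j (f j)) j"
    have "good f j" if "j < i" for j
      using IH[OF that] good_local(1)[of j "cut f j (f j)" f] unfolding cut_def by auto
    then obtain r where "good (f(i := r)) i" using good_extend by blast
    then have "good (cut f i r) i" using good_local(1)[of i "cut f i r" "f(i := r)"] unfolding cut_def by auto
    then show "\<exists>r. good (cut f i r) i" by blast
  qed
  then obtain f where f: "\<And>i. good (cut f i (f i)) i" by blast
  have "good f i" for i
    using f[of i] good_local(1)[of i "cut f i (f i)" f] unfolding cut_def by auto
  then show ?thesis by blast
qed

end

theorem theorem4p2:
  fixes R K :: "'a ring"
    and \<nu> :: "'a \<Rightarrow> 'g::linordered_ab_group_add"
    and CS :: "'a set" and x y :: 'a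
  assumes "regular_local_ring R" and "krull_dim R = 2"
    and "coefficient_set R CS"
    and "quotient_field K R"
    and "valuation K \<nu>" and "dominates K \<nu> R"
    and "regular_parameters R x y"
  shows "\<exists>(\<Omega> :: enat) (P :: nat \<Rightarrow> 'a) (n :: nat \<Rightarrow> nat) (len :: nat \<Rightarrow> nat)
      (c :: nat \<Rightarrow> nat \<Rightarrow> 'a) (\<sigma> :: nat \<Rightarrow> nat \<Rightarrow> nat \<Rightarrow> nat)
      (d :: nat \<Rightarrow> nat) (w :: nat \<Rightarrow> nat \<Rightarrow> nat) (b :: nat \<Rightarrow> nat \<Rightarrow> 'a set).
    0 < \<Omega> \<and>
    (\<forall>i. enat i \<le> \<Omega> \<longrightarrow> P i \<in> max_ideal R \<and> P i \<noteq> \<zero>\<^bsub>R\<^esub>) \<and>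
    P 0 = x \<and> P 1 = y \<and>
    (\<forall>i. 1 \<le> i \<and> enat i < \<Omega> \<longrightarrow>
      1 \<le> n i \<and> 1 \<le> len i \<and>
      P (i + 1) = P i [^]\<^bsub>K\<^esub> n i \<oplus>\<^bsub>K\<^esub>
        (\<Oplus>\<^bsub>K\<^esub>k\<in>{1..len i}. c i k \<otimes>\<^bsub>K\<^esub> power_product K P {..i} (\<lambda>s. \<sigma> i s k)) \<and>
      (\<forall>k\<in>{1..len i}.
        c i k \<in> CS \<and> c i k \<noteq> \<zero>\<^bsub>R\<^esub> \<and>
        (\<forall>s\<in>{1..i}. \<sigma> i s k < n s) \<and>
        nat_mult (n i) (\<nu> (P i)) = \<nu> (power_product K P {..i} (\<lambda>s. \<sigma> i s k)))) \<and>
    (\<forall>i. 1 \<le> i \<and> enat i < \<Omega> \<longrightarrow>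
      \<comment> \<open>1)\<close>
      nat_mult (n i) (\<nu> (P i)) < \<nu> (P (i + 1)) \<and>
      \<comment> \<open>2)\<close>
      (\<forall>(r :: nat) (m :: nat) (j :: nat \<Rightarrow> nat \<Rightarrow> nat).
        let M = (\<lambda>l. power_product K P {..r} (\<lambda>k. j k l)) in
        enat r < \<Omega> \<and> 0 < m \<and>
        (\<forall>l\<in>{1..m}. \<forall>k\<in>{1..r}. j k l < n k) \<and>
        inj_on (\<lambda>l. map (\<lambda>k. j k l) [0..<r + 1]) {1..m} \<and>
        (\<forall>l\<in>{1..m}. \<nu> (M l) = \<nu> (M 1)) \<longrightarrow>
        ring.independent (res_field K \<nu>) (base_field K \<nu> R)
          (\<one>\<^bsub>res_field K \<nu>\<^esub> # map (\<lambda>l. res K \<nu> (M l \<otimes>\<^bsub>K\<^esub> inv\<^bsub>K\<^esub> (M 1))) [2..<m + 1])) \<and>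
      \<comment> \<open>3)\<close>
      val_index \<nu> P i < \<infinity> \<and>
      (\<forall>k\<in>{1..len i}. nbar \<nu> P i dvd \<sigma> i i k) \<and>
      n i = nbar \<nu> P i * d i \<and> 0 < d i \<and>
      \<comment> \<open>4), where the properties of the \<open>U\<^sub>i\<close> are in the next conjunct\<close>
      (\<forall>t<d i.
        b i t = res K \<nu> (\<Oplus>\<^bsub>K\<^esub>k\<in>{k \<in> {1..len i}. \<sigma> i i k = t * nbar \<nu> P i}.
          c i k \<otimes>\<^bsub>K\<^esub> (power_product K P {..<i} (\<lambda>s. \<sigma> i s k) \<otimes>\<^bsub>K\<^esub>
            inv\<^bsub>K\<^esub> (U_elem K P w i [^]\<^bsub>K\<^esub> (d i - t)))) \<and>
        b i t \<in> tower K \<nu> R P w (i - 1)) \<and>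
      minimal_polynomial (res_field K \<nu>) (tower K \<nu> R P w (i - 1)) (alpha K \<nu> P w i)
        (\<one>\<^bsub>res_field K \<nu>\<^esub> # map (b i) (rev [0..<d i]))) \<and>
    \<comment> \<open>the \<open>U\<^sub>i\<close>, for all \<open>i < \<Omega>\<close> and also for \<open>i = \<Omega>\<close> if the index is finite there\<close>
    (\<forall>i. 1 \<le> i \<and> enat i \<le> \<Omega> \<and> val_index \<nu> P i < \<infinity> \<longrightarrow>
      (\<forall>j\<in>{1..<i}. w i j < n j) \<and>
      \<nu> (P i [^]\<^bsub>K\<^esub> nbar \<nu> P i) = \<nu> (U_elem K P w i)) \<and>
    \<comment> \<open>termination\<close>
    (\<forall>N. \<Omega> = enat N \<longrightarrow> stops_at K \<nu> R P w N) \<and>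
    (\<forall>i. 1 \<le> i \<and> enat i \<le> \<Omega> \<and> stops_at K \<nu> R P w i \<longrightarrow> \<Omega> = enat i)"
proof -
  interpret dominating_valuation K \<nu> R CS x y
  proof (intro dominating_valuation.intro valued_field.intro)
    show "field K" using assms(4) unfolding quotient_field_def by simp
  qed (unfold_locales, use assms in auto)
  obtain f where good: "\<And>i. good f i" using good_sequence by blast
  \<comment> \<open>The first stopping index from 1 on. There \<open>good\<close> still prescribes
    the element and U; entries become arbitrary only strictly after it.\<close>
  define \<Omega> where "\<Omega> = (if \<exists>i\<ge>1. stp f i then enat (LEAST i. 1 \<le> i \<and> stp f i) else \<infinity>)"
  have stop_ge: "\<Omega> \<le> enat i" if "1 \<le> i" "stp f i" for i
    using that unfolding \<Omega>_def by (auto intro: Least_le)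
  have stop_at: "1 \<le> i \<and> stp f i" if "\<Omega> = enat i" for i
    using that LeastI_ex[of "\<lambda>i. 1 \<le> i \<and> stp f i"] unfolding \<Omega>_def by (auto split: if_splits)
  have ns: "\<not> stp f j" if "1 \<le> j" "enat j < \<Omega>" for j
    using stop_ge[OF that(1)] that(2) by (auto simp: not_le[symmetric])
  have "0 < \<Omega>"
  proof (cases \<Omega>)
    case (enat i)
    then show ?thesis using stop_at[OF enat] by (simp add: zero_enat_def)
  qed simp
  have all: "good_elem f i \<and> good_U f i \<and> (1 \<le> i \<and> \<not> stp f i \<longrightarrow> good_expr f i)" if "enat i \<le> \<Omega>" for i
  proof -
    have "\<not> (\<exists>j<i. 1 \<le> j \<and> stp f j)"
      using ns that less_le_trans enat_ord_simps(2) by blast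
    then show ?thesis using good[of i] unfolding good_def by blast
  qed
  have ex: "good_expr f i" if "1 \<le> i" "enat i < \<Omega>" for i
    using all[of i] ns[OF that] that by auto
  have PS: "ent_P (f (i + 1)) = succ_elem f i" if "1 \<le> i" "enat i < \<Omega>" for i
  proof -
    have "enat (Suc i) \<le> \<Omega>" using that(2) by (simp add: Suc_ile_eq)
    then show ?thesis using all[of "Suc i"] that(1) unfolding good_elem_def by simp
  qed
  have P01: "ent_P (f 0) = x" "ent_P (f 1) = y"
  proof -
    show "ent_P (f 0) = x" using all[of 0] unfolding good_elem_def by (simp add: zero_enat_def[symmetric])
    have "enat 1 \<le> \<Omega>" using \<open>0 < \<Omega>\<close> by (simp add: Suc_ile_eq zero_enat_def)
    then show "ent_P (f 1) = y" using all[of 1] unfolding good_elem_def by simp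
  qed
  have mem: "ent_P (f i) \<in> \<mm> \<and> ent_P (f i) \<noteq> \<zero>\<^bsub>R\<^esub>" if "enat i \<le> \<Omega>" for i
  proof -
    consider "i = 0" | "i = 1" | j where "i = j + 1" "1 \<le> j" by (cases i; cases "i = 1") auto
    then show ?thesis
    proof cases
      case 3
      then have j: "1 \<le> j" "enat j < \<Omega>" using that by (auto simp: Suc_ile_eq)
      show ?thesis using ex[OF j] nzD(2) unfolding 3(1) PS[OF j] good_expr_def R_ops by blast
    qed (use P01 params_nonzero max_ideal_params R_ops in auto)
  qed
  have indep: "ring.independent (res_field K \<nu>) (base_field K \<nu> R)
      (\<one>\<^bsub>res_field K \<nu>\<^esub> # map (\<lambda>l. res K \<nu> (M l \<otimes>\<^bsub>K\<^esub> inv\<^bsub>K\<^esub> (M 1))) [2..<m + 1])"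
    if M: "M = (\<lambda>l. power_product K (\<lambda>i. ent_P (f i)) {..r} (\<lambda>k. j k l))"
      and r: "enat r < \<Omega>" and m: "0 < m" and less: "\<forall>l\<in>{1..m}. \<forall>k\<in>{1..r}. j k l < ent_n (f k)"
      and inj: "inj_on (\<lambda>l. map (\<lambda>k. j k l) [0..<r + 1]) {1..m}"
      and val: "\<forall>l\<in>{1..m}. \<nu> (M l) = \<nu> (M 1)" for r m j M
  proof -
    have le: "enat (Suc r) \<le> \<Omega>" using r by (simp add: Suc_ile_eq)
    \<comment> \<open>The bound r + 1 puts n_r and \<alpha>_r under the assumptions of the locale.
      It is available because r < \<Omega> makes P_(r+1) a member of the sequence.\<close>
    interpret k: key_sequence K \<nu> R CS x y "\<lambda>j. ent_P (f j)" "\<lambda>j. ent_n (f j)" "\<lambda>j. ent_w (f j)" "Suc r"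
    proof (rule good_key_sequence(1)[OF good])
      show "good_elem f (Suc r)" using all[OF le] by blast
      show "\<not> stp f j" if "1 \<le> j" "j < Suc r" for j
        using that le less_le_trans[of "enat j" "enat (Suc r)" \<Omega>] by (intro ns) simp_all
    qed simp
    show ?thesis unfolding M
      by (rule k.monomials_independent[OF lessI m less inj val[unfolded M]])
  qed
  have U: "(\<forall>j\<in>{1..<i}. ent_w (f i) j < ent_n (f j)) \<and>
      \<nu> (ent_P (f i) [^]\<^bsub>K\<^esub> qq f i) = \<nu> (U_elem K (\<lambda>j. ent_P (f j)) (\<lambda>j. ent_w (f j)) i)"
    if "1 \<le> i" "enat i \<le> \<Omega>" "val_index \<nu> (\<lambda>j. ent_P (f j)) i < \<infinity>" for i
    using all[OF that(2)] that(1,3) unfolding good_U_def by blast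
  have fin: "val_index \<nu> (\<lambda>j. ent_P (f j)) i < \<infinity>" if "1 \<le> i" "enat i < \<Omega>" for i
    using ns[OF that] unfolding stops_at_def by auto
  have minpol: "minimal_polynomial (res_field K \<nu>) (tow f (i - 1)) (alp f i)
      (\<one>\<^bsub>res_field K \<nu>\<^esub> # map (coeff_res f i (dd f i)) (rev [0..<dd f i]))" if "1 \<le> i" "enat i < \<Omega>" for i
    using ex[OF that] unfolding good_expr_def minimal_polynomial_def by blast
  have last: "\<Omega> = enat i" if "1 \<le> i" "enat i \<le> \<Omega>" "stp f i" for i
    using stop_ge[OF that(1,3)] that(2) by simp
  show ?thesis
  proof (rule exI[of _ \<Omega>], rule exI[of _ "\<lambda>i. ent_P (f i)"], rule exI[of _ "\<lambda>i. ent_n (f i)"],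
      rule exI[of _ "\<lambda>i. ent_len (f i)"], rule exI[of _ "\<lambda>i. ent_c (f i)"], rule exI[of _ "\<lambda>i. ent_e (f i)"],
      rule exI[of _ "\<lambda>i. dd f i"], rule exI[of _ "\<lambda>i. ent_w (f i)"],
      rule exI[of _ "\<lambda>i. coeff_res f i (dd f i)"], intro conjI allI impI ballI)
    fix i assume "1 \<le> i \<and> enat i < \<Omega>"
    then have i: "1 \<le> i" "enat i < \<Omega>" by auto
    note E = ex[OF i, unfolded good_expr_def]
    show "1 \<le> ent_n (f i)"
    proof -
      have "ent_n (f i) = qq f i * dd f i" "0 < dd f i" "0 < qq f i" using E by blast+
      then have "0 < ent_n (f i)" by simp
      then show ?thesis by simp
    qed
    show "1 \<le> ent_len (f i)" using E by blast
    show "ent_P (f (i + 1)) = ent_P (f i) [^]\<^bsub>K\<^esub> ent_n (f i) \<oplus>\<^bsub>K\<^esub>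
        (\<Oplus>\<^bsub>K\<^esub>k\<in>{1..ent_len (f i)}. ent_c (f i) k \<otimes>\<^bsub>K\<^esub>
          power_product K (\<lambda>i. ent_P (f i)) {..i} (\<lambda>s. ent_e (f i) s k))"
      unfolding PS[OF i] succ_elem_def ..
    show "ent_c (f i) k \<in> CS" "ent_c (f i) k \<noteq> \<zero>\<^bsub>R\<^esub>" "nbar \<nu> (\<lambda>i. ent_P (f i)) i dvd ent_e (f i) i k"
      "nat_mult (ent_n (f i)) (\<nu> (ent_P (f i))) = \<nu> (power_product K (\<lambda>i. ent_P (f i)) {..i} (\<lambda>s. ent_e (f i) s k))"
      if "k \<in> {1..ent_len (f i)}" for k
      using E that unfolding R_ops by blast+
    show "ent_e (f i) s k < ent_n (f s)" if "k \<in> {1..ent_len (f i)}" "s \<in> {1..i}" for k s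
      using E that by blast
    show "nat_mult (ent_n (f i)) (\<nu> (ent_P (f i))) < \<nu> (ent_P (f (i + 1)))" unfolding PS[OF i] using E by blast
    show "let M = \<lambda>l. power_product K (\<lambda>i. ent_P (f i)) {..r} (\<lambda>k. j k l) in
        enat r < \<Omega> \<and> 0 < m \<and> (\<forall>l\<in>{1..m}. \<forall>k\<in>{1..r}. j k l < ent_n (f k)) \<and>
        inj_on (\<lambda>l. map (\<lambda>k. j k l) [0..<r + 1]) {1..m} \<and> (\<forall>l\<in>{1..m}. \<nu> (M l) = \<nu> (M 1)) \<longrightarrow>
        ring.independent (res_field K \<nu>) (base_field K \<nu> R)
          (\<one>\<^bsub>res_field K \<nu>\<^esub> # map (\<lambda>l. res K \<nu> (M l \<otimes>\<^bsub>K\<^esub> inv\<^bsub>K\<^esub> M 1)) [2..<m + 1])" for r m j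
      unfolding Let_def by (intro impI, elim conjE, rule indep[OF refl, of r m j]) assumption+
    show "val_index \<nu> (\<lambda>i. ent_P (f i)) i < \<infinity>" by (rule fin[OF i])
    show "ent_n (f i) = nbar \<nu> (\<lambda>i. ent_P (f i)) i * dd f i" "0 < dd f i" using E by blast+
    show "coeff_res f i (dd f i) t = res K \<nu> (\<Oplus>\<^bsub>K\<^esub>k\<in>{k \<in> {1..ent_len (f i)}. ent_e (f i) i k = t * nbar \<nu> (\<lambda>i. ent_P (f i)) i}.
        ent_c (f i) k \<otimes>\<^bsub>K\<^esub> (power_product K (\<lambda>i. ent_P (f i)) {..<i} (\<lambda>s. ent_e (f i) s k) \<otimes>\<^bsub>K\<^esub>
          inv\<^bsub>K\<^esub> (U_elem K (\<lambda>i. ent_P (f i)) (\<lambda>i. ent_w (f i)) i [^]\<^bsub>K\<^esub> (dd f i - t))))" for t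
      unfolding coeff_res_def ..
    show "coeff_res f i (dd f i) t \<in> tow f (i - 1)" if "t < dd f i" for t using E that by blast
    show "minimal_polynomial (res_field K \<nu>) (tow f (i - 1)) (alp f i)
        (\<one>\<^bsub>res_field K \<nu>\<^esub> # map (coeff_res f i (dd f i)) (rev [0..<dd f i]))" by (rule minpol[OF i])
  next
    show "ent_w (f i) j < ent_n (f j)"
      if "1 \<le> i \<and> enat i \<le> \<Omega> \<and> val_index \<nu> (\<lambda>i. ent_P (f i)) i < \<infinity>" "j \<in> {1..<i}" for i j
      using U[of i] that by blast
    show "\<nu> (ent_P (f i) [^]\<^bsub>K\<^esub> nbar \<nu> (\<lambda>i. ent_P (f i)) i) = \<nu> (U_elem K (\<lambda>i. ent_P (f i)) (\<lambda>i. ent_w (f i)) i)"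
      if "1 \<le> i \<and> enat i \<le> \<Omega> \<and> val_index \<nu> (\<lambda>i. ent_P (f i)) i < \<infinity>" for i
      using U[of i] that by blast
  qed (use \<open>0 < \<Omega>\<close> mem P01 stop_at last in blast)+
qed

end
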